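(* Let $P$, $\Pi_I$, the piecewise Hölder function $k$, $k_0>0$, $x_0\notin\overline P$, $G$, $u_0$, the boundary value problem $(\mathcal P_1)$ and the notion of quasiclassical solution be as in the context. The problem $(\mathcal P_1)$ and the system $(\mathcal P_2)$ consisting of $$u(x)-\int_P (k^2(y)-k_0^2)\,G(x,y)\,u(y)\,dy=u_0(x),\qquad x\in P, \tag{a}$$ $$u(x)=u_0(x)+\int_P (k^2(y)-k_0^2)\,G(x,y)\,u(y)\,dy,\qquad x\in\mathbb R^3\setminus(P\cup\{x_0\}), \tag{b}$$ are equivalent in the following sense: (i) if $u$ is a quasiclassical solution to $(\mathcal P_1)$, then $u$ satisfies the integral equation (a) and the representation (b); (ii) conversely, for any solution $u\in L_2(P)$ of the integral equation (a), the total field obtained by extending $u$ to $\mathbb R^3\setminus\{x_0\}$ by formula (b) is a quasiclassical solution to $(\mathcal P_1)$.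
   Context: $P=\{x\in\mathbb R^3: a_j<x_j<b_j,\ j=1,2,3\}$ is an open rectangular parallelepiped. For a fixed integer $n\ge1$ set $x_{j,i}=a_j+\frac{b_j-a_j}{n}i$ ($0\le i\le n$), and for a multi-index $I=(i_1,i_2,i_3)$ with $0\le i_1,i_2,i_3\le n-1$ let $\Pi_I=\{x: x_{j,i_j}<x_j<x_{j,i_j+1},\ j=1,2,3\}$, with indicator function $\chi_I$. $E_P$ denotes the union of all edges of the parallelepipeds $\Pi_I$, and $\partial\Pi_I'=\partial\Pi_I\setminus E_P$. The complex-valued function $k$ on $P$ is piecewise Hölder: $k=\sum_I k_I\chi_I$ with $k_I\in C^{0,\alpha}(\Pi_I)$ for some $\alpha\in(0,1]$ (Hölder continuous on $\Pi_I$, uniformly, so that it has one-sided limits on the faces; values on the faces between sub-domains are immaterial). The homogeneous medium outside $P$ has wavenumber $k_0>0$. $G(x,y)=\dfrac{e^{ik_0|x-y|}}{4\pi|x-y|}$ and $u_0(x)=G(x,x_0)$ with a fixed $x_0\notin\overline P$; thus $(\Delta+k_0^2)u_0=-\delta(x-x_0)$. Problem $(\mathcal P_1)$: find a complex-valued function $u$ on $\mathbb R^3\setminus\{x_0\}$ such that, with scattered field $u_s=u-u_0$, 1. $(\Delta+k_I^2(x))u(x)=0$ in $\Pi_I$ for every $I$; and $(\Delta+k_0^2)u=-\delta(x-x_0)$ outside $\overline P$, i.e. $u_s$ extends to a $C^2$ function on $\mathbb R^3\setminus\overline P$ satisfying $(\Delta+k_0^2)u_s=0$ there; 2. $[u]|_{\partial\Pi_I}=0$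 and $\left[\frac{\partial u}{\partial\mathbf n}\right]\big|_{\partial\Pi_I'}=0$ for every $I$, where $[\cdot]$ is the jump across the boundary and $\mathbf n$ the unit normal; 3. $u\in H^1_{loc}(\mathbb R^3\setminus\{x_0\})$; 4. the Sommerfeld radiation condition $\frac{\partial u_s}{\partial r}=ik_0u_s+o(1/r)$ as $r=|x|\to\infty$, uniformly in directions. A quasiclassical solution is a solution $u$ of $(\mathcal P_1)$ with $$u\in C^1(\mathbb R^3\setminus\{x_0\})\cap\bigcap_I C^2(\Pi_I)\cap C^2(\mathbb R^3\setminus(\overline P\cup\{x_0\})).$$ A solution $u\in L_2(P)$ of (a) satisfies (a) almost everywhere; regularity assertions refer to the appropriate representative. *)

theory Defs
  imports "HOL-Analysis.Analysis" "HOL-Library.Landau_Symbols"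
begin

definition pd :: "3 \<Rightarrow> (real^3 \<Rightarrow> complex) \<Rightarrow> real^3 \<Rightarrow> complex" where
  "pd j f x = frechet_derivative f (at x) (axis j 1)"

text \<open>The following notions are meant for open \<open>S\<close>; they depend only on the values of
  \<open>f\<close> on \<open>S\<close>.\<close>

definition C1_on :: "(real^3) set \<Rightarrow> (real^3 \<Rightarrow> complex) \<Rightarrow> bool" where
  "C1_on S f \<longleftrightarrow> (\<forall>x\<in>S. f differentiable (at x)) \<and> (\<forall>j. continuous_on S (pd j f))"

definition C2_on :: "(real^3) set \<Rightarrow> (real^3 \<Rightarrow> complex) \<Rightarrow> bool" where
  "C2_on S f \<longleftrightarrow> C1_on S f \<and> (\<forall>j. C1_on S (pd j f))"

definition laplacian :: "(real^3 \<Rightarrow> complex) \<Rightarrow> real^3 \<Rightarrow> complex" where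
  "laplacian f x = (\<Sum>j\<in>UNIV. pd j (pd j f) x)"

definition helmholtz_on ::
    "(real^3 \<Rightarrow> complex) \<Rightarrow> (real^3) set \<Rightarrow> (real^3 \<Rightarrow> complex) \<Rightarrow> bool" where
  "helmholtz_on \<kappa> S f \<longleftrightarrow> C2_on S f \<and> (\<forall>x\<in>S. laplacian f x + (\<kappa> x)\<^sup>2 * f x = 0)"

definition holder_on :: "real \<Rightarrow> (real^3) set \<Rightarrow> (real^3 \<Rightarrow> complex) \<Rightarrow> bool" where
  "holder_on \<alpha> S f \<longleftrightarrow> (\<exists>C. \<forall>x\<in>S. \<forall>y\<in>S. dist (f x) (f y) \<le> C * dist x y powr \<alpha>)"

definition L2_on :: "(real^3) set \<Rightarrow> (real^3 \<Rightarrow> complex) \<Rightarrow> bool" where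
  "L2_on S f \<longleftrightarrow> f \<in> borel_measurable (lebesgue_on S) \<and>
     integrable (lebesgue_on S) (\<lambda>x. (norm (f x))\<^sup>2)"

text \<open>Smoothness is expressed by differentiability of all iterated partial derivatives
  (which gives their continuity).\<close>

definition test_function :: "(real^3) set \<Rightarrow> (real^3 \<Rightarrow> complex) \<Rightarrow> bool" where
  "test_function S \<phi> \<longleftrightarrow>
     (\<forall>js x. foldr pd js \<phi> differentiable (at x)) \<and>
     compact (closure {x. \<phi> x \<noteq> 0}) \<and> closure {x. \<phi> x \<noteq> 0} \<subseteq> S"

definition weak_pd_on ::
    "(real^3) set \<Rightarrow> 3 \<Rightarrow> (real^3 \<Rightarrow> complex) \<Rightarrow> (real^3 \<Rightarrow> complex) \<Rightarrow> bool" where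
  "weak_pd_on S j f g \<longleftrightarrow>
     (\<forall>\<phi>. test_function S \<phi> \<longrightarrow>
        (LINT x:S|lebesgue. f x * pd j \<phi> x) = - (LINT x:S|lebesgue. g x * \<phi> x))"

definition H1_loc_on :: "(real^3) set \<Rightarrow> (real^3 \<Rightarrow> complex) \<Rightarrow> bool" where
  "H1_loc_on S f \<longleftrightarrow>
     (\<exists>g. (\<forall>j. weak_pd_on S j f (g j)) \<and>
          (\<forall>K. compact K \<and> K \<subseteq> S \<longrightarrow> L2_on K f \<and> (\<forall>j. L2_on K (g j))))"

definition grid_index :: "nat \<Rightarrow> (nat^3) set" where
  "grid_index n = {I. \<forall>j. I $ j < n}"

definition grid_point :: "real^3 \<Rightarrow> real^3 \<Rightarrow> nat \<Rightarrow> 3 \<Rightarrow> nat \<Rightarrow> real" where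
  "grid_point a b n j i = a $ j + (b $ j - a $ j) / real n * real i"

definition cell :: "real^3 \<Rightarrow> real^3 \<Rightarrow> nat \<Rightarrow> nat^3 \<Rightarrow> (real^3) set" where
  "cell a b n I =
     {x. \<forall>j. grid_point a b n j (I $ j) < x $ j \<and> x $ j < grid_point a b n j (I $ j + 1)}"

definition grid_edges :: "real^3 \<Rightarrow> real^3 \<Rightarrow> nat \<Rightarrow> (real^3) set" where
  "grid_edges a b n = (\<Union>I\<in>grid_index n. \<Union>{e. e edge_of closure (cell a b n I)})"

text \<open>Existence of both one-sided limits is part of the notion.\<close>

definition has_jump :: "(real^3 \<Rightarrow> complex) \<Rightarrow> (real^3) set \<Rightarrow> real^3 \<Rightarrow> complex \<Rightarrow> bool" where
  "has_jump f S x v \<longleftrightarrow>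
     (\<exists>p q. (f \<longlongrightarrow> p) (at x within S) \<and> (f \<longlongrightarrow> q) (at x within - closure S) \<and> v = q - p)"

text \<open>For a box \<open>S\<close> and a boundary point \<open>x\<close> off its edges, there is exactly one such \<open>\<nu>\<close>,
  namely the outward unit normal of the face containing \<open>x\<close>.\<close>

definition unit_normal :: "(real^3) set \<Rightarrow> real^3 \<Rightarrow> real^3 \<Rightarrow> bool" where
  "unit_normal S x \<nu> \<longleftrightarrow> norm \<nu> = 1 \<and> (\<forall>y\<in>S. \<nu> \<bullet> (y - x) \<le> 0)"

text \<open>At \<open>x = y\<close> the value is 0 by the convention for division.\<close>

definition green :: "real \<Rightarrow> real^3 \<Rightarrow> real^3 \<Rightarrow> complex" where
  "green k0 x y = exp (\<i> * of_real (k0 * norm (x - y))) / of_real (4 * pi * norm (x - y))"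

definition incident :: "real \<Rightarrow> real^3 \<Rightarrow> real^3 \<Rightarrow> complex" where
  "incident k0 x0 x = green k0 x x0"

definition radiating :: "real \<Rightarrow> (real^3 \<Rightarrow> complex) \<Rightarrow> bool" where
  "radiating k0 v \<longleftrightarrow>
     (\<lambda>x. norm (frechet_derivative v (at x) (x /\<^sub>R norm x) - \<i> * of_real k0 * v x))
       \<in> o[at_infinity](\<lambda>x. 1 / norm x)"

text \<open>The equation with point source at \<open>x0\<close> in the exterior is expressed by the scattered
  field extending across \<open>x0\<close> to a solution of the homogeneous equation. The value of \<open>u\<close> at
  \<open>x0\<close> plays no role.\<close>

definition P1_solution :: "real^3 \<Rightarrow> real^3 \<Rightarrow> nat \<Rightarrow> (nat^3 \<Rightarrow> real^3 \<Rightarrow> complex) \<Rightarrow>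
    real \<Rightarrow> real^3 \<Rightarrow> (real^3 \<Rightarrow> complex) \<Rightarrow> bool" where
  "P1_solution a b n kI k0 x0 u \<longleftrightarrow>
     (\<forall>I\<in>grid_index n. helmholtz_on (kI I) (cell a b n I) u) \<and>
     (\<exists>v. (\<forall>x \<in> - (closure (box a b) \<union> {x0}). v x = u x - incident k0 x0 x) \<and>
          helmholtz_on (\<lambda>_. of_real k0) (- closure (box a b)) v) \<and>
     (\<forall>I\<in>grid_index n.
        (\<forall>x\<in>frontier (cell a b n I). has_jump u (cell a b n I) x 0) \<and>
        (\<forall>x\<in>frontier (cell a b n I) - grid_edges a b n.
           \<forall>\<nu>. unit_normal (cell a b n I) x \<nu> \<longrightarrow>
             has_jump (\<lambda>y. frechet_derivative u (at y) \<nu>) (cell a b n I) x 0)) \<and>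
     H1_loc_on (- {x0}) u \<and>
     radiating k0 (\<lambda>x. u x - incident k0 x0 x)"

definition quasiclassical :: "real^3 \<Rightarrow> real^3 \<Rightarrow> nat \<Rightarrow> (nat^3 \<Rightarrow> real^3 \<Rightarrow> complex) \<Rightarrow>
    real \<Rightarrow> real^3 \<Rightarrow> (real^3 \<Rightarrow> complex) \<Rightarrow> bool" where
  "quasiclassical a b n kI k0 x0 u \<longleftrightarrow>
     P1_solution a b n kI k0 x0 u \<and>
     C1_on (- {x0}) u \<and>
     (\<forall>I\<in>grid_index n. C2_on (cell a b n I) u) \<and>
     C2_on (- (closure (box a b) \<union> {x0})) u"

definition volume_potential :: "(real^3) set \<Rightarrow> (real^3 \<Rightarrow> complex) \<Rightarrow> real \<Rightarrow>
    (real^3 \<Rightarrow> complex) \<Rightarrow> real^3 \<Rightarrow> complex" where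
  "volume_potential P k k0 u x =
     (LINT y:P|lebesgue. ((k y)\<^sup>2 - (of_real k0)\<^sup>2) * green k0 x y * u y)"

end

theory Submission imports Defs begin

text \<open>Both directions rest on two devices. Integration by parts is done on the whole space with
  functions of bounded support, where the integral of a partial derivative vanishes
  (\<open>integral_pd_eq_0\<close>); cutoff functions take the place of boundaries, and no surface integral
  occurs. Singular kernels are limits of smooth ones: in \<open>rgreen k e\<close> the distance \<open>norm z\<close> in the
  Green function is replaced by \<open>sqrt ((norm z)\<^sup>2 + e\<^sup>2)\<close>. This kernel solves the Helmholtz
  equation up to \<open>- rdelta k e\<close>, an approximate identity (\<open>rgreen2_trace\<close>, \<open>delta_limit\<close>), and
  \<open>e\<close> tends to 0 by dominated convergence.

  From the integral equation to the boundary value problem one gains regularity step by step. The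
  density \<open>f = (k\<^sup>2 - k0\<^sup>2) * u\<close> is square integrable with bounded support, so its potential is
  continuous (\<open>L2_potential_continuous\<close>) and \<open>u\<close> has a bounded representative; then the potential
  is \<open>C\<^sup>1\<close> (\<open>potential_C1\<close>), hence \<open>f\<close> is Hoelder in every cell, and there the potential is \<open>C\<^sup>2\<close>
  and solves the inhomogeneous Helmholtz equation (\<open>potential_C2\<close>). The same lemma applies in the
  exterior, where \<open>f\<close> vanishes. The radiation condition is read off from the kernel
  (\<open>far_field_kernel\<close>), and the transmission conditions hold because the total field is \<open>C\<^sup>1\<close>.

  In the other direction the scattered field \<open>v\<close> is \<open>C\<^sup>1\<close> on the whole space and satisfies
  \<open>laplacian v = - (k0\<^sup>2 * v + f)\<close> off finitely many planes. The planes do not matter for the weak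
  form of this equation (\<open>weak_identity_across_planes\<close>), because the gradient of \<open>v\<close> is continuous
  across them. Testing with a cutoff times the regularised Green function represents \<open>v\<close> as the
  potential of \<open>f\<close> plus an integral over the shell \<open>\<rho> < norm y < 2 * \<rho>\<close> (\<open>cutoff_representation\<close>).
  Testing with a cutoff times the conjugate of \<open>v\<close> bounds the mean square of \<open>v\<close> on the shell
  (\<open>shell_energy_bound\<close>), and with the radiation condition the shell integral tends to 0 as \<open>\<rho>\<close>
  grows (\<open>radiating_representation\<close>).\<close>

section \<open>Partial derivatives\<close>

text \<open>Derivatives are recorded as families of partial derivatives, so that the
  product and chain rules produce the partial derivatives directly instead of a linear
  map.\<close>

definition has_grad :: "(real^3 \<Rightarrow> complex) \<Rightarrow> (3 \<Rightarrow> complex) \<Rightarrow> real^3 \<Rightarrow> bool" where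
  "has_grad f g x \<longleftrightarrow> (f has_derivative (\<lambda>h. \<Sum>j\<in>UNIV. (h $ j) *\<^sub>R g j)) (at x)"

lemma has_grad_frechet:
  assumes "has_grad f g x"
  shows "frechet_derivative f (at x) h = (\<Sum>j\<in>UNIV. (h $ j) *\<^sub>R g j)"
  using fun_cong[OF frechet_derivative_at[OF assms[unfolded has_grad_def]], of h] by (rule sym)

lemma has_grad_pd:
  assumes "has_grad f g x" shows "pd j f x = g j"
  unfolding pd_def has_grad_frechet[OF assms]
  by (simp add: axis_def if_distrib[of "\<lambda>t. t *\<^sub>R _"] cong: if_cong)

lemma has_grad_differentiable: "has_grad f g x \<Longrightarrow> f differentiable (at x)"
  unfolding has_grad_def differentiable_def by blast

lemma has_grad_continuous: "has_grad f g x \<Longrightarrow> isCont f x"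
  unfolding has_grad_def using has_derivative_continuous by blast

lemma differentiable_has_grad:
  assumes "f differentiable (at x)"
  shows "has_grad f (\<lambda>j. pd j f x) x"
proof -
  let ?D = "frechet_derivative f (at x)"
  have D: "(f has_derivative ?D) (at x)"
    using assms frechet_derivative_works by blast
  then have lin: "linear ?D" by (rule has_derivative_linear)
  have "?D h = (\<Sum>j\<in>UNIV. (h $ j) *\<^sub>R pd j f x)" for h
  proof -
    have "?D h = ?D (\<Sum>j\<in>UNIV. (h $ j) *\<^sub>R axis j 1)"
      using basis_expansion[of h] by (simp add: scalar_mult_eq_scaleR)
    then show ?thesis by (simp add: linear_sum[OF lin] linear_cmul[OF lin] pd_def)
  qed
  then have "?D = (\<lambda>h. \<Sum>j\<in>UNIV. (h $ j) *\<^sub>R pd j f x)" by blast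
  with D show ?thesis unfolding has_grad_def by simp
qed

lemma has_grad_cong_open:
  assumes "open S" "x \<in> S" "\<And>y. y \<in> S \<Longrightarrow> f y = f' y" "has_grad f g x"
  shows "has_grad f' g x"
  unfolding has_grad_def
  by (rule has_derivative_transform_within_open[OF assms(4)[unfolded has_grad_def] assms(1,2)])
     (rule assms(3))

lemma has_grad_const: "has_grad (\<lambda>x. c) (\<lambda>j. 0) x"
  unfolding has_grad_def by simp

lemma has_grad_add:
  "has_grad f g x \<Longrightarrow> has_grad f' g' x \<Longrightarrow> has_grad (\<lambda>x. f x + f' x) (\<lambda>j. g j + g' j) x"
  unfolding has_grad_def
  by (drule (1) has_derivative_add) (simp add: scaleR_add_right sum.distrib)

lemma has_grad_diff:
  "has_grad f g x \<Longrightarrow> has_grad f' g' x \<Longrightarrow> has_grad (\<lambda>x. f x - f' x) (\<lambda>j. g j - g' j) x"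
  unfolding has_grad_def
  by (drule (1) has_derivative_diff) (simp add: scaleR_diff_right sum_subtractf)

lemma has_grad_mult:
  "has_grad f g x \<Longrightarrow> has_grad f' g' x \<Longrightarrow>
    has_grad (\<lambda>x. f x * f' x) (\<lambda>j. f x * g' j + g j * f' x) x"
  unfolding has_grad_def
  by (drule (1) has_derivative_mult)
     (simp add: scaleR_add_right sum.distrib sum_distrib_left sum_distrib_right)

lemma has_grad_cnj: "has_grad f g x \<Longrightarrow> has_grad (\<lambda>x. cnj (f x)) (\<lambda>j. cnj (g j)) x"
  unfolding has_grad_def
  by (drule bounded_linear.has_derivative[OF bounded_linear_cnj]) simp

lemma has_grad_component: "has_grad (\<lambda>x. of_real (x $ i)) (\<lambda>j. if j = i then 1 else 0) x"
proof -
  have "((\<lambda>x::real^3. complex_of_real (x $ i)) has_derivative (\<lambda>h. of_real (h $ i))) (at x)"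
    by (intro bounded_linear.has_derivative[OF bounded_linear_of_real]
          bounded_linear.has_derivative[OF bounded_linear_vec_nth] has_derivative_ident)
  moreover have "(\<lambda>h::real^3. complex_of_real (h $ i))
      = (\<lambda>h. \<Sum>j\<in>UNIV. (h $ j) *\<^sub>R (if j = i then 1 else 0))"
    by (simp add: scaleR_conv_of_real if_distrib cong: if_cong)
  ultimately show ?thesis unfolding has_grad_def by simp
qed

lemma has_grad_compose_real:
  assumes r: "(r has_derivative (\<lambda>h. \<Sum>j\<in>UNIV. (h $ j) * r' j)) (at x)"
    and p: "(p has_vector_derivative p') (at (r x))"
  shows "has_grad (\<lambda>x. p (r x)) (\<lambda>j. of_real (r' j) * p') x"
proof -
  have "(p \<circ> r has_derivative (\<lambda>h. h *\<^sub>R p') \<circ> (\<lambda>h. \<Sum>j\<in>UNIV. (h $ j) * r' j)) (at x)"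
    using diff_chain_at[OF r p[unfolded has_vector_derivative_def]] .
  then show ?thesis
    unfolding has_grad_def o_def
    by (simp add: scaleR_sum_left scaleR_conv_of_real mult.assoc sum_distrib_right)
qed

lemma C1_onI:
  assumes "\<And>x. x \<in> S \<Longrightarrow> has_grad f (g x) x" "\<And>j. continuous_on S (\<lambda>x. g x j)"
  shows "C1_on S f"
  unfolding C1_on_def
proof (intro conjI ballI allI)
  fix j show "continuous_on S (pd j f)"
    using assms(2)[of j] by (rule continuous_on_eq) (simp add: has_grad_pd[OF assms(1)])
qed (use assms(1) has_grad_differentiable in blast)

lemma C1_on_has_grad: "C1_on S f \<Longrightarrow> x \<in> S \<Longrightarrow> has_grad f (\<lambda>j. pd j f x) x"
  unfolding C1_on_def by (blast intro: differentiable_has_grad)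

lemma C1_on_pd_continuous: "C1_on S f \<Longrightarrow> continuous_on S (pd j f)"
  unfolding C1_on_def by blast

lemma C1_on_continuous: "C1_on S f \<Longrightarrow> continuous_on S f"
  by (intro continuous_at_imp_continuous_on ballI has_grad_continuous[OF C1_on_has_grad])

lemma C1_on_subset: "C1_on S f \<Longrightarrow> T \<subseteq> S \<Longrightarrow> C1_on T f"
  unfolding C1_on_def by (meson continuous_on_subset subsetD)

lemma C2_on_subset: "C2_on S f \<Longrightarrow> T \<subseteq> S \<Longrightarrow> C2_on T f"
  unfolding C2_on_def by (meson C1_on_subset)

lemma pd_cong_open:
  assumes "open S" "x \<in> S" "\<And>y. y \<in> S \<Longrightarrow> f y = f' y"
  shows "pd j f x = pd j f' x"
proof -
  have "(f has_derivative D) (at x) \<longleftrightarrow> (f' has_derivative D) (at x)" for D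
    using has_derivative_transform_within_open[of f D x UNIV S f']
      has_derivative_transform_within_open[of f' D x UNIV S f] assms by auto
  then show ?thesis unfolding pd_def frechet_derivative_def by simp
qed

lemma C1_on_cong:
  assumes "open S" "\<And>y. y \<in> S \<Longrightarrow> f y = f' y" "C1_on S f"
  shows "C1_on S f'"
proof (rule C1_onI)
  fix x assume "x \<in> S"
  then show "has_grad f' (\<lambda>j. pd j f x) x"
    using has_grad_cong_open[of S x f f'] C1_on_has_grad[OF assms(3)] assms by simp
qed (rule C1_on_pd_continuous[OF assms(3)])

lemma C2_on_cong:
  assumes "open S" "\<And>y. y \<in> S \<Longrightarrow> f y = f' y" "C2_on S f"
  shows "C2_on S f'"
  unfolding C2_on_def
proof (intro conjI allI)
  show "C1_on S f'"
    by (rule C1_on_cong[OF assms(1,2)]) (use assms(3) in \<open>auto simp: C2_on_def\<close>)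
  fix j
  show "C1_on S (pd j f')"
  proof (rule C1_on_cong[OF assms(1)])
    show "C1_on S (pd j f)" using assms(3) unfolding C2_on_def by blast
    show "pd j f y = pd j f' y" if "y \<in> S" for y
      by (rule pd_cong_open[OF assms(1) that assms(2)])
  qed
qed

lemma laplacian_cong:
  assumes "open S" "x \<in> S" "\<And>y. y \<in> S \<Longrightarrow> f y = f' y"
  shows "laplacian f x = laplacian f' x"
proof -
  have "pd j (pd j f) x = pd j (pd j f') x" for j
    by (rule pd_cong_open[OF assms(1,2)], rule pd_cong_open[OF assms(1)]) (auto simp: assms)
  then show ?thesis unfolding laplacian_def by simp
qed

lemma C1_on_local:
  assumes "\<And>x. x \<in> S \<Longrightarrow> \<exists>T. open T \<and> x \<in> T \<and> C1_on T f"
  shows "C1_on S f"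
proof (rule C1_onI)
  fix x assume "x \<in> S"
  then show "has_grad f (\<lambda>j. pd j f x) x" using assms C1_on_has_grad by blast
next
  fix j
  have "isCont (pd j f) x" if "x \<in> S" for x
    using assms[OF that] C1_on_pd_continuous continuous_on_eq_continuous_at by blast
  then show "continuous_on S (\<lambda>x. pd j f x)"
    using continuous_at_imp_continuous_on by blast
qed

lemma C2_on_local:
  assumes "\<And>x. x \<in> S \<Longrightarrow> \<exists>T. open T \<and> x \<in> T \<and> C2_on T f"
  shows "C2_on S f"
  unfolding C2_on_def
proof (intro conjI allI)
  show "C1_on S f"
    by (rule C1_on_local) (use assms in \<open>unfold C2_on_def, blast\<close>)
  show "C1_on S (pd j f)" for j
    by (rule C1_on_local) (use assms in \<open>unfold C2_on_def, blast\<close>)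
qed

lemma C1_on_const: "C1_on S (\<lambda>x. c)"
  by (rule C1_onI[OF has_grad_const]) auto

lemma C1_on_add: "C1_on S f \<Longrightarrow> C1_on S g \<Longrightarrow> C1_on S (\<lambda>x. f x + g x)"
  by (rule C1_onI, rule has_grad_add[OF C1_on_has_grad C1_on_has_grad], assumption+)
     (intro continuous_intros C1_on_pd_continuous)

lemma C1_on_diff: "C1_on S f \<Longrightarrow> C1_on S g \<Longrightarrow> C1_on S (\<lambda>x. f x - g x)"
  by (rule C1_onI, rule has_grad_diff[OF C1_on_has_grad C1_on_has_grad], assumption+)
     (intro continuous_intros C1_on_pd_continuous)

lemma C1_on_mult: "C1_on S f \<Longrightarrow> C1_on S g \<Longrightarrow> C1_on S (\<lambda>x. f x * g x)"
  by (rule C1_onI, rule has_grad_mult[OF C1_on_has_grad C1_on_has_grad], assumption+)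
     (intro continuous_intros C1_on_pd_continuous C1_on_continuous)

lemma C1_on_cnj: "C1_on S f \<Longrightarrow> C1_on S (\<lambda>x. cnj (f x))"
  by (rule C1_onI, rule has_grad_cnj[OF C1_on_has_grad], assumption+)
     (intro continuous_intros C1_on_pd_continuous)

lemma C2_on_add:
  assumes "open S" "C2_on S f" "C2_on S g" shows "C2_on S (\<lambda>x. f x + g x)"
proof -
  have p: "pd j (\<lambda>x. f x + g x) x = pd j f x + pd j g x" if "x \<in> S" for x j
    using has_grad_pd[OF has_grad_add] C1_on_has_grad assms that unfolding C2_on_def by blast
  show ?thesis unfolding C2_on_def
  proof (intro conjI allI)
    show "C1_on S (\<lambda>x. f x + g x)"
      using assms C1_on_add unfolding C2_on_def by blast
    fix j
    have "C1_on S (\<lambda>x. pd j f x + pd j g x)"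
      using assms unfolding C2_on_def by (intro C1_on_add) auto
    then show "C1_on S (pd j (\<lambda>x. f x + g x))"
      by (rule C1_on_cong[OF assms(1), rotated]) (rule p[symmetric])
  qed
qed

lemma C2_on_diff:
  assumes "open S" "C2_on S f" "C2_on S g" shows "C2_on S (\<lambda>x. f x - g x)"
proof -
  have p: "pd j (\<lambda>x. f x - g x) x = pd j f x - pd j g x" if "x \<in> S" for x j
    using has_grad_pd[OF has_grad_diff] C1_on_has_grad assms that unfolding C2_on_def by blast
  show ?thesis unfolding C2_on_def
  proof (intro conjI allI)
    show "C1_on S (\<lambda>x. f x - g x)"
      using assms C1_on_diff unfolding C2_on_def by blast
    fix j
    have "C1_on S (\<lambda>x. pd j f x - pd j g x)"
      using assms unfolding C2_on_def by (intro C1_on_diff) auto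
    then show "C1_on S (pd j (\<lambda>x. f x - g x))"
      by (rule C1_on_cong[OF assms(1), rotated]) (rule p[symmetric])
  qed
qed

lemma laplacian_add:
  assumes "open S" "C2_on S f" "C2_on S g" "x \<in> S"
  shows "laplacian (\<lambda>x. f x + g x) x = laplacian f x + laplacian g x"
proof -
  have p: "pd j (\<lambda>x. f x + g x) x = pd j f x + pd j g x" if "x \<in> S" for x j
    using has_grad_pd[OF has_grad_add] C1_on_has_grad assms that unfolding C2_on_def by blast
  have q: "pd j (\<lambda>x. pd j f x + pd j g x) x = pd j (pd j f) x + pd j (pd j g) x" for j
    using has_grad_pd[OF has_grad_add] C1_on_has_grad assms unfolding C2_on_def by blast
  have "pd j (pd j (\<lambda>x. f x + g x)) x = pd j (pd j f) x + pd j (pd j g) x" for j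
    using pd_cong_open[of S x "pd j (\<lambda>x. f x + g x)" "\<lambda>x. pd j f x + pd j g x" j]
      assms p q by simp
  then show ?thesis unfolding laplacian_def by (simp add: sum.distrib)
qed

lemma laplacian_diff:
  assumes "open S" "C2_on S f" "C2_on S g" "x \<in> S"
  shows "laplacian (\<lambda>x. f x - g x) x = laplacian f x - laplacian g x"
proof -
  have p: "pd j (\<lambda>x. f x - g x) x = pd j f x - pd j g x" if "x \<in> S" for x j
    using has_grad_pd[OF has_grad_diff] C1_on_has_grad assms that unfolding C2_on_def by blast
  have q: "pd j (\<lambda>x. pd j f x - pd j g x) x = pd j (pd j f) x - pd j (pd j g) x" for j
    using has_grad_pd[OF has_grad_diff] C1_on_has_grad assms unfolding C2_on_def by blast
  have "pd j (pd j (\<lambda>x. f x - g x)) x = pd j (pd j f) x - pd j (pd j g) x" for j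
    using pd_cong_open[of S x "pd j (\<lambda>x. f x - g x)" "\<lambda>x. pd j f x - pd j g x" j]
      assms p q by simp
  then show ?thesis unfolding laplacian_def by (simp add: sum_subtractf)
qed

lemma norm_grad_le:
  assumes "\<And>j. norm (g j) \<le> B"
  shows "norm (\<Sum>j\<in>UNIV. (h $ j) *\<^sub>R (g j :: complex)) \<le> 3 * B * norm (h :: real^3)"
proof -
  have "norm (\<Sum>j\<in>UNIV. (h $ j) *\<^sub>R g j) \<le> (\<Sum>j\<in>(UNIV::3 set). norm h * B)"
    by (intro order.trans[OF norm_sum] sum_mono)
       (simp add: mult_mono component_le_norm_cart assms)
  then show ?thesis by (simp add: mult_ac)
qed

lemma lipschitz_of_pd_bound:
  assumes "convex S" "\<And>x. x \<in> S \<Longrightarrow> has_grad f (g x) x"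
    and "\<And>x j. x \<in> S \<Longrightarrow> norm (g x j) \<le> B" "x \<in> S" "y \<in> S"
  shows "norm (f x - f y) \<le> 3 * B * norm (x - y)"
proof (rule differentiable_bound[OF assms(1) _ _ assms(4,5)])
  fix x assume "x \<in> S"
  then show "(f has_derivative (\<lambda>h. \<Sum>j\<in>UNIV. (h $ j) *\<^sub>R g x j)) (at x within S)"
    using assms(2) unfolding has_grad_def by (blast intro: has_derivative_at_withinI)
  show "onorm (\<lambda>h. \<Sum>j\<in>UNIV. (h $ j) *\<^sub>R g x j) \<le> 3 * B"
    using norm_grad_le[of "g x" B] assms(3)[OF \<open>x \<in> S\<close>]
    by (intro onorm_le) auto
qed

lemma C1_on_lipschitz_ball:
  assumes S: "open S" "C1_on S f" and r: "cball c r \<subseteq> S"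
  obtains L where "L \<ge> 0" "\<And>x y. x \<in> ball c r \<Longrightarrow> y \<in> ball c r \<Longrightarrow> norm (f x - f y) \<le> L * norm (x - y)"
proof -
  have "\<exists>B. \<forall>x\<in>cball c r. norm (pd j f x) \<le> B" for j
  proof -
    have "bounded (pd j f ` cball c r)"
      by (intro compact_imp_bounded compact_continuous_image continuous_on_subset[OF C1_on_pd_continuous[OF S(2)] r] compact_cball)
    then show ?thesis unfolding bounded_iff by blast
  qed
  then obtain B where B: "\<And>j x. x \<in> cball c r \<Longrightarrow> norm (pd j f x) \<le> B j" by metis
  define M where "M = (\<Sum>j\<in>UNIV. \<bar>B j\<bar>)"
  have le: "norm (pd j f x) \<le> M" if "x \<in> ball c r" for x j
  proof -
    have "norm (pd j f x) \<le> \<bar>B j\<bar>" using B[of x j] that by simp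
    also have "\<dots> \<le> M" unfolding M_def by (rule member_le_sum) auto
    finally show ?thesis .
  qed
  show ?thesis
  proof (rule that[of "3 * M"])
    show "3 * M \<ge> 0" unfolding M_def by (simp add: sum_nonneg)
    fix x y assume xy: "x \<in> ball c r" "y \<in> ball c r"
    show "norm (f x - f y) \<le> 3 * M * norm (x - y)"
    proof (rule lipschitz_of_pd_bound[OF convex_ball _ le xy])
      fix x assume "x \<in> ball c r"
      then have "x \<in> S" using r by auto
      then show "has_grad f (\<lambda>j. pd j f x) x" by (rule C1_on_has_grad[OF S(2)])
    qed
  qed
qed

section \<open>Integration by parts on the whole space\<close>

lemma integrable_continuous_support:
  fixes f :: "real^3 \<Rightarrow> 'b::{banach, second_countable_topology}"
  assumes "continuous_on UNIV f" "\<And>x. R < norm x \<Longrightarrow> f x = 0"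
  shows "integrable lborel f"
proof -
  have "integrable lborel (\<lambda>x. indicator (cball 0 R) x *\<^sub>R f x)"
    using assms(1) by (intro borel_integrable_compact) (auto intro: continuous_on_subset)
  moreover have "(\<lambda>x. indicator (cball 0 R) x *\<^sub>R f x) = f"
    using assms(2) by (auto simp: indicator_def not_le)
  ultimately show ?thesis by simp
qed

lemma lborel_integral_translate:
  fixes f :: "real^3 \<Rightarrow> complex"
  assumes [measurable]: "f \<in> borel_measurable borel"
  shows "integral\<^sup>L lborel (\<lambda>x. f (x + c)) = integral\<^sup>L lborel f"
proof -
  have "integral\<^sup>L lborel f = integral\<^sup>L (distr lborel borel (\<lambda>x. c + 1 *\<^sub>R x)) f"
    using lborel_affine[of 1 c] by (simp add: density_1)
  also have "\<dots> = integral\<^sup>L lborel (\<lambda>x. f (c + 1 *\<^sub>R x))"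
    by (rule integral_distr) auto
  finally show ?thesis by (simp add: add.commute)
qed

text \<open>Translation invariance of Lebesgue measure makes the integral of every
  difference quotient of \<open>F\<close> zero. As \<open>F\<close> is Lipschitz with
  bounded support, the quotients are dominated by a multiple of the indicator of a ball,
  and their limit is the partial derivative. All integrations by parts below reduce to
  this fact; no surface integral occurs.\<close>

lemma integral_pd_eq_0:
  assumes F: "C1_on UNIV F" and R: "\<And>x. R < norm x \<Longrightarrow> F x = 0"
  shows "integral\<^sup>L lborel (pd j F) = 0"
proof -
  have cF: "continuous_on UNIV F" using F by (rule C1_on_continuous)
  have g: "has_grad F (\<lambda>j. pd j F x) x" for x using C1_on_has_grad[OF F] by simp
  have pd0: "pd i F x = 0" if "R < norm x" for i x
  proof -
    have "pd i F x = pd i (\<lambda>_. 0) x"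
      using that R by (intro pd_cong_open[of "{x. R < norm x}"]) (auto intro: open_Collect_less continuous_intros)
    then show ?thesis using has_grad_pd[OF has_grad_const] by simp
  qed
  have "\<exists>B\<ge>0. \<forall>x i. norm (pd i F x) \<le> B"
  proof -
    have "\<exists>B. \<forall>x\<in>cball 0 R. norm (pd i F x) \<le> B" for i
      using compact_imp_bounded[OF compact_continuous_image[OF
          continuous_on_subset[OF C1_on_pd_continuous[OF F, of i] subset_UNIV] compact_cball[of 0 R]]]
      unfolding bounded_iff by auto
    then obtain B where B: "\<And>i x. x \<in> cball 0 R \<Longrightarrow> norm (pd i F x) \<le> B i" by metis
    have "norm (pd i F x) \<le> (\<Sum>i\<in>UNIV. \<bar>B i\<bar>)" for i x
    proof (cases "norm x \<le> R")
      case True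
      then have "norm (pd i F x) \<le> \<bar>B i\<bar>" using B[of x i] by simp
      also have "\<dots> \<le> (\<Sum>i\<in>UNIV. \<bar>B i\<bar>)" by (rule member_le_sum) auto
      finally show ?thesis .
    qed (use pd0 in \<open>auto simp: sum_nonneg\<close>)
    moreover have "(\<Sum>i\<in>UNIV. \<bar>B i\<bar>) \<ge> 0" by (simp add: sum_nonneg)
    ultimately show ?thesis by blast
  qed
  then obtain B where B0: "B \<ge> 0" and B: "\<And>x i. norm (pd i F x) \<le> B" by blast
  let ?e = "axis j 1 :: real^3"
  define t where "t n = 1 / real (Suc n)" for n
  have t: "t n > 0" "t n \<le> 1" for n by (auto simp: t_def)
  have t0: "t \<longlonglongrightarrow> 0" unfolding t_def using LIMSEQ_inverse_real_of_nat by (simp add: inverse_eq_divide)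
  define q where "q n x = (1 / t n) *\<^sub>R (F (x + t n *\<^sub>R ?e) - F x)" for n x
  have int: "integrable lborel F" using cF R by (rule integrable_continuous_support)
  have mF: "F \<in> borel_measurable borel" using borel_measurable_continuous_onI[OF cF] .
  have "integral\<^sup>L lborel (q n) = 0" for n
  proof -
    have c: "continuous_on UNIV (\<lambda>x. F (x + t n *\<^sub>R ?e))"
      by (intro continuous_on_compose2[OF cF] continuous_intros) auto
    have "integrable lborel (\<lambda>x. F (x + t n *\<^sub>R ?e))"
    proof (rule integrable_continuous_support[OF c, of "R + 1"])
      fix x :: "real^3" assume "R + 1 < norm x"
      moreover have "norm x \<le> norm (x + t n *\<^sub>R ?e) + t n"
        using norm_triangle_ineq4[of "x + t n *\<^sub>R ?e" "t n *\<^sub>R ?e"] t[of n] by (simp add: norm_axis_1)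
      ultimately show "F (x + t n *\<^sub>R ?e) = 0" using t(2)[of n] by (intro R) simp
    qed
    then show ?thesis unfolding q_def
      using int lborel_integral_translate[OF mF, of "t n *\<^sub>R ?e"] by simp
  qed
  moreover have "(\<lambda>n. integral\<^sup>L lborel (q n)) \<longlonglongrightarrow> integral\<^sup>L lborel (pd j F)"
  proof (rule integral_dominated_convergence[where w="\<lambda>x. indicator (cball 0 (R+1)) x *\<^sub>R (3 * B)"])
    show "pd j F \<in> borel_measurable lborel"
      using borel_measurable_continuous_onI[OF C1_on_pd_continuous[OF F]] by simp
    show "q n \<in> borel_measurable lborel" for n
      unfolding q_def using mF by measurable
    show "integrable lborel (\<lambda>x::real^3. indicator (cball 0 (R+1)) x *\<^sub>R (3 * B))"
      by (intro borel_integrable_compact) auto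
    show "AE x in lborel. (\<lambda>n. q n x) \<longlonglongrightarrow> pd j F x"
    proof (rule AE_I2)
      fix x
      have l: "((\<lambda>s::real. x + s *\<^sub>R ?e) has_derivative (\<lambda>s. s *\<^sub>R ?e)) (at 0)"
        by (auto intro!: derivative_eq_intros)
      have "(F has_derivative (\<lambda>h. \<Sum>j\<in>UNIV. (h $ j) *\<^sub>R pd j F x)) (at (x + 0 *\<^sub>R ?e))"
        using g[of x] unfolding has_grad_def by simp
      from diff_chain_at[OF l this]
      have "((\<lambda>s. F (x + s *\<^sub>R ?e)) has_derivative
           (\<lambda>h. \<Sum>j\<in>UNIV. (h $ j) *\<^sub>R pd j F x) \<circ> (\<lambda>s. s *\<^sub>R ?e)) (at 0)"
        by (simp add: o_def)
      then have "((\<lambda>s. F (x + s *\<^sub>R ?e)) has_vector_derivative pd j F x) (at 0)"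
        unfolding has_vector_derivative_def o_def
        by (simp add: axis_def if_distrib[of "\<lambda>t. t *\<^sub>R _"] if_distrib[of "\<lambda>t. _ * t"] cong: if_cong)
      then have "((\<lambda>y. (1 / norm (y - 0)) *\<^sub>R (F (x + y *\<^sub>R ?e) -
          (F (x + 0 *\<^sub>R ?e) + (y - 0) *\<^sub>R pd j F x))) \<longlongrightarrow> 0) (at 0)"
        unfolding has_vector_derivative_def has_derivative_within by blast
      moreover have "filterlim t (at 0) sequentially"
        using t0 t(1) by (intro filterlim_atI) (auto simp: less_imp_neq[symmetric])
      ultimately have "(\<lambda>n. (1 / norm (t n - 0)) *\<^sub>R (F (x + t n *\<^sub>R ?e) -
          (F (x + 0 *\<^sub>R ?e) + (t n - 0) *\<^sub>R pd j F x))) \<longlonglongrightarrow> 0"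
        by (rule filterlim_compose)
      moreover have "(1 / norm (t n - 0)) *\<^sub>R (F (x + t n *\<^sub>R ?e) -
          (F (x + 0 *\<^sub>R ?e) + (t n - 0) *\<^sub>R pd j F x)) = q n x - pd j F x" for n
        using t(1)[of n] by (simp add: q_def algebra_simps)
      ultimately show "(\<lambda>n. q n x) \<longlonglongrightarrow> pd j F x"
        by (simp add: LIM_zero_iff)
    qed
    show "AE x in lborel. norm (q n x) \<le> indicator (cball 0 (R+1)) x *\<^sub>R (3 * B)" for n
    proof (rule AE_I2)
      fix x
      show "norm (q n x) \<le> indicator (cball 0 (R+1)) x *\<^sub>R (3 * B)"
      proof (cases "norm x \<le> R + 1")
        case True
        have "norm (F (x + t n *\<^sub>R ?e) - F x) \<le> 3 * B * norm ((x + t n *\<^sub>R ?e) - x)"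
          by (rule lipschitz_of_pd_bound[of UNIV F "\<lambda>x j. pd j F x"]) (use g B in auto)
        then have "norm (F (x + t n *\<^sub>R ?e) - F x) \<le> 3 * B * t n"
          using t[of n] by simp
        then show ?thesis
          using True t[of n] unfolding q_def norm_scaleR by (simp add: field_simps)
      next
        case False
        have "norm x \<le> norm (x + t n *\<^sub>R ?e) + t n"
          using norm_triangle_ineq4[of "x + t n *\<^sub>R ?e" "t n *\<^sub>R ?e"] t[of n] by (simp add: norm_axis_1)
        then show ?thesis unfolding q_def using R False t(2)[of n] by simp
      qed
    qed
  qed
  ultimately show ?thesis by (simp add: LIMSEQ_const_iff)
qed

section \<open>Limits from norm bounds\<close>

lemma LIMSEQ_of_norm_le:
  fixes f :: "nat \<Rightarrow> 'a::real_normed_vector"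
  assumes "\<And>n. norm (f n - l) \<le> c n" "c \<longlonglongrightarrow> 0"
  shows "f \<longlonglongrightarrow> l"
  using Lim_null_comparison[of "\<lambda>n. f n - l" c sequentially] assms by (simp add: LIM_zero_iff)

lemma tendsto_of_holder:
  fixes f :: "real^3 \<Rightarrow> complex"
  assumes "\<forall>\<^sub>F y in at x within S. norm (f y - f x) \<le> C * norm (y - x) powr \<alpha>" "\<alpha> > 0"
  shows "(f \<longlongrightarrow> f x) (at x within S)"
proof -
  have "((\<lambda>y. norm (y - x)) \<longlongrightarrow> norm (x - x)) (at x within S)"
    by (intro tendsto_norm tendsto_diff tendsto_ident_at tendsto_const)
  then have n0: "((\<lambda>y. norm (y - x)) \<longlongrightarrow> 0) (at x within S)" by simp
  have "((\<lambda>y. norm (y - x) powr \<alpha>) \<longlongrightarrow> 0 powr \<alpha>) (at x within S)"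
    by (rule tendsto_powr'[OF n0 tendsto_const]) (use assms(2) in auto)
  from tendsto_mult_left[OF this, of C]
  have "((\<lambda>y. C * norm (y - x) powr \<alpha>) \<longlongrightarrow> 0) (at x within S)" by simp
  from Lim_null_comparison[OF assms(1) this] show ?thesis by (simp add: LIM_zero_iff)
qed

section \<open>Radial integrals\<close>

lemma pred_ball [measurable]: "Measurable.pred borel (\<lambda>x. x \<in> ball (c :: real^3) R)"
proof -
  have "ball c R \<in> sets borel" by simp
  then show ?thesis by (simp add: pred_def)
qed

text \<open>Polar coordinates, for radial integrands only. Both measures give the
  half-line up to \<open>a\<close> the volume of the ball of radius \<open>a\<close>,
  and half-lines generate the Borel sets.\<close>

lemma distr_norm_lborel:
  "distr lborel borel (norm :: real^3 \<Rightarrow> real) =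
    density lborel (\<lambda>r. ennreal (4 * pi * r\<^sup>2) * indicator {0..} r)"
proof (rule measure_eqI_generator_eq[where E="range (\<lambda>a::real. {..a})" and \<Omega>=UNIV
      and A="\<lambda>i. {..real i}"])
  show "Int_stable (range (\<lambda>a::real. {..a}))" by (auto simp: Int_stable_def)
  show "range (\<lambda>a::real. {..a}) \<subseteq> Pow UNIV" by simp
  have b: "sets borel = sigma_sets UNIV (range (\<lambda>a::real. {..a}))"
    by (subst borel_eq_atMost) simp
  show "sets (distr lborel borel (norm :: real^3 \<Rightarrow> real)) = sigma_sets UNIV (range (\<lambda>a::real. {..a}))"
    using b by simp
  show "sets (density lborel (\<lambda>r. ennreal (4 * pi * r\<^sup>2) * indicator {0..} r))
      = sigma_sets UNIV (range (\<lambda>a::real. {..a}))"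
    using b by simp
  show "range (\<lambda>i. {..real i}) \<subseteq> range (\<lambda>a::real. {..a})" by auto
  show "(\<Union>i. {..real i}) = UNIV"
    using real_arch_simple by auto
  have eq: "emeasure (distr lborel borel (norm :: real^3 \<Rightarrow> real)) {..a} =
      (if a < 0 then 0 else ennreal (4 / 3 * pi * a ^ 3))" for a
  proof -
    have "emeasure (distr lborel borel (norm :: real^3 \<Rightarrow> real)) {..a}
       = emeasure lborel (norm -` {..a} \<inter> space lborel :: (real^3) set)"
      by (rule emeasure_distr) auto
    also have "norm -` {..a} \<inter> space lborel = (cball 0 a :: (real^3) set)"
      by (auto simp: dist_norm)
    finally show ?thesis
      by (simp add: emeasure_cball unit_ball_vol_numeral fact_numeral)
  qed
  show "emeasure (distr lborel borel (norm :: real^3 \<Rightarrow> real)) {..real i} \<noteq> \<infinity>" for i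
    unfolding eq by simp
  fix X :: "real set" assume "X \<in> range (\<lambda>a. {..a})"
  then obtain a where X: "X = {..a}" by auto
  have "emeasure (density lborel (\<lambda>r. ennreal (4 * pi * r\<^sup>2) * indicator {0..} r)) X
    = (\<integral>\<^sup>+ r. ennreal (4 * pi * r\<^sup>2) * indicator {0..} r * indicator {..a} r \<partial>lborel)"
    unfolding X by (rule emeasure_density) auto
  also have "\<dots> = (\<integral>\<^sup>+ r. ennreal (4 * pi * r\<^sup>2) * indicator {0..a} r \<partial>lborel)"
    by (intro nn_integral_cong) (auto simp: indicator_def)
  also have "\<dots> = (if a < 0 then 0 else ennreal (4 / 3 * pi * a ^ 3))"
  proof (cases "a < 0")
    case False
    have "(\<integral>\<^sup>+ r. ennreal (4 * pi * r\<^sup>2) * indicator {0..a} r \<partial>lborel)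
       = ennreal (4 / 3 * pi * a ^ 3 - 4 / 3 * pi * 0 ^ 3)"
      using False
      by (intro nn_integral_FTC_Icc) (auto intro!: derivative_eq_intros simp: power2_eq_square)
    then show ?thesis using False by simp
  qed simp
  finally show "emeasure (distr lborel borel (norm :: real^3 \<Rightarrow> real)) X =
      emeasure (density lborel (\<lambda>r. ennreal (4 * pi * r\<^sup>2) * indicator {0..} r)) X"
    using eq X by simp
qed

lemma nn_integral_radial:
  assumes [measurable]: "h \<in> borel_measurable borel"
  shows "(\<integral>\<^sup>+ z. h (norm (z :: real^3)) \<partial>lborel) =
    (\<integral>\<^sup>+ r. ennreal (4 * pi * r\<^sup>2) * indicator {0..} r * h r \<partial>lborel)"
proof -
  have "(\<integral>\<^sup>+ z. h (norm (z :: real^3)) \<partial>lborel) = (\<integral>\<^sup>+ r. h r \<partial>distr lborel borel (norm :: real^3 \<Rightarrow> real))"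
    by (rule nn_integral_distr[symmetric]) auto
  also have "\<dots> = (\<integral>\<^sup>+ r. ennreal (4 * pi * r\<^sup>2) * indicator {0..} r * h r \<partial>lborel)"
    unfolding distr_norm_lborel by (rule nn_integral_density) auto
  finally show ?thesis .
qed

text \<open>In polar coordinates the integrand is a multiple of \<open>r powr (2 -
  p)\<close>, and \<open>2 - p > -1\<close>.\<close>

lemma integrable_norm_powr_ball:
  assumes p: "p < 3"
  shows "integrable lborel (\<lambda>z::real^3. indicator (ball 0 R) z * norm z powr (- p))"
proof (cases "R \<le> 0")
  case False
  define I where "I = integral {0..R} (\<lambda>r. r powr (2 - p))"
  have hI: "((\<lambda>r. r powr (2 - p)) has_integral I) {0..R}"
    using integrable_on_powr_from_0[of "2 - p" R] p False unfolding I_def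
    by (simp add: integrable_integral)
  have hI': "((\<lambda>r. 4 * pi * r powr (2 - p)) has_integral 4 * pi * I) {0..R}"
    using has_integral_mult_right[OF hI] by simp
  have "(\<integral>\<^sup>+ z. ennreal (indicator (ball 0 R) z * norm z powr (- p)) \<partial>(lborel :: (real^3) measure))
    = (\<integral>\<^sup>+ z. (\<lambda>r. ennreal (indicator {..<R} r * r powr (- p))) (norm (z::real^3)) \<partial>lborel)"
    by (intro nn_integral_cong) (auto simp: indicator_def dist_norm)
  also have "\<dots> = (\<integral>\<^sup>+ r. ennreal (4 * pi * r\<^sup>2) * indicator {0..} r *
      ennreal (indicator {..<R} r * r powr (- p)) \<partial>lborel)"
    by (rule nn_integral_radial) measurable
  also have "\<dots> \<le> (\<integral>\<^sup>+ r. ennreal (indicator {0..R} r * (4 * pi * r powr (2 - p))) \<partial>lborel)"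
  proof (intro nn_integral_mono)
    fix r :: real
    have "r\<^sup>2 * r powr (- p) = r powr (2 - p)" if "r \<ge> 0"
      using that by (cases "r = 0") (auto simp: powr_diff powr_minus_divide)
    then show "ennreal (4 * pi * r\<^sup>2) * indicator {0..} r * ennreal (indicator {..<R} r * r powr (- p))
      \<le> ennreal (indicator {0..R} r * (4 * pi * r powr (2 - p)))"
      by (auto simp: indicator_def ennreal_mult'[symmetric] mult.assoc)
  qed
  also have "\<dots> = ennreal (4 * pi * I)"
    by (rule nn_integral_has_integral_lebesgue[OF _ hI']) auto
  finally have fin: "(\<integral>\<^sup>+ z. ennreal (indicator (ball 0 R) z * norm z powr (- p)) \<partial>(lborel :: (real^3) measure)) < \<infinity>"
    by (rule le_less_trans) simp
  show ?thesis
  proof (rule integrableI_nonneg)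
    show "(\<lambda>z::real^3. indicator (ball 0 R) z * norm z powr (- p)) \<in> borel_measurable lborel"
      by measurable
  qed (use fin in auto)
next
  case True
  then have "(\<lambda>z::real^3. indicator (ball 0 R) z * norm z powr (- p)) = (\<lambda>z. 0)"
  proof -
    have "\<not> norm z < R" for z :: "real^3" using True norm_ge_zero[of z] by linarith
    then show ?thesis by (simp add: fun_eq_iff indicator_def)
  qed
  then show ?thesis by simp
qed

text \<open>In polar coordinates the integrand becomes the derivative of \<open>(r /
  sqrt (r\<^sup>2 + e\<^sup>2)) ^ 3\<close>. This function is the leading part of the
  approximate identity \<open>rdelta\<close> below; its mass on a ball tends to 1 as
  \<open>e\<close> tends to 0.\<close>

lemma integral_delta_profile:
  assumes e: "e > 0" and R: "R > 0"
  shows "integrable lborel (\<lambda>z::real^3. indicator (ball 0 R) z * (3 * e\<^sup>2 / (4 * pi * sqrt ((norm z)\<^sup>2 + e\<^sup>2) ^ 5)))"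
    and "integral\<^sup>L lborel (\<lambda>z::real^3. indicator (ball 0 R) z * (3 * e\<^sup>2 / (4 * pi * sqrt ((norm z)\<^sup>2 + e\<^sup>2) ^ 5)))
      = (R / sqrt (R\<^sup>2 + e\<^sup>2)) ^ 3"
proof -
  let ?g = "\<lambda>r. 3 * e\<^sup>2 / (4 * pi * sqrt (r\<^sup>2 + e\<^sup>2) ^ 5)"
  let ?f = "\<lambda>z::real^3. indicator (ball 0 R) z * ?g (norm z)"
  have pos: "r\<^sup>2 + e\<^sup>2 > 0" for r using e by (simp add: add_nonneg_pos)
  have "(\<integral>\<^sup>+ z. ennreal (?f z) \<partial>lborel)
    = (\<integral>\<^sup>+ z. (\<lambda>r. ennreal (indicator {..<R} r * ?g r)) (norm (z::real^3)) \<partial>lborel)"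
    by (intro nn_integral_cong) (auto simp: indicator_def dist_norm)
  also have "\<dots> = (\<integral>\<^sup>+ r. ennreal (4 * pi * r\<^sup>2) * indicator {0..} r *
      ennreal (indicator {..<R} r * ?g r) \<partial>lborel)"
    by (rule nn_integral_radial) measurable
  also have "\<dots> = (\<integral>\<^sup>+ r. ennreal (3 * (r / sqrt (r\<^sup>2 + e\<^sup>2))\<^sup>2 * (e\<^sup>2 / sqrt (r\<^sup>2 + e\<^sup>2) ^ 3)) * indicator {0..R} r \<partial>lborel)"
  proof (intro nn_integral_cong_AE)
    have "AE r in lborel. r \<noteq> R" by (rule AE_lborel_singleton)
    then show "AE r in lborel. ennreal (4 * pi * r\<^sup>2) * indicator {0..} r *
      ennreal (indicator {..<R} r * ?g r) = ennreal (3 * (r / sqrt (r\<^sup>2 + e\<^sup>2))\<^sup>2 * (e\<^sup>2 / sqrt (r\<^sup>2 + e\<^sup>2) ^ 3)) * indicator {0..R} r"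
    proof eventually_elim
      case (elim r)
      have "4 * pi * r\<^sup>2 * ?g r = 3 * (r / sqrt (r\<^sup>2 + e\<^sup>2))\<^sup>2 * (e\<^sup>2 / sqrt (r\<^sup>2 + e\<^sup>2) ^ 3)"
      proof -
        obtain s where s: "s = sqrt (r\<^sup>2 + e\<^sup>2)" by simp
        with pos[of r] have "s > 0" by simp
        then show ?thesis unfolding s[symmetric] by (simp add: field_simps eval_nat_numeral)
      qed
      with elim show ?case by (auto simp: indicator_def ennreal_mult'[symmetric])
    qed
  qed
  also have "\<dots> = ennreal ((R / sqrt (R\<^sup>2 + e\<^sup>2)) ^ 3 - (0 / sqrt (0\<^sup>2 + e\<^sup>2)) ^ 3)"
  proof (rule nn_integral_FTC_Icc)
    fix r :: real
    let ?s = "sqrt (r\<^sup>2 + e\<^sup>2)"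
    have s: "?s > 0" using pos by simp
    have s2: "?s * ?s = r\<^sup>2 + e\<^sup>2" using pos[of r] by simp
    have "((\<lambda>r. (r / sqrt (r\<^sup>2 + e\<^sup>2)) ^ 3) has_real_derivative
       3 * (r / ?s)\<^sup>2 * ((1 * ?s - r * ((2 * r) * (inverse ?s / 2))) / (?s * ?s))) (at r)"
      using pos[of r] s by (auto intro!: derivative_eq_intros)
    moreover have "(1 * ?s - r * ((2 * r) * (inverse ?s / 2))) / (?s * ?s) = e\<^sup>2 / ?s ^ 3"
    proof -
      have "(1 * ?s - r * ((2 * r) * (inverse ?s / 2))) = (?s * ?s - r\<^sup>2) / ?s"
      proof -
        obtain w where w: "w = ?s" by simp
        then have "w > 0" using s by simp
        then show ?thesis unfolding w[symmetric] by (simp add: field_simps power2_eq_square)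
      qed
      also have "\<dots> = e\<^sup>2 / ?s" unfolding s2 by simp
      finally show ?thesis by (simp add: power3_eq_cube)
    qed
    ultimately show "((\<lambda>r. (r / sqrt (r\<^sup>2 + e\<^sup>2)) ^ 3) has_real_derivative
       3 * (r / ?s)\<^sup>2 * (e\<^sup>2 / ?s ^ 3)) (at r)" by (simp only:)
  qed (use R in auto)
  finally have *: "(\<integral>\<^sup>+ z. ennreal (?f z) \<partial>lborel) = ennreal ((R / sqrt (R\<^sup>2 + e\<^sup>2)) ^ 3)" by simp
  show "integrable lborel ?f"
  proof (rule integrableI_nonneg)
    show "?f \<in> borel_measurable lborel" by measurable
  qed (use * in auto)
  show "integral\<^sup>L lborel ?f = (R / sqrt (R\<^sup>2 + e\<^sup>2)) ^ 3"
  proof (subst integral_eq_nn_integral)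
    show "?f \<in> borel_measurable lborel" by measurable
    show "AE z in lborel. 0 \<le> ?f z" by simp
    show "enn2real (\<integral>\<^sup>+ z. ennreal (?f z) \<partial>lborel) = (R / sqrt (R\<^sup>2 + e\<^sup>2)) ^ 3"
      unfolding * using R by (intro enn2real_ennreal) auto
  qed
qed

text \<open>Dominated convergence with an integrable power of the norm as majorant.
  Every passage from a regularised kernel to a singular one is an instance.\<close>

lemma kernel_L1_limit:
  fixes K :: "nat \<Rightarrow> real^3 \<Rightarrow> complex" and K' :: "real^3 \<Rightarrow> complex"
  assumes p: "p < 3"
    and [measurable]: "\<And>n. K n \<in> borel_measurable borel" "K' \<in> borel_measurable borel"
    and bd: "\<And>n z. z \<noteq> 0 \<Longrightarrow> norm z < R \<Longrightarrow> norm (K n z) \<le> C * norm z powr (- p)"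
    and lim: "\<And>z. z \<noteq> 0 \<Longrightarrow> norm z < R \<Longrightarrow> (\<lambda>n. K n z) \<longlonglongrightarrow> K' z"
  shows "integrable lborel (\<lambda>z. indicator (ball 0 R) z * norm (K' z))"
    and "integrable lborel (\<lambda>z. indicator (ball 0 R) z * norm (K n z))"
    and "integrable lborel (\<lambda>z. indicator (ball 0 R) z * norm (K n z - K' z))"
    and "(\<lambda>n. LINT z|lborel. indicator (ball 0 R) z * norm (K n z - K' z)) \<longlonglongrightarrow> 0"
proof -
  have i: "integrable lborel (\<lambda>z::real^3. C * (indicator (ball 0 R) z * norm z powr (- p)))"
    using integrable_norm_powr_ball[OF p] by simp
  have nz: "AE z in lborel. z \<noteq> (0 :: real^3)" by (rule AE_lborel_singleton)
  have bd': "norm (K' z) \<le> C * norm z powr (- p)" if "z \<noteq> 0" "norm z < R" for z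
    by (rule LIMSEQ_le_const2[OF tendsto_norm[OF lim[OF that]]]) (use bd that in auto)
  show i1: "integrable lborel (\<lambda>z. indicator (ball 0 R) z * norm (K' z))"
    by (rule Bochner_Integration.integrable_bound[OF i])
       (use nz bd' in \<open>auto elim!: eventually_mono simp: indicator_def intro: order.trans[OF _ abs_ge_self]\<close>)
  show i2: "integrable lborel (\<lambda>z. indicator (ball 0 R) z * norm (K n z))" for n
    by (rule Bochner_Integration.integrable_bound[OF i])
       (use nz bd in \<open>auto elim!: eventually_mono simp: indicator_def intro: order.trans[OF _ abs_ge_self]\<close>)
  show "integrable lborel (\<lambda>z. indicator (ball 0 R) z * norm (K n z - K' z))"
  proof (rule Bochner_Integration.integrable_bound[OF Bochner_Integration.integrable_add[OF i2 i1]])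
    show "AE z in lborel. norm (indicator (ball 0 R) z * norm (K n z - K' z)) \<le>
      norm (indicator (ball 0 R) z * norm (K n z) + indicator (ball 0 R) z * norm (K' z))"
      by (rule AE_I2) (auto simp: indicator_def norm_triangle_ineq4)
  qed measurable
  have "(\<lambda>n. LINT z|lborel. indicator (ball 0 R) z * norm (K n z - K' z)) \<longlonglongrightarrow> (LINT z|(lborel::(real^3) measure). 0)"
  proof (rule integral_dominated_convergence[where w="\<lambda>z. 2 * (C * (indicator (ball 0 R) z * norm z powr (- p)))"])
    show "AE z in lborel. (\<lambda>n. indicator (ball 0 R) z * norm (K n z - K' z)) \<longlonglongrightarrow> 0"
      using nz
    proof eventually_elim
      case (elim z)
      show ?case
      proof (cases "norm z < R")
        case True
        then show ?thesis using lim[OF elim True]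
          by (simp add: indicator_def tendsto_norm_zero_iff LIM_zero_iff)
      qed (simp add: indicator_def)
    qed
    show "AE z in lborel. norm (indicator (ball 0 R) z * norm (K n z - K' z))
        \<le> 2 * (C * (indicator (ball 0 R) z * norm z powr (- p)))" for n
      using nz
    proof eventually_elim
      case (elim z)
      then show ?case
        using norm_triangle_ineq4[of "K n z" "K' z"] bd[of z n] bd'[of z]
        by (auto simp: indicator_def)
    qed
    show "(\<lambda>z. indicator (ball 0 R) z * norm (K n z - K' z)) \<in> borel_measurable lborel" for n
      by measurable
  qed (use i in auto)
  then show "(\<lambda>n. LINT z|lborel. indicator (ball 0 R) z * norm (K n z - K' z)) \<longlonglongrightarrow> 0" by simp
qed

section \<open>The regularised Green function\<close>

text \<open>A smooth substitute for the norm. As it is at least \<open>norm z\<close>,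
  all bounds for the kernels below are uniform in \<open>e\<close>.\<close>

definition regrad :: "real \<Rightarrow> real^3 \<Rightarrow> real" where
  "regrad e z = sqrt ((norm z)\<^sup>2 + e\<^sup>2)"

text \<open>The Green function in terms of the radius \<open>s\<close>;
  \<open>profile1\<close> and \<open>profile2\<close> arise from it by applying
  \<open>(1 / s) d/ds\<close> once and twice.\<close>

definition profile0 :: "real \<Rightarrow> real \<Rightarrow> complex" where
  "profile0 k s = exp (\<i> * of_real (k * s)) / of_real (4 * pi * s)"

definition profile1 :: "real \<Rightarrow> real \<Rightarrow> complex" where
  "profile1 k s = exp (\<i> * of_real (k * s)) * (\<i> * of_real (k * s) - 1) / of_real (4 * pi * s ^ 3)"

definition profile2 :: "real \<Rightarrow> real \<Rightarrow> complex" where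
  "profile2 k s = exp (\<i> * of_real (k * s)) * (3 - 3 * \<i> * of_real (k * s) - of_real ((k * s)\<^sup>2))
      / of_real (4 * pi * s ^ 5)"

text \<open>The gradient of \<open>regrad e\<close> at \<open>z\<close> is \<open>z /
  regrad e z\<close>, so differentiating a profile in \<open>z\<close> means applying
  \<open>(1 / s) d/ds\<close> and multiplying by a coordinate. Hence
  \<open>rgreen1\<close> and \<open>rgreen2\<close> are the first and second partial
  derivatives of \<open>rgreen\<close>; for \<open>e = 0\<close> and \<open>z \<noteq>
  0\<close> they are those of the Green function itself.\<close>

definition rgreen :: "real \<Rightarrow> real \<Rightarrow> real^3 \<Rightarrow> complex" where
  "rgreen k e z = profile0 k (regrad e z)"

definition rgreen1 :: "real \<Rightarrow> real \<Rightarrow> 3 \<Rightarrow> real^3 \<Rightarrow> complex" where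
  "rgreen1 k e j z = of_real (z $ j) * profile1 k (regrad e z)"

definition rgreen2 :: "real \<Rightarrow> real \<Rightarrow> 3 \<Rightarrow> 3 \<Rightarrow> real^3 \<Rightarrow> complex" where
  "rgreen2 k e i j z = (if i = j then profile1 k (regrad e z) else 0) +
      of_real (z $ i) * of_real (z $ j) * profile2 k (regrad e z)"

text \<open>The defect of \<open>rgreen k e\<close> in the Helmholtz equation, which
  approximates the Dirac measure at the origin.\<close>

definition rdelta :: "real \<Rightarrow> real \<Rightarrow> real^3 \<Rightarrow> complex" where
  "rdelta k e z = of_real (e\<^sup>2) * profile2 k (regrad e z)"

lemma profile0_deriv:
  assumes "s > 0"
  shows "(profile0 k has_vector_derivative of_real s * profile1 k s) (at s)"
proof -
  have 1: "((\<lambda>w. exp (\<i> * (of_real k * w)) / (of_real (4 * pi) * w)) has_field_derivative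
      (exp (\<i> * of_real (k * s)) * (\<i> * of_real k) * (of_real (4 * pi) * of_real s) -
       exp (\<i> * of_real (k * s)) * of_real (4 * pi)) / (of_real (4 * pi) * of_real s)\<^sup>2) (at (complex_of_real s))"
    using assms by (auto intro!: derivative_eq_intros simp: power2_eq_square)
  have e: "(exp (\<i> * of_real (k * s)) * (\<i> * of_real k) * (of_real (4 * pi) * of_real s) -
       exp (\<i> * of_real (k * s)) * of_real (4 * pi)) / (of_real (4 * pi) * of_real s)\<^sup>2
     = of_real s * profile1 k s"
    using assms unfolding profile1_def by (simp add: field_simps power2_eq_square power3_eq_cube)
  show ?thesis
    using has_vector_derivative_real_field[OF 1[unfolded e]] unfolding profile0_def by simp
qed

lemma profile1_deriv:
  assumes "s > 0"
  shows "(profile1 k has_vector_derivative of_real s * profile2 k s) (at s)"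
proof -
  let ?E = "exp (\<i> * of_real (k * s))"
  have 1: "((\<lambda>w. exp (\<i> * (of_real k * w)) * (\<i> * (of_real k * w) - 1) / (of_real (4 * pi) * w ^ 3)) has_field_derivative
      ((?E * (\<i> * of_real k) * (\<i> * of_real (k * s) - 1) + ?E * (\<i> * of_real k)) * (of_real (4 * pi) * of_real s ^ 3) -
       (?E * (\<i> * of_real (k * s) - 1)) * (of_real (4 * pi) * (3 * of_real s ^ 2))) / (of_real (4 * pi) * of_real s ^ 3)\<^sup>2)
       (at (complex_of_real s))"
    using assms by (auto intro!: derivative_eq_intros simp: power2_eq_square algebra_simps)
  have e: "((?E * (\<i> * of_real k) * (\<i> * of_real (k * s) - 1) + ?E * (\<i> * of_real k)) * (of_real (4 * pi) * of_real s ^ 3) -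
       (?E * (\<i> * of_real (k * s) - 1)) * (of_real (4 * pi) * (3 * of_real s ^ 2))) / (of_real (4 * pi) * of_real s ^ 3)\<^sup>2
     = of_real s * profile2 k s"
  proof -
    obtain E where E: "E = ?E" by simp
    have "\<i> * \<i> = (-1 :: complex)" by simp
    show ?thesis
      using assms unfolding profile2_def E[symmetric]
      by (simp add: field_simps eval_nat_numeral)
  qed
  show ?thesis
    using has_vector_derivative_real_field[OF 1[unfolded e]] unfolding profile1_def by simp
qed

lemma regrad_nonneg [simp]: "regrad e z \<ge> 0"
  unfolding regrad_def by simp

lemma norm_le_regrad: "norm z \<le> regrad e z"
  unfolding regrad_def by (rule real_le_rsqrt) simp

lemma regrad_le: "e \<ge> 0 \<Longrightarrow> regrad e z \<le> norm z + e"
  unfolding regrad_def by (rule real_le_lsqrt) (auto simp: power2_sum)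

lemma regrad_pos: "e > 0 \<or> z \<noteq> 0 \<Longrightarrow> regrad e z > 0"
  unfolding regrad_def by (auto simp: add_nonneg_pos add_pos_nonneg)

lemma regrad_0 [simp]: "regrad 0 z = norm z"
  unfolding regrad_def by simp

lemma regrad_has_derivative:
  assumes "regrad e z > 0"
  shows "(regrad e has_derivative (\<lambda>h. \<Sum>j\<in>UNIV. (h $ j) * (z $ j / regrad e z))) (at z)"
proof -
  have p: "(norm z)\<^sup>2 + e\<^sup>2 > 0" using assms unfolding regrad_def by simp
  then have p': "z \<bullet> z + e\<^sup>2 > 0" by (simp add: power2_norm_eq_inner)
  have "((\<lambda>z. sqrt (z \<bullet> z + e\<^sup>2)) has_derivative
      (\<lambda>h. inverse (sqrt (z \<bullet> z + e\<^sup>2)) / 2 * (z \<bullet> h + h \<bullet> z))) (at z)"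
    using p' by (auto intro!: derivative_eq_intros)
  moreover have "(\<lambda>z. sqrt (z \<bullet> z + e\<^sup>2)) = regrad e"
    unfolding regrad_def by (simp add: power2_norm_eq_inner)
  moreover have "inverse (sqrt (z \<bullet> z + e\<^sup>2)) / 2 * (z \<bullet> h + h \<bullet> z)
      = (\<Sum>j\<in>UNIV. (h $ j) * (z $ j / regrad e z))" for h
  proof -
    have "inverse (sqrt (z \<bullet> z + e\<^sup>2)) / 2 * (z \<bullet> h + h \<bullet> z) = (h \<bullet> z) / regrad e z"
      unfolding regrad_def power2_norm_eq_inner by (simp add: inner_commute field_simps)
    then show ?thesis by (simp add: inner_vec_def sum_divide_distrib)
  qed
  ultimately show ?thesis by simp
qed

lemma rgreen_has_grad:
  assumes "e > 0 \<or> z \<noteq> 0"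
  shows "has_grad (rgreen k e) (\<lambda>j. rgreen1 k e j z) z"
proof -
  note s = regrad_pos[OF assms]
  have "has_grad (\<lambda>z. profile0 k (regrad e z))
     (\<lambda>j. of_real (z $ j / regrad e z) * (of_real (regrad e z) * profile1 k (regrad e z))) z"
    by (rule has_grad_compose_real[OF regrad_has_derivative[OF s] profile0_deriv[OF s]])
  then show ?thesis using s unfolding rgreen_def rgreen1_def by simp
qed

lemma profile1_has_grad:
  assumes "e > 0 \<or> z \<noteq> 0"
  shows "has_grad (\<lambda>z. profile1 k (regrad e z)) (\<lambda>j. of_real (z $ j) * profile2 k (regrad e z)) z"
proof -
  note s = regrad_pos[OF assms]
  have "has_grad (\<lambda>z. profile1 k (regrad e z))
     (\<lambda>j. of_real (z $ j / regrad e z) * (of_real (regrad e z) * profile2 k (regrad e z))) z"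
    by (rule has_grad_compose_real[OF regrad_has_derivative[OF s] profile1_deriv[OF s]])
  then show ?thesis using s by simp
qed

lemma rgreen1_has_grad:
  assumes "e > 0 \<or> z \<noteq> 0"
  shows "has_grad (rgreen1 k e j) (\<lambda>i. rgreen2 k e i j z) z"
proof -
  have "(\<lambda>i. of_real (z $ j) * (of_real (z $ i) * profile2 k (regrad e z)) +
      (if i = j then 1 else 0) * profile1 k (regrad e z)) = (\<lambda>i. rgreen2 k e i j z)"
    unfolding rgreen2_def by auto
  then show ?thesis
    using has_grad_mult[OF has_grad_component[of j z] profile1_has_grad[OF assms, of k]]
    unfolding rgreen1_def by simp
qed

text \<open>The radial form of the Helmholtz equation is \<open>3 * profile1 k s +
  s\<^sup>2 * profile2 k s = - k\<^sup>2 * profile0 k s\<close>. The trace contains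
  \<open>(norm z)\<^sup>2 = s\<^sup>2 - e\<^sup>2\<close> in place of
  \<open>s\<^sup>2\<close>, and the difference is \<open>rdelta\<close>.\<close>

lemma rgreen2_trace:
  assumes "e > 0 \<or> z \<noteq> 0"
  shows "(\<Sum>j\<in>UNIV. rgreen2 k e j j z) = - (of_real k)\<^sup>2 * rgreen k e z - rdelta k e z"
proof -
  obtain s where s: "s = regrad e z" and s0: "s > 0" using regrad_pos[OF assms] by simp
  have r2: "(\<Sum>j\<in>UNIV. complex_of_real (z $ j) * of_real (z $ j)) = of_real (s\<^sup>2 - e\<^sup>2)"
  proof -
    have "s\<^sup>2 = (norm z)\<^sup>2 + e\<^sup>2" unfolding s regrad_def by simp
    then have "s\<^sup>2 - e\<^sup>2 = (\<Sum>j\<in>UNIV. z $ j * z $ j)"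
      using power2_norm_eq_inner[of z] by (simp add: inner_vec_def)
    then show ?thesis by (simp only: of_real_mult[symmetric] of_real_sum[symmetric])
  qed
  have "(\<Sum>j\<in>UNIV. rgreen2 k e j j z) = 3 * profile1 k s + of_real (s\<^sup>2 - e\<^sup>2) * profile2 k s"
    unfolding rgreen2_def s[symmetric] r2[symmetric] by (simp add: sum.distrib sum_distrib_right)
  also have "\<dots> = (3 * profile1 k s + of_real (s\<^sup>2) * profile2 k s) - of_real (e\<^sup>2) * profile2 k s"
    by (simp add: algebra_simps)
  also have "3 * profile1 k s + of_real (s\<^sup>2) * profile2 k s = - (of_real k)\<^sup>2 * profile0 k s"
  proof -
    obtain E where E: "E = exp (\<i> * of_real (k * s))" by simp
    show ?thesis
      using s0 unfolding profile0_def profile1_def profile2_def E[symmetric]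
      by (simp add: field_simps eval_nat_numeral)
  qed
  finally show ?thesis unfolding rgreen_def rdelta_def s .
qed

lemma profile_continuous:
  shows "continuous_on {0<..} (profile0 k)" "continuous_on {0<..} (profile1 k)"
    "continuous_on {0<..} (profile2 k)"
  unfolding profile0_def profile1_def profile2_def by (auto intro!: continuous_intros)

lemma regrad_continuous: "continuous_on S (\<lambda>z. regrad e z)"
  unfolding regrad_def by (intro continuous_intros)

lemma profile_regrad_continuous:
  assumes "\<And>z. z \<in> S \<Longrightarrow> e > 0 \<or> z \<noteq> 0"
  shows "continuous_on S (\<lambda>z. profile0 k (regrad e z))"
    "continuous_on S (\<lambda>z. profile1 k (regrad e z))"
    "continuous_on S (\<lambda>z. profile2 k (regrad e z))"
  using assms regrad_pos
  by (auto intro!: continuous_on_compose2[OF profile_continuous(1)]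
      continuous_on_compose2[OF profile_continuous(2)]
      continuous_on_compose2[OF profile_continuous(3)] regrad_continuous)

lemma rgreen_continuous:
  assumes "\<And>z. z \<in> S \<Longrightarrow> e > 0 \<or> z \<noteq> 0"
  shows "continuous_on S (rgreen k e)" "continuous_on S (rgreen1 k e j)"
    "continuous_on S (rgreen2 k e i j)" "continuous_on S (rdelta k e)"
  unfolding rgreen_def[abs_def] rgreen1_def[abs_def] rgreen2_def[abs_def] rdelta_def[abs_def]
  using profile_regrad_continuous[OF assms, of S]
  by (cases "i = j"; auto intro!: continuous_intros)+

lemma rgreen_C2:
  assumes "open S" "\<And>z. z \<in> S \<Longrightarrow> e > 0 \<or> z \<noteq> 0"
  shows "C2_on S (rgreen k e)" "\<And>z j. z \<in> S \<Longrightarrow> pd j (rgreen k e) z = rgreen1 k e j z"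
    "\<And>j. C1_on S (rgreen1 k e j)" "\<And>z i j. z \<in> S \<Longrightarrow> pd i (rgreen1 k e j) z = rgreen2 k e i j z"
    "\<And>z. z \<in> S \<Longrightarrow> laplacian (rgreen k e) z = - (of_real k)\<^sup>2 * rgreen k e z - rdelta k e z"
proof -
  note c = rgreen_continuous[where S=S and e=e, OF assms(2)]
  show p1: "pd j (rgreen k e) z = rgreen1 k e j z" if "z \<in> S" for z j
    using has_grad_pd[OF rgreen_has_grad] assms(2) that by simp
  show p2: "pd i (rgreen1 k e j) z = rgreen2 k e i j z" if "z \<in> S" for z i j
    using has_grad_pd[OF rgreen1_has_grad] assms(2) that by simp
  have C: "C1_on S (rgreen k e)"
    by (rule C1_onI[where g="\<lambda>z j. rgreen1 k e j z"]) (use assms(2) rgreen_has_grad c in auto)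
  show C1: "C1_on S (rgreen1 k e j)" for j
    by (rule C1_onI[where g="\<lambda>z i. rgreen2 k e i j z"]) (use assms(2) rgreen1_has_grad c in auto)
  show "C2_on S (rgreen k e)"
    unfolding C2_on_def
  proof (intro conjI allI C)
    show "C1_on S (pd j (rgreen k e))" for j
      by (rule C1_on_cong[OF assms(1) _ C1]) (simp add: p1)
  qed
  show "laplacian (rgreen k e) z = - (of_real k)\<^sup>2 * rgreen k e z - rdelta k e z" if z: "z \<in> S" for z
  proof -
    have "pd j (pd j (rgreen k e)) z = rgreen2 k e j j z" for j
      using pd_cong_open[of S z "pd j (rgreen k e)" "rgreen1 k e j" j] assms(1) z p1 p2[OF z] by simp
    then show ?thesis
      unfolding laplacian_def using rgreen2_trace[of e z k] assms(2)[OF z] by simp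
  qed
qed

lemma profile_bounds:
  assumes "0 < r" "r \<le> s" "s \<le> S" "k \<ge> 0"
  shows "norm (profile0 k s) \<le> 1 / r" "norm (profile1 k s) \<le> (3 + 3 * k * S + (k * S)\<^sup>2) / r ^ 3"
    "norm (profile2 k s) \<le> (3 + 3 * k * S + (k * S)\<^sup>2) / s ^ 5"
proof -
  have s: "s > 0" using assms by simp
  have k: "0 \<le> k * s" "k * s \<le> k * S" "(k * s)\<^sup>2 \<le> (k * S)\<^sup>2"
    using assms by (auto intro!: mult_left_mono power_mono mult_nonneg_nonneg)
  have E: "norm (exp (\<i> * of_real (k * s))) = 1" by (simp only: norm_exp_i_times)
  have pi: "4 * pi \<ge> 1" using pi_ge_two by simp
  have "norm (profile0 k s) = 1 / (4 * pi * s)"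
    unfolding profile0_def norm_divide E norm_of_real using s by simp
  also have "\<dots> \<le> 1 / r"
    using assms pi s mult_mono[of 1 "4 * pi" r s] by (intro divide_left_mono) auto
  finally show "norm (profile0 k s) \<le> 1 / r" .
  have "norm (profile1 k s) = norm (\<i> * of_real (k * s) - 1) / (4 * pi * s ^ 3)"
    unfolding profile1_def norm_divide norm_mult E norm_of_real using s by simp
  also have "\<dots> \<le> (3 + 3 * k * S + (k * S)\<^sup>2) / r ^ 3"
  proof (rule frac_le)
    have "norm (\<i> * of_real (k * s) - 1) \<le> \<bar>k * s\<bar> + 1"
      by (rule order.trans[OF norm_triangle_ineq4]) (simp add: norm_mult)
    then show "norm (\<i> * of_real (k * s) - 1) \<le> 3 + 3 * k * S + (k * S)\<^sup>2"
      using k zero_le_power2[of "k * S"] by linarith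
    show "r ^ 3 \<le> 4 * pi * s ^ 3"
      using mult_mono[OF pi power_mono[OF assms(2), of 3]] assms by simp
  qed (use assms k in auto)
  finally show "norm (profile1 k s) \<le> (3 + 3 * k * S + (k * S)\<^sup>2) / r ^ 3" .
  have "norm (profile2 k s) = norm (3 - 3 * \<i> * of_real (k * s) - of_real ((k * s)\<^sup>2)) / (4 * pi * s ^ 5)"
    unfolding profile2_def norm_divide norm_mult E norm_of_real using s by simp
  also have "\<dots> \<le> (3 + 3 * k * S + (k * S)\<^sup>2) / s ^ 5"
  proof (rule frac_le)
    have "norm (3 - 3 * \<i> * of_real (k * s) - of_real ((k * s)\<^sup>2))
        \<le> norm (3 - 3 * \<i> * of_real (k * s)) + norm (complex_of_real ((k * s)\<^sup>2))"
      by (rule norm_triangle_ineq4)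
    also have "norm (3 - 3 * \<i> * of_real (k * s)) \<le> norm (3::complex) + norm (3 * \<i> * of_real (k * s))"
      by (rule norm_triangle_ineq4)
    finally have "norm (3 - 3 * \<i> * of_real (k * s) - of_real ((k * s)\<^sup>2)) \<le> 3 + 3 * \<bar>k * s\<bar> + \<bar>(k * s)\<^sup>2\<bar>"
      unfolding norm_of_real by (simp add: norm_mult del: of_real_power of_real_mult)
    then show "norm (3 - 3 * \<i> * of_real (k * s) - of_real ((k * s)\<^sup>2)) \<le> 3 + 3 * k * S + (k * S)\<^sup>2"
      using k unfolding abs_of_nonneg[OF k(1)] abs_of_nonneg[OF zero_le_power2] by linarith
    show "s ^ 5 \<le> 4 * pi * s ^ 5"
      using mult_right_mono[OF pi, of "s ^ 5"] s by simp
  qed (use s k in auto)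
  finally show "norm (profile2 k s) \<le> (3 + 3 * k * S + (k * S)\<^sup>2) / s ^ 5" .
qed

text \<open>The singularities of order 1 and 2 are integrable in three dimensions, the
  one of order 3 only after multiplication by a positive power of the norm.\<close>

lemma rgreen_bounds:
  assumes z: "z \<noteq> 0" "norm z < R" and e: "0 \<le> e" "e \<le> 1" and k: "k \<ge> 0"
  defines "M \<equiv> 3 + 3 * k * (R + 1) + (k * (R + 1))\<^sup>2"
  shows "norm (rgreen k e z) \<le> 1 / norm z" "norm (rgreen1 k e j z) \<le> M / (norm z)\<^sup>2"
    "norm (rgreen2 k e i j z) \<le> 2 * M / norm z ^ 3"
    "norm (rdelta k e z) \<le> M * e\<^sup>2 / regrad e z ^ 5"
proof -
  let ?s = "regrad e z" and ?r = "norm z"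
  have r: "0 < ?r" "?r \<le> ?s" "?s \<le> R + 1"
    using z e norm_le_regrad[of z e] regrad_le[of e z] by auto
  then have s: "?s > 0" by linarith
  have "R + 1 \<ge> 0" using r by linarith
  then have M: "M \<ge> 0" unfolding M_def using k by simp
  note b = profile_bounds[OF r k, folded M_def]
  show "norm (rgreen k e z) \<le> 1 / norm z" unfolding rgreen_def by (rule b(1))
  have c: "\<bar>z $ j\<bar> \<le> ?r" for j by (rule component_le_norm_cart)
  have "norm (rgreen1 k e j z) \<le> ?r * (M / ?r ^ 3)"
    unfolding rgreen1_def norm_mult norm_of_real by (intro mult_mono c b(2)) auto
  then show "norm (rgreen1 k e j z) \<le> M / (norm z)\<^sup>2"
    using r by (simp add: power2_eq_square power3_eq_cube)
  have "norm (rgreen2 k e i j z) \<le> norm (profile1 k ?s) + norm (of_real (z $ i) * of_real (z $ j) * profile2 k ?s)"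
    unfolding rgreen2_def by (rule order.trans[OF norm_triangle_ineq]) auto
  also have "norm (of_real (z $ i) * of_real (z $ j) * profile2 k ?s) \<le> ?s * ?s * (M / ?s ^ 5)"
    unfolding norm_mult norm_of_real using c[of i] c[of j] r
    by (intro mult_mono b(3)) auto
  also have "\<dots> = M / ?s ^ 3" using s by (simp add: eval_nat_numeral)
  also have "\<dots> \<le> M / ?r ^ 3"
    using r(1,2) s M by (intro divide_left_mono power_mono mult_pos_pos zero_less_power) auto
  finally show "norm (rgreen2 k e i j z) \<le> 2 * M / norm z ^ 3" using b(2) by simp
  have "norm (rdelta k e z) = e\<^sup>2 * norm (profile2 k ?s)"
    unfolding rdelta_def norm_mult norm_of_real by simp
  also have "\<dots> \<le> e\<^sup>2 * (M / ?s ^ 5)" by (intro mult_left_mono b(3)) auto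
  finally show "norm (rdelta k e z) \<le> M * e\<^sup>2 / regrad e z ^ 5" by (simp add: mult.commute)
qed

lemma rgreen_limits:
  assumes "z \<noteq> 0" "e \<longlonglongrightarrow> 0"
  shows "(\<lambda>n. rgreen k (e n) z) \<longlonglongrightarrow> rgreen k 0 z"
    "(\<lambda>n. rgreen1 k (e n) j z) \<longlonglongrightarrow> rgreen1 k 0 j z"
    "(\<lambda>n. rgreen2 k (e n) i j z) \<longlonglongrightarrow> rgreen2 k 0 i j z"
    "(\<lambda>n. rdelta k (e n) z) \<longlonglongrightarrow> 0"
proof -
  have "(\<lambda>n. regrad (e n) z) \<longlonglongrightarrow> sqrt ((norm z)\<^sup>2 + 0\<^sup>2)"
    unfolding regrad_def using assms(2) by (intro tendsto_intros)
  then have l: "(\<lambda>n. regrad (e n) z) \<longlonglongrightarrow> norm z" by simp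
  have p: "isCont (profile0 k) (norm z)" "isCont (profile1 k) (norm z)" "isCont (profile2 k) (norm z)"
    using profile_continuous assms(1) by (auto simp: continuous_on_eq_continuous_at)
  note q = isCont_tendsto_compose[OF p(1) l] isCont_tendsto_compose[OF p(2) l] isCont_tendsto_compose[OF p(3) l]
  show "(\<lambda>n. rgreen k (e n) z) \<longlonglongrightarrow> rgreen k 0 z" unfolding rgreen_def using q by simp
  show "(\<lambda>n. rgreen1 k (e n) j z) \<longlonglongrightarrow> rgreen1 k 0 j z"
    unfolding rgreen1_def using q by (auto intro!: tendsto_intros)
  show "(\<lambda>n. rgreen2 k (e n) i j z) \<longlonglongrightarrow> rgreen2 k 0 i j z"
    unfolding rgreen2_def using q by (auto intro!: tendsto_intros)
  have "(\<lambda>n. rdelta k (e n) z) \<longlonglongrightarrow> of_real (0\<^sup>2) * profile2 k (norm z)"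
    unfolding rdelta_def using q assms(2) by (intro tendsto_intros) auto
  then show "(\<lambda>n. rdelta k (e n) z) \<longlonglongrightarrow> 0" by simp
qed

lemma rgreen_measurable [measurable]:
  "rgreen k e \<in> borel_measurable borel" "rgreen1 k e j \<in> borel_measurable borel"
  "rgreen2 k e i j \<in> borel_measurable borel" "rdelta k e \<in> borel_measurable borel"
  unfolding rgreen_def[abs_def] rgreen1_def[abs_def] rgreen2_def[abs_def] rdelta_def[abs_def]
    profile0_def profile1_def profile2_def regrad_def
  by measurable

section \<open>Convolutions\<close>

text \<open>The integral is taken with respect to \<open>lborel\<close>: kernels and
  densities are Borel functions throughout, which makes reflections and translations of
  the integrand available.\<close>

definition conv :: "(real^3 \<Rightarrow> complex) \<Rightarrow> (real^3 \<Rightarrow> complex) \<Rightarrow> real^3 \<Rightarrow> complex" where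
  "conv K f x = (LINT y|lborel. K (x - y) * f y)"

lemma distr_reflect: "distr lborel borel (\<lambda>y. x - y) = (lborel :: (real^3) measure)"
proof -
  show ?thesis using lborel_affine[of "-1" x] by (simp add: density_1)
qed

lemma integrable_reflect:
  fixes h :: "real^3 \<Rightarrow> 'b::{banach, second_countable_topology}"
  assumes "integrable lborel h"
  shows "integrable lborel (\<lambda>y. h (x - y))"
proof -
  have "integrable (distr lborel borel (\<lambda>y. x - y)) h" unfolding distr_reflect by (rule assms)
  then show ?thesis by (rule integrable_distr[rotated]) simp
qed

lemma integral_reflect:
  fixes h :: "real^3 \<Rightarrow> 'b::{banach, second_countable_topology}"
  assumes "h \<in> borel_measurable borel"
  shows "(LINT y|lborel. h (x - y)) = integral\<^sup>L lborel h"
proof -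
  have "integral\<^sup>L (distr lborel borel (\<lambda>y. x - y)) h = (LINT y|lborel. h (x - y))"
    by (rule integral_distr) (use assms in auto)
  then show ?thesis unfolding distr_reflect by simp
qed

text \<open>Only the values of \<open>K\<close> on a ball matter, since \<open>f\<close>
  has bounded support; the bound is therefore uniform for \<open>x\<close> in a bounded
  set.\<close>

lemma conv_bound:
  assumes [measurable]: "K \<in> borel_measurable borel" "f \<in> borel_measurable borel"
    and f: "\<And>y. norm (f y) \<le> M" "\<And>y. R0 \<le> norm y \<Longrightarrow> f y = 0" and x: "norm x + R0 \<le> R"
    and K: "integrable lborel (\<lambda>z. indicator (ball 0 R) z * norm (K z))"
  shows "integrable lborel (\<lambda>y. K (x - y) * f y)"
    and "norm (conv K f x) \<le> M * (LINT z|lborel. indicator (ball 0 R) z * norm (K z))"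
proof -
  let ?h = "\<lambda>z. indicator (ball 0 R) z * norm (K z)"
  have h: "integrable lborel (\<lambda>y. M * ?h (x - y))"
    using integrable_reflect[OF K, of x] by simp
  have M: "M \<ge> 0" using f(1)[of 0] norm_ge_zero order.trans by blast
  have le: "norm (K (x - y) * f y) \<le> M * ?h (x - y)" for y
  proof (cases "norm y < R0")
    case True
    then have "x - y \<in> ball 0 R" using norm_triangle_ineq4[of x y] x by simp
    then show ?thesis using f(1)[of y] M
      by (simp add: norm_mult mult.commute[of "norm (f y)"] mult.commute[of M] mult_left_mono)
  qed (use f(2)[of y] M in auto)
  show i: "integrable lborel (\<lambda>y. K (x - y) * f y)"
  proof (rule Bochner_Integration.integrable_bound[OF h])
    show "(\<lambda>y. K (x - y) * f y) \<in> borel_measurable lborel" by measurable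
    show "AE y in lborel. norm (K (x - y) * f y) \<le> norm (M * ?h (x - y))"
      using le by (auto intro!: AE_I2 order.trans[OF _ abs_ge_self] simp del: norm_mult)
  qed
  have "norm (conv K f x) \<le> (LINT y|lborel. M * ?h (x - y))"
    unfolding conv_def by (rule Bochner_Integration.integral_norm_bound_integral[OF i h]) (use le in auto)
  also have "\<dots> = M * (LINT z|lborel. ?h z)"
    using integral_reflect[of ?h x] by simp
  finally show "norm (conv K f x) \<le> M * (LINT z|lborel. ?h z)" .
qed

lemma conv_diff_kernel:
  assumes "integrable lborel (\<lambda>y. K (x - y) * f y)" "integrable lborel (\<lambda>y. L (x - y) * f y)"
  shows "conv (\<lambda>z. K z - L z) f x = conv K f x - conv L f x"
  using assms unfolding conv_def by (simp add: algebra_simps)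

lemma continuous_bounded_on_cball:
  fixes K :: "real^3 \<Rightarrow> complex"
  assumes "continuous_on UNIV K"
  shows "\<exists>B. \<forall>z. norm z \<le> r \<longrightarrow> norm (K z) \<le> B"
proof -
  have "bounded (K ` cball 0 r)"
    by (intro compact_imp_bounded compact_continuous_image continuous_on_subset[OF assms]) auto
  then show ?thesis unfolding bounded_iff by (metis imageI mem_cball_0)
qed

lemma conv_integrable_continuous:
  fixes K f :: "real^3 \<Rightarrow> complex"
  assumes K: "continuous_on UNIV K" and f: "integrable lborel f" "\<And>y. R0 \<le> norm y \<Longrightarrow> f y = 0"
  shows "integrable lborel (\<lambda>y. K (x - y) * f y)"
proof -
  have [measurable]: "K \<in> borel_measurable borel" by (rule borel_measurable_continuous_onI[OF K])
  have [measurable]: "f \<in> borel_measurable borel" using f(1) by auto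
  obtain B where B: "\<And>z. norm z \<le> norm x + R0 \<Longrightarrow> norm (K z) \<le> B"
    using continuous_bounded_on_cball[OF K] by blast
  show ?thesis
  proof (rule Bochner_Integration.integrable_bound[where f="\<lambda>y. B *\<^sub>R norm (f y)"])
    show "integrable lborel (\<lambda>y. B *\<^sub>R norm (f y))" using f(1) by auto
    show "(\<lambda>y. K (x - y) * f y) \<in> borel_measurable lborel" by measurable
    have "norm (K (x - y) * f y) \<le> norm (B *\<^sub>R norm (f y))" for y
    proof (cases "norm y < R0")
      case True
      then have "norm (K (x - y)) \<le> B" using norm_triangle_ineq4[of x y] by (intro B) simp
      then show ?thesis unfolding norm_mult
        by (auto intro!: mult_right_mono order.trans[OF _ abs_ge_self])
    qed (use f(2) in auto)
    then show "AE y in lborel. norm (K (x - y) * f y) \<le> norm (B *\<^sub>R norm (f y))" by auto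
  qed
qed

lemma conv_continuous:
  assumes K: "continuous_on UNIV K" and f: "integrable lborel f" "\<And>y. R0 \<le> norm y \<Longrightarrow> f y = 0"
  shows "continuous_on UNIV (conv K f)"
proof (rule continuous_at_imp_continuous_on, rule ballI)
  fix x :: "real^3"
  have [measurable]: "K \<in> borel_measurable borel" by (rule borel_measurable_continuous_onI[OF K])
  have [measurable]: "f \<in> borel_measurable borel" using f(1) by auto
  obtain B where B: "\<And>z. norm z \<le> norm x + 1 + R0 \<Longrightarrow> norm (K z) \<le> B"
    using continuous_bounded_on_cball[OF K] by blast
  show "isCont (conv K f) x"
    unfolding continuous_within_sequentially
  proof (intro allI impI)
    fix X assume "(\<forall>n::nat. X n \<in> UNIV) \<and> X \<longlonglongrightarrow> x"
    then have X: "X \<longlonglongrightarrow> x" by simp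
    then have "\<forall>\<^sub>F n in sequentially. dist (X n) x < 1" by (rule tendstoD) simp
    then obtain N where N: "\<And>n. n \<ge> N \<Longrightarrow> dist (X n) x < 1" unfolding eventually_sequentially by auto
    have "(\<lambda>n. conv K f (X (n + N))) \<longlonglongrightarrow> conv K f x"
      unfolding conv_def
    proof (rule integral_dominated_convergence[where w="\<lambda>y. B *\<^sub>R norm (f y)"])
      show "integrable lborel (\<lambda>y. B *\<^sub>R norm (f y))" using f(1) by auto
      show "(\<lambda>y. K (x - y) * f y) \<in> borel_measurable lborel" by measurable
      show "(\<lambda>y. K (X (n + N) - y) * f y) \<in> borel_measurable lborel" for n by measurable
      have "(\<lambda>n. K (X (n + N) - y) * f y) \<longlonglongrightarrow> K (x - y) * f y" for y
      proof -
        have "isCont K (x - y)" using K by (simp add: continuous_on_eq_continuous_at)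
        moreover have "(\<lambda>n. X (n + N) - y) \<longlonglongrightarrow> x - y"
          using LIMSEQ_ignore_initial_segment[OF X, of N] by (intro tendsto_intros)
        ultimately have "(\<lambda>n. K (X (n + N) - y)) \<longlonglongrightarrow> K (x - y)"
          by (rule isCont_tendsto_compose)
        then show ?thesis by (rule tendsto_mult_right)
      qed
      then show "AE y in lborel. (\<lambda>n. K (X (n + N) - y) * f y) \<longlonglongrightarrow> K (x - y) * f y" by simp
      have "norm (K (X (n + N) - y) * f y) \<le> B *\<^sub>R norm (f y)" for n y
      proof (cases "norm y < R0")
        case True
        have "norm (X (n + N)) < norm x + 1"
          using N[of "n + N"] norm_triangle_ineq2[of "X (n+N)" x] by (simp add: dist_norm)
        then have "norm (K (X (n + N) - y)) \<le> B"
          using True norm_triangle_ineq4[of "X (n+N)" y] by (intro B) simp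
        then show ?thesis unfolding norm_mult by (auto intro!: mult_right_mono)
      qed (use f(2) in auto)
      then show "AE y in lborel. norm (K (X (n + N) - y) * f y) \<le> B *\<^sub>R norm (f y)" for n by simp
    qed
    then show "(conv K f \<circ> X) \<longlonglongrightarrow> conv K f x"
      unfolding o_def by (rule LIMSEQ_offset)
  qed
qed

text \<open>The partial derivatives of \<open>K\<close> are uniformly continuous on a
  compact set, so the first-order remainder of \<open>K\<close> is small uniformly in
  the integration variable.\<close>

lemma conv_has_grad:
  assumes K: "C1_on UNIV K" and f: "integrable lborel f" "\<And>y. R0 \<le> norm y \<Longrightarrow> f y = 0"
  shows "has_grad (conv K f) (\<lambda>j. conv (pd j K) f x) x"
  unfolding has_grad_def has_derivative_at_alt
proof (intro conjI allI impI)
  show "bounded_linear (\<lambda>h::real^3. \<Sum>j\<in>UNIV. (h $ j) *\<^sub>R conv (pd j K) f x)"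
    by (intro bounded_linear_sum bounded_linear_scaleR_const bounded_linear_vec_nth)
  fix e :: real assume e: "e > 0"
  define A where "A = (LINT y|lborel. norm (f y))"
  have A: "A \<ge> 0" unfolding A_def by simp
  define \<eta> where "\<eta> = e / (3 * (A + 1))"
  have \<eta>: "\<eta> > 0" "3 * \<eta> * A \<le> e"
    using e A unfolding \<eta>_def by (auto simp: field_simps)
  have cK: "continuous_on UNIV K" by (rule C1_on_continuous[OF K])
  have cP: "continuous_on UNIV (pd j K)" for j by (rule C1_on_pd_continuous[OF K])
  let ?C = "cball 0 (norm x + R0 + 1) :: (real^3) set"
  have "\<exists>d>0. \<forall>z\<in>?C. \<forall>w\<in>?C. dist w z < d \<longrightarrow> dist (pd j K w) (pd j K z) < \<eta>" for j
    using compact_uniformly_continuous[OF continuous_on_subset[OF cP[of j] subset_UNIV] compact_cball]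
      \<eta>(1) unfolding uniformly_continuous_on_def by blast
  then obtain d where d: "\<And>j. d j > 0"
    "\<And>j z w. z \<in> ?C \<Longrightarrow> w \<in> ?C \<Longrightarrow> dist w z < d j \<Longrightarrow> dist (pd j K w) (pd j K z) < \<eta>"
    by metis
  define D where "D = min 1 (Min (range d))"
  have D: "D > 0" "D \<le> 1" "D \<le> d j" for j unfolding D_def using d(1) by (auto simp: min.coboundedI2)
  show "\<exists>D>0. \<forall>y. norm (y - x) < D \<longrightarrow> norm (conv K f y - conv K f x -
      (\<Sum>j\<in>UNIV. ((y - x) $ j) *\<^sub>R conv (pd j K) f x)) \<le> e * norm (y - x)"
  proof (intro exI conjI allI impI)
    show "D > 0" by (rule D)
    fix x' assume x': "norm (x' - x) < D"
    define h where "h = x' - x"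
    have i1: "integrable lborel (\<lambda>y. K (x - y) * f y)" for x
      by (rule conv_integrable_continuous[OF cK f])
    have i2: "integrable lborel (\<lambda>y. pd j K (x - y) * f y)" for x j
      by (rule conv_integrable_continuous[OF cP f])
    let ?g = "\<lambda>y. (K (x' - y) - K (x - y) - (\<Sum>j\<in>UNIV. (h $ j) *\<^sub>R pd j K (x - y))) * f y"
    have g_eq: "?g = (\<lambda>y. K (x' - y) * f y - K (x - y) * f y -
        (\<Sum>j\<in>UNIV. (h $ j) *\<^sub>R (pd j K (x - y) * f y)))"
      by (auto simp: algebra_simps sum_distrib_left)
    have ig: "integrable lborel ?g"
      unfolding g_eq using i1 i2 by (intro Bochner_Integration.integrable_diff
          Bochner_Integration.integrable_sum integrable_scaleR_right) auto
    have "conv K f x' - conv K f x - (\<Sum>j\<in>UNIV. (h $ j) *\<^sub>R conv (pd j K) f x) = integral\<^sup>L lborel ?g"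
      unfolding g_eq conv_def using i1 i2 by simp
    then have "norm (conv K f x' - conv K f x - (\<Sum>j\<in>UNIV. (h $ j) *\<^sub>R conv (pd j K) f x)) =
        norm (integral\<^sup>L lborel ?g)" by simp
    also have "norm (integral\<^sup>L lborel ?g) \<le> (LINT y|lborel. (3 * \<eta> * norm h) * norm (f y))"
    proof (rule Bochner_Integration.integral_norm_bound_integral[OF ig])
      show "integrable lborel (\<lambda>y. (3 * \<eta> * norm h) * norm (f y))" using f(1) by auto
      fix y
      show "norm (?g y) \<le> (3 * \<eta> * norm h) * norm (f y)"
      proof (cases "norm y < R0")
        case True
        define z where "z = x - y"
        have z: "norm z \<le> norm x + R0" using norm_triangle_ineq4[of x y] True unfolding z_def by simp
        let ?\<phi> = "\<lambda>w. K w - (\<Sum>j\<in>UNIV. of_real (w $ j) * pd j K z)"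
        have gr: "has_grad ?\<phi> (\<lambda>i. pd i K w - pd i K z) w" for w
        proof -
          have "has_grad (\<lambda>w. \<Sum>j\<in>UNIV. of_real (w $ j) * pd j K z) (\<lambda>i. pd i K z) w"
          proof -
            have "((\<lambda>w. \<Sum>j\<in>UNIV. of_real (w $ j) * pd j K z) has_derivative
              (\<lambda>h. \<Sum>j\<in>UNIV. of_real (h $ j) * pd j K z)) (at w)"
              by (intro has_derivative_sum has_derivative_mult_left
                bounded_linear.has_derivative[OF bounded_linear_of_real]
                bounded_linear.has_derivative[OF bounded_linear_vec_nth] has_derivative_ident)
            then show ?thesis unfolding has_grad_def by (simp add: scaleR_conv_of_real)
          qed
          then show ?thesis using has_grad_diff[OF C1_on_has_grad[OF K UNIV_I]] by blast
        qed
        have "norm (?\<phi> (z + h) - ?\<phi> z) \<le> 3 * \<eta> * norm ((z + h) - z)"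
        proof (rule lipschitz_of_pd_bound[where S="ball z D"])
          show "has_grad ?\<phi> (\<lambda>i. pd i K w - pd i K z) w" for w by (rule gr)
          fix w j assume "w \<in> ball z D"
          then have w: "dist w z < d j" "norm w \<le> norm z + 1"
            using D(2) D(3)[of j] norm_triangle_ineq2[of w z] by (auto simp: dist_norm norm_minus_commute)
          then show "norm (pd j K w - pd j K z) \<le> \<eta>"
            using d(2)[of z w j] z by (simp add: dist_norm)
        qed (use x' D in \<open>auto simp: dist_norm h_def norm_minus_commute\<close>)
        moreover have "?\<phi> (z + h) - ?\<phi> z = K (x' - y) - K (x - y) - (\<Sum>j\<in>UNIV. (h $ j) *\<^sub>R pd j K (x - y))"
          unfolding z_def h_def
          by (simp add: algebra_simps sum.distrib sum_subtractf scaleR_conv_of_real)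
        ultimately show ?thesis unfolding norm_mult by (intro mult_right_mono) auto
      qed (use f(2) in auto)
    qed
    also have "(LINT y|lborel. (3 * \<eta> * norm h) * norm (f y)) = (3 * \<eta> * A) * norm h"
      unfolding A_def by simp
    also have "\<dots> \<le> e * norm h" using \<eta>(2) by (intro mult_right_mono) auto
    finally show "norm (conv K f x' - conv K f x -
      (\<Sum>j\<in>UNIV. ((x' - x) $ j) *\<^sub>R conv (pd j K) f x)) \<le> e * norm (x' - x)"
      unfolding h_def .
  qed
qed

text \<open>The source of all regularity statements for singular potentials, which are
  limits of smooth ones.\<close>

lemma C1_uniform_limit:
  fixes f :: "nat \<Rightarrow> real^3 \<Rightarrow> complex"
  assumes S: "open S" "convex S"
    and gr: "\<And>n x. x \<in> S \<Longrightarrow> has_grad (f n) (g n x) x"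
    and cont: "\<And>n j. continuous_on S (\<lambda>x. g n x j)"
    and lim: "\<And>x. x \<in> S \<Longrightarrow> (\<lambda>n. f n x) \<longlonglongrightarrow> F x"
    and unif: "\<And>j. \<exists>c. c \<longlonglongrightarrow> 0 \<and> (\<forall>n. \<forall>x\<in>S. norm (g n x j - G x j) \<le> c n)"
  shows "x \<in> S \<Longrightarrow> has_grad F (G x) x" and "continuous_on S (\<lambda>x. G x j)"
proof -
  obtain c where c: "\<And>j. c j \<longlonglongrightarrow> (0::real)" "\<And>j n x. x \<in> S \<Longrightarrow> norm (g n x j - G x j) \<le> c j n"
    using unif by metis
  show "continuous_on S (\<lambda>x. G x j)"
  proof (rule uniform_limit_theorem[where f="\<lambda>n x. g n x j" and F=sequentially])
    show "uniform_limit S (\<lambda>n x. g n x j) (\<lambda>x. G x j) sequentially"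
      unfolding uniform_limit_iff
    proof (intro allI impI)
      fix e :: real assume "e > 0"
      then have "\<forall>\<^sub>F n in sequentially. c j n < e" using order_tendstoD(2)[OF c(1)] by blast
      then show "\<forall>\<^sub>F n in sequentially. \<forall>x\<in>S. dist (g n x j) (G x j) < e"
        by eventually_elim (use c(2) in \<open>auto simp: dist_norm intro: le_less_trans\<close>)
    qed
  qed (use cont in auto)
  assume x: "x \<in> S"
  have "\<exists>F'. \<forall>x\<in>S. (\<lambda>n. f n x) \<longlonglongrightarrow> F' x \<and>
      (F' has_derivative (\<lambda>h. \<Sum>j\<in>UNIV. (h $ j) *\<^sub>R G x j)) (at x within S)"
  proof (rule has_derivative_sequence[where f=f and l="F x", OF S(2) _ _ x lim[OF x]])
    show "(f n has_derivative (\<lambda>h. \<Sum>j\<in>UNIV. (h $ j) *\<^sub>R g n x j)) (at x within S)" if "x \<in> S" for n x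
      using gr[OF that] unfolding has_grad_def by (rule has_derivative_at_withinI)
    fix e :: real assume e: "e > 0"
    have "\<forall>\<^sub>F n in sequentially. \<forall>j. c j n < e / 3"
      using order_tendstoD(2)[OF c(1), of "e/3"] e by (intro eventually_all_finite) auto
    then show "\<forall>\<^sub>F n in sequentially. \<forall>x\<in>S. \<forall>h. norm ((\<Sum>j\<in>UNIV. (h $ j) *\<^sub>R g n x j) -
        (\<Sum>j\<in>UNIV. (h $ j) *\<^sub>R G x j)) \<le> e * norm h"
    proof eventually_elim
      case (elim n)
      show ?case
      proof (intro ballI allI)
        fix x h assume x: "x \<in> S"
        have "norm (\<Sum>j\<in>UNIV. (h $ j) *\<^sub>R (g n x j - G x j)) \<le> 3 * (e / 3) * norm h"
        proof (rule norm_grad_le)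
          show "norm (g n x j - G x j) \<le> e / 3" for j using c(2)[OF x, of n j] elim[rule_format, of j] by linarith
        qed
        then show "norm ((\<Sum>j\<in>UNIV. (h $ j) *\<^sub>R g n x j) - (\<Sum>j\<in>UNIV. (h $ j) *\<^sub>R G x j)) \<le> e * norm h"
          by (simp add: scaleR_diff_right sum_subtractf)
      qed
    qed
  qed
  then obtain F' where F': "\<And>x. x \<in> S \<Longrightarrow> (\<lambda>n. f n x) \<longlonglongrightarrow> F' x"
    "\<And>x. x \<in> S \<Longrightarrow> (F' has_derivative (\<lambda>h. \<Sum>j\<in>UNIV. (h $ j) *\<^sub>R G x j)) (at x within S)" by blast
  have eq: "F' y = F y" if "y \<in> S" for y using F'(1) lim that LIMSEQ_unique by blast
  have "has_grad F' (G x) x"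
    using F'(2)[OF x] unfolding has_grad_def at_within_open[OF x S(1)] .
  then show "has_grad F (G x) x" using has_grad_cong_open[of S x F' F "G x"] S(1) x eq by simp
qed

section \<open>Potentials of bounded densities\<close>

definition eps :: "nat \<Rightarrow> real" where "eps n = 1 / real (Suc n)"

lemma eps_props: "eps n > 0" "eps n \<ge> 0" "eps n \<le> 1" "eps \<longlonglongrightarrow> 0"
  unfolding eps_def using LIMSEQ_inverse_real_of_nat by (auto simp: inverse_eq_divide)

lemma bounded_support_integrable:
  fixes f :: "real^3 \<Rightarrow> complex"
  assumes "f \<in> borel_measurable borel" "\<And>y. norm (f y) \<le> M" "\<And>y. R0 \<le> norm y \<Longrightarrow> f y = 0"
  shows "integrable lborel f"
proof (rule Bochner_Integration.integrable_bound[where f="\<lambda>y. indicator (cball 0 R0) y *\<^sub>R M"])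
  show "integrable lborel (\<lambda>y::real^3. indicator (cball 0 R0) y *\<^sub>R M)"
    by (intro borel_integrable_compact) auto
  show "AE y in lborel. norm (f y) \<le> norm (indicator (cball 0 R0) y *\<^sub>R M)"
  proof (rule AE_I2)
    fix y show "norm (f y) \<le> norm (indicator (cball 0 R0) y *\<^sub>R M)"
      using assms(2)[of y] assms(3)[of y] by (cases "R0 \<le> norm y") (auto simp: indicator_def)
  qed
qed (use assms in auto)

text \<open>The error is bounded by the \<open>L\<^sup>1\<close> distance of the kernels
  on a ball, which does not depend on \<open>x\<close>.\<close>

lemma conv_uniform_limit:
  fixes K :: "nat \<Rightarrow> real^3 \<Rightarrow> complex" and K' :: "real^3 \<Rightarrow> complex"
  assumes p: "p < 3"
    and [measurable]: "\<And>n. K n \<in> borel_measurable borel" "K' \<in> borel_measurable borel"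
    and bd: "\<And>n z. z \<noteq> 0 \<Longrightarrow> norm z < R \<Longrightarrow> norm (K n z) \<le> C * norm z powr (- p)"
    and lim: "\<And>z. z \<noteq> 0 \<Longrightarrow> norm z < R \<Longrightarrow> (\<lambda>n. K n z) \<longlonglongrightarrow> K' z"
    and f: "f \<in> borel_measurable borel" "\<And>y. norm (f y) \<le> M" "\<And>y. R0 \<le> norm y \<Longrightarrow> f y = 0"
  shows "norm x + R0 \<le> R \<Longrightarrow> integrable lborel (\<lambda>y. K' (x - y) * f y)"
    "norm x + R0 \<le> R \<Longrightarrow> integrable lborel (\<lambda>y. K n (x - y) * f y)"
    "\<exists>c. c \<longlonglongrightarrow> 0 \<and> (\<forall>n x. norm x + R0 \<le> R \<longrightarrow> norm (conv (K n) f x - conv K' f x) \<le> c n)"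
proof -
  note k = kernel_L1_limit[OF p assms(2,3) bd lim]
  show i1: "integrable lborel (\<lambda>y. K' (x - y) * f y)" if "norm x + R0 \<le> R" for x
    by (rule conv_bound(1)[OF assms(3) f that k(1)])
  show i2: "integrable lborel (\<lambda>y. K n (x - y) * f y)" if "norm x + R0 \<le> R" for n x
    by (rule conv_bound(1)[OF assms(2) f that k(2)])
  let ?c = "\<lambda>n. M * (LINT z|lborel. indicator (ball 0 R) z * norm (K n z - K' z))"
  have "?c \<longlonglongrightarrow> 0" using tendsto_mult_right_zero[OF k(4)] .
  moreover have "norm (conv (K n) f x - conv K' f x) \<le> ?c n" if x: "norm x + R0 \<le> R" for n x
  proof -
    have "norm (conv (\<lambda>z. K n z - K' z) f x) \<le> ?c n"
      using conv_bound(2)[OF _ f x k(3)] by simp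
    then show ?thesis using conv_diff_kernel[OF i2[OF x] i1[OF x]] by simp
  qed
  ultimately show "\<exists>c. c \<longlonglongrightarrow> 0 \<and> (\<forall>n x. norm x + R0 \<le> R \<longrightarrow> norm (conv (K n) f x - conv K' f x) \<le> c n)"
    by blast
qed

lemma rgreen_powr_bounds:
  assumes k: "k \<ge> 0" and e: "0 \<le> e" "e \<le> 1"
  defines "M \<equiv> \<lambda>R. 3 + 3 * k * (R + 1) + (k * (R + 1))\<^sup>2"
  shows "z \<noteq> 0 \<Longrightarrow> norm z < R \<Longrightarrow> norm (rgreen k e z) \<le> 1 * norm z powr (- 1)"
    "z \<noteq> 0 \<Longrightarrow> norm z < R \<Longrightarrow> norm (rgreen1 k e j z) \<le> M R * norm z powr (- 2)"
    "z \<noteq> 0 \<Longrightarrow> norm z < R \<Longrightarrow> norm (rgreen2 k e i j z) \<le> (2 * M R) * norm z powr (- 3)"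
  using rgreen_bounds[of z R e k] assms
  by (simp_all add: powr_minus_divide powr_numeral)

lemma regularized_potential:
  assumes h: "h \<in> borel_measurable borel" "\<And>y. norm (h y) \<le> M" "\<And>y. R0 \<le> norm y \<Longrightarrow> h y = 0"
    and k: "k \<ge> 0"
  shows "\<exists>c. c \<longlonglongrightarrow> 0 \<and> (\<forall>n x. norm x + R0 \<le> R \<longrightarrow>
      norm (conv (rgreen1 k (eps n) j) h x - conv (rgreen1 k 0 j) h x) \<le> c n)"
    and "(\<lambda>n. conv (rgreen k (eps n)) h x) \<longlonglongrightarrow> conv (rgreen k 0) h x"
    and "(\<lambda>n. conv (rgreen1 k (eps n) j) h x) \<longlonglongrightarrow> conv (rgreen1 k 0 j) h x"
    and "integrable lborel (\<lambda>y. rgreen k 0 (x - y) * h y)"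
    and "integrable lborel (\<lambda>y. rgreen1 k 0 j (x - y) * h y)"
proof -
  define Mb where "Mb R = 3 + 3 * k * (R + 1) + (k * (R + 1))\<^sup>2" for R
  note rb = rgreen_powr_bounds[OF k eps_props(2) eps_props(3), folded Mb_def]
  have B0: "norm (rgreen k (eps n) z) \<le> 1 * norm z powr (- 1)" if "z \<noteq> 0" "norm z < R" for n z R
    by (rule rb(1)[OF that])
  have B1: "norm (rgreen1 k (eps n) j z) \<le> Mb R * norm z powr (- 2)" if "z \<noteq> 0" "norm z < R" for n z R
    by (rule rb(2)[OF that])
  have l0: "(\<lambda>n. rgreen k (eps n) z) \<longlonglongrightarrow> rgreen k 0 z" "(\<lambda>n. rgreen1 k (eps n) j z) \<longlonglongrightarrow> rgreen1 k 0 j z"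
    if "z \<noteq> 0" "norm z < R" for z R using rgreen_limits[OF that(1) eps_props(4)] by auto
  have c0: "\<exists>c. c \<longlonglongrightarrow> 0 \<and> (\<forall>n x. norm x + R0 \<le> R \<longrightarrow>
      norm (conv (rgreen k (eps n)) h x - conv (rgreen k 0) h x) \<le> c n)" for R
    by (rule conv_uniform_limit(3)[where p=1 and C=1]) (fact B0 l0 h rgreen_measurable | simp)+
  show c1: "\<exists>c. c \<longlonglongrightarrow> 0 \<and> (\<forall>n x. norm x + R0 \<le> R \<longrightarrow>
      norm (conv (rgreen1 k (eps n) j) h x - conv (rgreen1 k 0 j) h x) \<le> c n)" for R
    by (rule conv_uniform_limit(3)[where p=2 and C="Mb R"]) (fact B1 l0 h rgreen_measurable | simp)+
  show "(\<lambda>n. conv (rgreen k (eps n)) h x) \<longlonglongrightarrow> conv (rgreen k 0) h x"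
  proof -
    obtain c where c: "c \<longlonglongrightarrow> 0" "\<And>n. norm (conv (rgreen k (eps n)) h x - conv (rgreen k 0) h x) \<le> c n"
      using c0[of "norm x + R0"] by blast
    show ?thesis by (rule LIMSEQ_of_norm_le[OF c(2,1)])
  qed
  show "(\<lambda>n. conv (rgreen1 k (eps n) j) h x) \<longlonglongrightarrow> conv (rgreen1 k 0 j) h x"
  proof -
    obtain c where c: "c \<longlonglongrightarrow> 0" "\<And>n. norm (conv (rgreen1 k (eps n) j) h x - conv (rgreen1 k 0 j) h x) \<le> c n"
      using c1[of "norm x + R0"] by blast
    show ?thesis by (rule LIMSEQ_of_norm_le[OF c(2,1)])
  qed
  show "integrable lborel (\<lambda>y. rgreen k 0 (x - y) * h y)"
    by (rule conv_uniform_limit(1)[where p=1 and C=1 and R="norm x + R0" and K="\<lambda>n. rgreen k (eps n)" and M=M and ?R0.0=R0])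
       (fact B0 l0 h rgreen_measurable | simp)+
  show "integrable lborel (\<lambda>y. rgreen1 k 0 j (x - y) * h y)"
    by (rule conv_uniform_limit(1)[where p=2 and C="Mb (norm x + R0)" and R="norm x + R0" and K="\<lambda>n. rgreen1 k (eps n) j" and M=M and ?R0.0=R0])
       (fact B1 l0 h rgreen_measurable | simp)+
qed

text \<open>The kernel of the gradient has an integrable singularity of order 2, so the
  gradients of the regularised potentials converge locally uniformly.\<close>

lemma potential_C1:
  assumes f: "f \<in> borel_measurable borel" "\<And>y. norm (f y) \<le> M" "\<And>y. R0 \<le> norm y \<Longrightarrow> f y = 0"
    and k: "k \<ge> 0"
  shows "has_grad (conv (rgreen k 0) f) (\<lambda>j. conv (rgreen1 k 0 j) f x) x"
    and "continuous_on UNIV (conv (rgreen1 k 0 j) f)"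
proof -
  note fi = bounded_support_integrable[OF f]
  have R: "norm w + R0 \<le> norm x + 1 + R0" if "w \<in> ball 0 (norm x + 1)" for w x :: "real^3"
    using that by simp
  note lim = regularized_potential(2)[OF f k]
  have unif: "\<exists>c. c \<longlonglongrightarrow> 0 \<and> (\<forall>n. \<forall>w\<in>ball 0 (norm x + 1). norm (conv (rgreen1 k (eps n) j) f w - conv (rgreen1 k 0 j) f w) \<le> c n)"
    for j and x :: "real^3"
    using regularized_potential(1)[OF f k, where R="norm x + 1 + R0" and j=j] R[of _ x] by blast
  have pdr: "pd j (rgreen k (eps n)) = rgreen1 k (eps n) j" for j n
    using rgreen_C2(2)[of UNIV "eps n"] eps_props(1) by auto
  have C: "C1_on UNIV (rgreen k (eps n))" for n
    using rgreen_C2(1)[of UNIV "eps n"] eps_props(1) unfolding C2_on_def by auto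
  have gr: "has_grad (conv (rgreen k (eps n)) f) (\<lambda>j. conv (rgreen1 k (eps n) j) f x) x" for n x
    using conv_has_grad[OF C fi f(3)] unfolding pdr .
  have ct: "continuous_on S (conv (rgreen1 k (eps n) j) f)" for n j S
  proof -
    have "continuous_on UNIV (rgreen1 k (eps n) j)"
      by (rule rgreen_continuous(2)) (simp add: eps_props(1))
    from conv_continuous[OF this fi f(3)] show ?thesis by (rule continuous_on_subset) auto
  qed
  show "has_grad (conv (rgreen k 0) f) (\<lambda>j. conv (rgreen1 k 0 j) f x) x"
    by (rule C1_uniform_limit(1)[where S="ball 0 (norm x + 1)" and f="\<lambda>n. conv (rgreen k (eps n)) f"
          and g="\<lambda>n x j. conv (rgreen1 k (eps n) j) f x"])
       (use gr ct lim unif in auto)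
  have "continuous_on (ball 0 (norm x + 1)) (\<lambda>x. conv (rgreen1 k 0 j) f x)" for x :: "real^3"
    by (rule C1_uniform_limit(2)[where S="ball 0 (norm x + 1)" and f="\<lambda>n. conv (rgreen k (eps n)) f"
          and g="\<lambda>n x j. conv (rgreen1 k (eps n) j) f x" and F="conv (rgreen k 0) f"])
       (use gr ct lim unif in auto)
  then have "isCont (conv (rgreen1 k 0 j) f) x" for x
    by (rule continuous_on_interior[of "ball 0 (norm x + 1)"]) simp
  then show "continuous_on UNIV (conv (rgreen1 k 0 j) f)"
    by (simp add: continuous_at_imp_continuous_on)
qed

text \<open>The square of the positive part is \<open>C\<^sup>1\<close>; composing it
  with itself gives a transition from 1 on \<open>t \<le> 1\<close> to 0 on \<open>t
  \<ge> 2\<close>. One continuous derivative is enough for all integrations by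
  parts.\<close>

definition step :: "real \<Rightarrow> real" where
  "step t = (max 0 (1 - (max 0 (t - 1))\<^sup>2))\<^sup>2"

definition step_slope :: "real \<Rightarrow> real" where
  "step_slope t = 4 * max 0 (1 - (max 0 (t - 1))\<^sup>2) * max 0 (t - 1)"

text \<open>Equal to 1 on the ball of radius \<open>\<rho>\<close> and to 0 off the ball
  of radius \<open>2 * \<rho>\<close>; its gradient at \<open>z\<close> is \<open>-
  bump_slope \<rho> z\<close> times \<open>z\<close>.\<close>

definition bump :: "real \<Rightarrow> real^3 \<Rightarrow> complex" where
  "bump \<rho> z = of_real (step ((norm z)\<^sup>2 / \<rho>\<^sup>2))"

definition bump_slope :: "real \<Rightarrow> real^3 \<Rightarrow> real" where
  "bump_slope \<rho> z = 2 / \<rho>\<^sup>2 * step_slope ((norm z)\<^sup>2 / \<rho>\<^sup>2)"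

section \<open>Cutoff functions\<close>

lemma pos_part_square_deriv:
  "((\<lambda>t. (max 0 t)\<^sup>2) has_real_derivative 2 * max 0 t) (at (t :: real))"
proof -
  consider "t < 0" | "t > 0" | "t = 0" by linarith
  then show ?thesis
  proof cases
    case 1
    have "((\<lambda>t::real. 0) has_real_derivative 0) (at t)" by simp
    then show ?thesis
      using has_field_derivative_transform_within_open[of "\<lambda>t. 0" 0 t "{..<0}" "\<lambda>t. (max 0 t)\<^sup>2"] 1
      by (simp add: max_def)
  next
    case 2
    have "((\<lambda>t::real. t\<^sup>2) has_real_derivative 2 * t) (at t)" by (auto intro!: derivative_eq_intros)
    then show ?thesis
      using has_field_derivative_transform_within_open[of "\<lambda>t. t\<^sup>2" "2 * t" t "{0<..}" "\<lambda>t. (max 0 t)\<^sup>2"] 2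
      by (simp add: max_def)
  next
    case 3
    have "((\<lambda>h::real. ((max 0 (0 + h))\<^sup>2 - (max 0 0)\<^sup>2) / h) \<longlongrightarrow> 0) (at 0)"
    proof (rule Lim_null_comparison)
      show "\<forall>\<^sub>F h in at 0. norm (((max 0 (0 + h))\<^sup>2 - (max 0 0)\<^sup>2) / h) \<le> \<bar>h :: real\<bar>"
        by (rule always_eventually) (auto simp: max_def power2_eq_square)
      show "((\<lambda>h::real. \<bar>h\<bar>) \<longlongrightarrow> 0) (at 0)" by (intro tendsto_rabs_zero tendsto_ident_at)
    qed
    then show ?thesis unfolding 3 DERIV_def by simp
  qed
qed

lemma step_deriv: "(step has_real_derivative - step_slope t) (at t)"
proof -
  have "((\<lambda>t. (max 0 (1 - (max 0 (t - 1))\<^sup>2))\<^sup>2) has_real_derivative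
      2 * max 0 (1 - (max 0 (t - 1))\<^sup>2) * (0 - 2 * max 0 (t - 1) * (1 - 0))) (at t)"
    by (intro DERIV_chain2[OF pos_part_square_deriv] DERIV_diff DERIV_const DERIV_ident
        DERIV_chain2[OF pos_part_square_deriv, where g="\<lambda>t. t - 1"])
  then show ?thesis unfolding step_def[abs_def] step_slope_def by (simp add: mult_ac)
qed

lemma step_eq: "t \<le> 1 \<Longrightarrow> step t = 1" "t \<ge> 2 \<Longrightarrow> step t = 0"
  and step_slope_eq: "t \<le> 1 \<Longrightarrow> step_slope t = 0" "t \<ge> 2 \<Longrightarrow> step_slope t = 0"
proof -
  show "t \<le> 1 \<Longrightarrow> step t = 1" "t \<le> 1 \<Longrightarrow> step_slope t = 0" unfolding step_def step_slope_def by simp_all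
  have "max 0 (1 - (max 0 (t - 1))\<^sup>2) = 0" if "t \<ge> 2"
  proof -
    have "1 \<le> (t - 1)\<^sup>2" using that by (intro one_le_power) simp
    moreover have "max 0 (t - 1) = t - 1" using that by simp
    ultimately show ?thesis by simp
  qed
  then show "t \<ge> 2 \<Longrightarrow> step t = 0" "t \<ge> 2 \<Longrightarrow> step_slope t = 0" unfolding step_def step_slope_def by simp_all
qed

lemma step_bounds: "0 \<le> step t" "step t \<le> 1"
  and step_slope_bounds: "0 \<le> step_slope t" "step_slope t \<le> 4"
proof -
  define m where "m = max 0 (t - 1)"
  define w where "w = max 0 (1 - m\<^sup>2)"
  have m: "m \<ge> 0" and w: "0 \<le> w" "w \<le> 1" unfolding m_def w_def by auto
  have b: "step t = w\<^sup>2" and s: "step_slope t = 4 * (w * m)"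
    unfolding step_def step_slope_def w_def m_def by simp_all
  show "0 \<le> step t" "step t \<le> 1" unfolding b using w by (auto simp: power_le_one)
  show "0 \<le> step_slope t" unfolding s using m w by simp
  have "w * m \<le> 1"
  proof (cases "m \<le> 1")
    case True
    then show ?thesis using w m mult_mono[of w 1 m 1] by simp
  next
    case False
    then have "1 - m\<^sup>2 \<le> 0" by (simp add: one_le_power)
    then have "w = 0" unfolding w_def by simp
    then show ?thesis by simp
  qed
  then show "step_slope t \<le> 4" unfolding s by simp
qed

lemma step_continuous: "continuous_on S step" "continuous_on S step_slope"
  unfolding step_def[abs_def] step_slope_def[abs_def] by (intro continuous_intros)+

lemma of_real_step_deriv:
  "((\<lambda>t. complex_of_real (step t)) has_vector_derivative of_real (- step_slope t)) (at t)"
  by (rule bounded_linear.has_vector_derivative[OF bounded_linear_of_real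
      step_deriv[unfolded has_real_derivative_iff_has_vector_derivative]])

lemma bump_has_grad:
  "has_grad (bump \<rho>) (\<lambda>j. of_real (- (z $ j) * bump_slope \<rho> z)) z"
proof -
  have r: "((\<lambda>z::real^3. (norm z)\<^sup>2 / \<rho>\<^sup>2) has_derivative (\<lambda>h. \<Sum>j\<in>UNIV. (h $ j) * (2 * z $ j / \<rho>\<^sup>2))) (at z)"
  proof -
    have "((\<lambda>z::real^3. z \<bullet> z / \<rho>\<^sup>2) has_derivative (\<lambda>h. (z \<bullet> h + h \<bullet> z) / \<rho>\<^sup>2)) (at z)"
      by (auto intro!: derivative_eq_intros simp: divide_inverse)
    moreover have "(z \<bullet> h + h \<bullet> z) / \<rho>\<^sup>2 = (\<Sum>j\<in>UNIV. (h $ j) * (2 * z $ j / \<rho>\<^sup>2))" for h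
      by (simp add: inner_commute[of z] inner_vec_def sum_distrib_left sum_divide_distrib algebra_simps)
    ultimately show ?thesis by (simp add: power2_norm_eq_inner)
  qed
  let ?t = "(norm z)\<^sup>2 / \<rho>\<^sup>2"
  from has_grad_compose_real[OF r of_real_step_deriv]
  have "has_grad (bump \<rho>) (\<lambda>j. of_real (2 * z $ j / \<rho>\<^sup>2) * of_real (- step_slope ?t)) z"
    unfolding bump_def[abs_def] .
  moreover have "(\<lambda>j. complex_of_real (2 * z $ j / \<rho>\<^sup>2) * of_real (- step_slope ?t))
      = (\<lambda>j. of_real (- (z $ j) * bump_slope \<rho> z))"
    unfolding bump_slope_def of_real_mult[symmetric] by (simp add: field_simps)
  ultimately show ?thesis by simp
qed

lemma bump_continuous: "continuous_on S (bump \<rho>)" "continuous_on S (bump_slope \<rho>)"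
  unfolding bump_def[abs_def] bump_slope_def[abs_def] divide_inverse
  by (intro continuous_intros continuous_on_compose2[OF step_continuous(1)[of UNIV]]
      continuous_on_compose2[OF step_continuous(2)[of UNIV]]; simp)+

lemma bump_C1: "C1_on S (bump \<rho>)"
  by (rule C1_onI[OF bump_has_grad]) (intro continuous_intros bump_continuous)

lemma pd_bump: "pd j (bump \<rho>) z = of_real (- (z $ j) * bump_slope \<rho> z)"
  by (rule has_grad_pd[OF bump_has_grad])

lemma bump_inside:
  assumes "\<rho> > 0" "norm z \<le> \<rho>"
  shows "bump \<rho> z = 1" "bump_slope \<rho> z = 0"
proof -
  have "(norm z)\<^sup>2 \<le> \<rho>\<^sup>2" using assms by (intro power_mono) auto
  then have "(norm z)\<^sup>2 / \<rho>\<^sup>2 \<le> 1" using assms by simp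
  then show "bump \<rho> z = 1" "bump_slope \<rho> z = 0"
    unfolding bump_def bump_slope_def by (simp_all add: step_eq step_slope_eq)
qed

lemma bump_outside:
  assumes "\<rho> > 0" "norm z \<ge> 2 * \<rho>"
  shows "bump \<rho> z = 0" "bump_slope \<rho> z = 0"
proof -
  have "(2 * \<rho>)\<^sup>2 \<le> (norm z)\<^sup>2" using assms by (intro power_mono) auto
  then have "4 \<le> (norm z)\<^sup>2 / \<rho>\<^sup>2" using assms by (simp add: le_divide_eq power_mult_distrib)
  then have "(norm z)\<^sup>2 / \<rho>\<^sup>2 \<ge> 2" by linarith
  then show "bump \<rho> z = 0" "bump_slope \<rho> z = 0"
    unfolding bump_def bump_slope_def by (simp_all add: step_eq step_slope_eq)
qed

lemma bump_bounds:
  shows "norm (bump \<rho> z) \<le> 1" "norm (1 - bump \<rho> z) \<le> 1" "bump_slope \<rho> z \<ge> 0" "bump_slope \<rho> z \<le> 8 / \<rho>\<^sup>2"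
proof -
  let ?t = "(norm z)\<^sup>2 / \<rho>\<^sup>2"
  show "norm (bump \<rho> z) \<le> 1" unfolding bump_def norm_of_real using step_bounds[of ?t] by simp
  have "1 - bump \<rho> z = of_real (1 - step ?t)" unfolding bump_def by simp
  then show "norm (1 - bump \<rho> z) \<le> 1" using step_bounds[of ?t] by (simp only: norm_of_real)
  show "bump_slope \<rho> z \<ge> 0" unfolding bump_slope_def using step_slope_bounds(1)[of ?t] by simp
  show "bump_slope \<rho> z \<le> 8 / \<rho>\<^sup>2"
    unfolding bump_slope_def using mult_left_mono[OF step_slope_bounds(2)[of ?t], of "2 / \<rho>\<^sup>2"] by simp
qed

lemma bump_measurable [measurable]:
  "bump \<rho> \<in> borel_measurable borel" "bump_slope \<rho> \<in> borel_measurable borel"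
  by (intro borel_measurable_continuous_onI bump_continuous)+

section \<open>Splitting of the second derivatives of the kernel\<close>

text \<open>The splitting \<open>rgreen1 = bump * rgreen1 + (1 - bump) *
  rgreen1\<close>, differentiated in direction \<open>i\<close>: the part
  \<open>near2\<close> carries the singularity and, being a derivative of a function
  with bounded support, has integral zero for \<open>e > 0\<close>.\<close>

definition near2 :: "real \<Rightarrow> real \<Rightarrow> real \<Rightarrow> 3 \<Rightarrow> 3 \<Rightarrow> real^3 \<Rightarrow> complex" where
  "near2 \<rho> k e i j z = bump \<rho> z * rgreen2 k e i j z
     + of_real (- (z $ i) * bump_slope \<rho> z) * rgreen1 k e j z"

definition far2 :: "real \<Rightarrow> real \<Rightarrow> real \<Rightarrow> 3 \<Rightarrow> 3 \<Rightarrow> real^3 \<Rightarrow> complex" where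
  "far2 \<rho> k e i j z = (1 - bump \<rho> z) * rgreen2 k e i j z
     - of_real (- (z $ i) * bump_slope \<rho> z) * rgreen1 k e j z"

lemma near_far: "rgreen2 k e i j z = near2 \<rho> k e i j z + far2 \<rho> k e i j z"
  unfolding near2_def far2_def by (simp add: algebra_simps)

lemma near2_measurable [measurable]:
  "near2 \<rho> k e i j \<in> borel_measurable borel" "far2 \<rho> k e i j \<in> borel_measurable borel"
proof -
  have [measurable]: "(\<lambda>z::real^3. z $ i) \<in> borel_measurable borel"
    by (intro borel_measurable_continuous_onI continuous_intros)
  show "near2 \<rho> k e i j \<in> borel_measurable borel" "far2 \<rho> k e i j \<in> borel_measurable borel"
    unfolding near2_def[abs_def] far2_def[abs_def] by measurable
qed

lemma near2_outside: "\<rho> > 0 \<Longrightarrow> norm z \<ge> 2 * \<rho> \<Longrightarrow> near2 \<rho> k e i j z = 0"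
  unfolding near2_def using bump_outside by simp

lemma far2_inside: "\<rho> > 0 \<Longrightarrow> norm z \<le> \<rho> \<Longrightarrow> far2 \<rho> k e i j z = 0"
  unfolding far2_def using bump_inside by simp

lemma near2_integral:
  assumes "e > 0" "\<rho> > 0"
  shows "integral\<^sup>L lborel (near2 \<rho> k e i j) = 0"
proof -
  let ?F = "\<lambda>z. bump \<rho> z * rgreen1 k e j z"
  have p: "pd i ?F = near2 \<rho> k e i j"
  proof
    fix z
    have "has_grad (rgreen1 k e j) (\<lambda>i. rgreen2 k e i j z) z"
      using rgreen1_has_grad assms(1) by blast
    from has_grad_pd[OF has_grad_mult[OF bump_has_grad this]]
    show "pd i ?F z = near2 \<rho> k e i j z" unfolding near2_def by simp
  qed
  have "C1_on UNIV ?F"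
    by (intro C1_on_mult bump_C1 rgreen_C2(3)) (use assms in auto)
  then have "integral\<^sup>L lborel (pd i ?F) = 0"
    by (rule integral_pd_eq_0[where R="2 * \<rho>"]) (use bump_outside assms in auto)
  then show ?thesis unfolding p .
qed

lemma near2_far2_bounds:
  assumes k: "k \<ge> 0" and e: "0 \<le> e" "e \<le> 1" and z: "z \<noteq> 0" "norm z < R" and \<rho>: "\<rho> > 0"
  defines "M \<equiv> 3 + 3 * k * (R + 1) + (k * (R + 1))\<^sup>2"
  defines "C \<equiv> 2 * M + 8 / \<rho>\<^sup>2 * R\<^sup>2 * M"
  shows "norm (near2 \<rho> k e i j z) \<le> C / norm z ^ 3" "norm (far2 \<rho> k e i j z) \<le> C / norm z ^ 3"
proof -
  note b = rgreen_bounds[OF z e k, folded M_def]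
  let ?r = "norm z"
  have r: "?r > 0" using z by simp
  have M: "M \<ge> 0"
  proof -
    have "0 \<le> M / ?r\<^sup>2" using b(2) norm_ge_zero order.trans by blast
    then show ?thesis using r by (simp add: zero_le_divide_iff)
  qed
  have "norm (of_real (- (z $ i) * bump_slope \<rho> z) * rgreen1 k e j z) \<le> (?r * (8 / \<rho>\<^sup>2)) * (M / ?r\<^sup>2)"
    unfolding norm_mult norm_of_real abs_mult
    using component_le_norm_cart[of z i] bump_bounds[of \<rho> z] b(2)
    by (intro mult_mono mult_nonneg_nonneg) auto
  also have "\<dots> = 8 / \<rho>\<^sup>2 * ?r\<^sup>2 * M / ?r ^ 3"
    using r by (simp add: field_simps power2_eq_square power3_eq_cube)
  also have "\<dots> \<le> 8 / \<rho>\<^sup>2 * R\<^sup>2 * M / ?r ^ 3"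
    using z r M by (intro divide_right_mono mult_right_mono mult_left_mono power_mono) auto
  finally have 1: "norm (of_real (- (z $ i) * bump_slope \<rho> z) * rgreen1 k e j z) \<le> 8 / \<rho>\<^sup>2 * R\<^sup>2 * M / ?r ^ 3" .
  have 2: "norm (bump \<rho> z * rgreen2 k e i j z) \<le> 1 * (2 * M / ?r ^ 3)"
    unfolding norm_mult by (intro mult_mono bump_bounds b(3)) auto
  have 3: "norm ((1 - bump \<rho> z) * rgreen2 k e i j z) \<le> 1 * (2 * M / ?r ^ 3)"
    unfolding norm_mult by (intro mult_mono bump_bounds b(3)) auto
  have C: "C / ?r ^ 3 = 1 * (2 * M / ?r ^ 3) + 8 / \<rho>\<^sup>2 * R\<^sup>2 * M / ?r ^ 3"
    unfolding C_def by (simp add: add_divide_distrib)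
  show "norm (near2 \<rho> k e i j z) \<le> C / norm z ^ 3"
    unfolding near2_def C by (rule order.trans[OF norm_triangle_ineq add_mono[OF 2 1]])
  show "norm (far2 \<rho> k e i j z) \<le> C / norm z ^ 3"
    unfolding far2_def C by (rule order.trans[OF norm_triangle_ineq4 add_mono[OF 3 1]])
qed

section \<open>The approximate identity\<close>

text \<open>Removing the leading part lowers the order of the singularity to 2,
  uniformly in \<open>e\<close>, so the remainder disappears in the limit by dominated
  convergence.\<close>

lemma rdelta_minus_profile_bound:
  assumes k: "k \<ge> 0" and e: "0 < e" "e \<le> 1" and z: "z \<noteq> 0" "norm z < R"
  shows "norm (rdelta k e z - of_real (3 * e\<^sup>2 / (4 * pi * regrad e z ^ 5)))
      \<le> (6 * k + k\<^sup>2 * (R + 1)) * norm z powr (- 2)"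
proof -
  let ?s = "regrad e z"
  have s: "?s > 0" using regrad_pos e by simp
  have es: "e \<le> ?s" unfolding regrad_def by (rule real_le_rsqrt) simp
  have sR: "?s \<le> R + 1" using regrad_le[of e z] e z by simp
  define w where "w = exp (\<i> * of_real (k * ?s))"
  have w1: "norm w = 1" unfolding w_def by (simp only: norm_exp_i_times)
  have w2: "norm (w - 1) \<le> k * ?s"
  proof -
    have "norm (w - 1) = 2 * \<bar>sin (k * ?s / 2)\<bar>" unfolding w_def by (rule dist_exp_i_1)
    also have "\<dots> \<le> 2 * \<bar>k * ?s / 2\<bar>" by (intro mult_left_mono abs_sin_x_le_abs_x) auto
    finally show ?thesis using k s by simp
  qed
  have eq: "rdelta k e z - of_real (3 * e\<^sup>2 / (4 * pi * ?s ^ 5)) =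
      of_real (e\<^sup>2 / (4 * pi * ?s ^ 5)) * (3 * (w - 1) - 3 * \<i> * of_real (k * ?s) * w - of_real ((k * ?s)\<^sup>2) * w)"
    unfolding rdelta_def profile2_def w_def[symmetric] using s by (simp add: field_simps)
  have "norm (3 * (w - 1) - 3 * \<i> * of_real (k * ?s) * w - of_real ((k * ?s)\<^sup>2) * w)
      \<le> norm (3 * (w - 1)) + norm (3 * \<i> * of_real (k * ?s) * w) + norm (of_real ((k * ?s)\<^sup>2) * w)"
    by (intro order.trans[OF norm_triangle_ineq4] add_mono norm_triangle_ineq4 order.refl)
  also have "\<dots> \<le> 3 * (k * ?s) + 3 * (k * ?s) + (k * ?s)\<^sup>2"
    unfolding norm_mult w1 norm_of_real using w2 k s by simp
  also have "\<dots> = ?s * (6 * k + k\<^sup>2 * ?s)" by (simp add: algebra_simps power2_eq_square)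
  also have "\<dots> \<le> ?s * (6 * k + k\<^sup>2 * (R + 1))"
    using s sR by (intro mult_left_mono add_left_mono) auto
  finally have le: "norm (3 * (w - 1) - 3 * \<i> * of_real (k * ?s) * w - of_real ((k * ?s)\<^sup>2) * w)
      \<le> ?s * (6 * k + k\<^sup>2 * (R + 1))" .
  have ge: "e\<^sup>2 / (4 * pi * ?s ^ 5) \<ge> 0" using s by simp
  have "norm (rdelta k e z - of_real (3 * e\<^sup>2 / (4 * pi * ?s ^ 5)))
      \<le> (e\<^sup>2 / (4 * pi * ?s ^ 5)) * (?s * (6 * k + k\<^sup>2 * (R + 1)))"
    unfolding eq norm_mult[of "of_real (e\<^sup>2 / (4 * pi * ?s ^ 5))"] norm_of_real abs_of_nonneg[OF ge]
    by (rule mult_left_mono[OF le ge])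
  also have "\<dots> = (6 * k + k\<^sup>2 * (R + 1)) * (e\<^sup>2 / (4 * pi * ?s ^ 4))"
    using s by (simp add: field_simps eval_nat_numeral)
  also have "\<dots> \<le> (6 * k + k\<^sup>2 * (R + 1)) * (1 / (norm z)\<^sup>2)"
  proof (rule mult_left_mono)
    have "(norm z)\<^sup>2 * e\<^sup>2 \<le> ?s\<^sup>2 * ?s\<^sup>2"
      using norm_le_regrad[of z e] es e by (intro mult_mono power_mono) auto
    also have "\<dots> \<le> 4 * pi * ?s ^ 4"
      using pi_ge_two mult_right_mono[of 1 "4 * pi" "?s ^ 4"] s by (simp add: power_add[symmetric])
    finally show "e\<^sup>2 / (4 * pi * ?s ^ 4) \<le> 1 / (norm z)\<^sup>2"
      using s z by (simp add: divide_simps mult.commute)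
    have "R \<ge> 0" using z(2) norm_ge_zero[of z] by linarith
    then show "0 \<le> 6 * k + k\<^sup>2 * (R + 1)" using k by (intro add_nonneg_nonneg mult_nonneg_nonneg) auto
  qed
  finally show ?thesis using z by (simp add: powr_minus_divide powr_numeral)
qed

text \<open>The leading part of \<open>rdelta\<close> is nonnegative, has mass tending
  to 1 and concentrates at the origin; the remainder tends to 0 in
  \<open>L\<^sup>1\<close>.\<close>

lemma delta_limit:
  assumes f: "f \<in> borel_measurable borel" "\<And>y. norm (f y) \<le> M" "\<And>y. R0 \<le> norm y \<Longrightarrow> f y = 0"
    and k: "k \<ge> 0" and cont: "isCont f x"
  shows "(\<lambda>n. conv (rdelta k (eps n)) f x) \<longlonglongrightarrow> f x"
proof -
  note fm [measurable] = f(1)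
  define R where "R = \<bar>R0\<bar> + norm x + 1"
  have R: "R > 0" "norm x + R0 \<le> R" unfolding R_def using norm_ge_zero[of x] by linarith+
  have M: "M \<ge> 0" using f(2)[of 0] norm_ge_zero order.trans by blast
  define P where "P n z = 3 * (eps n)\<^sup>2 / (4 * pi * regrad (eps n) z ^ 5)" for n and z :: "real^3"
  define Q where "Q n = (\<lambda>z. rdelta k (eps n) z - of_real (P n z))" for n
  have P0: "P n z \<ge> 0" for n z unfolding P_def by (auto intro!: divide_nonneg_nonneg)
  have sp: "regrad (eps n) z > 0" for n z using regrad_pos eps_props(1) by blast
  have Pm [measurable]: "P n \<in> borel_measurable borel" for n unfolding P_def[abs_def] regrad_def by measurable
  have Qm [measurable]: "Q n \<in> borel_measurable borel" for n unfolding Q_def by measurable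
  have Pi: "integrable lborel (\<lambda>z. indicator (ball 0 R) z * P n z)"
    "(LINT z|lborel. indicator (ball 0 R) z * P n z) = (R / sqrt (R\<^sup>2 + (eps n)\<^sup>2)) ^ 3" for n
    using integral_delta_profile[OF eps_props(1) R(1), of n] unfolding P_def regrad_def by auto
  have Plim: "(\<lambda>n. (R / sqrt (R\<^sup>2 + (eps n)\<^sup>2)) ^ 3) \<longlonglongrightarrow> 1"
  proof -
    have "(\<lambda>n. (R / sqrt (R\<^sup>2 + (eps n)\<^sup>2)) ^ 3) \<longlonglongrightarrow> (R / sqrt (R\<^sup>2 + 0\<^sup>2)) ^ 3"
      using R by (intro tendsto_intros eps_props) auto
    then show ?thesis using R by simp
  qed
  have Ple: "(R / sqrt (R\<^sup>2 + (eps n)\<^sup>2)) ^ 3 \<le> 1" for n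
  proof -
    have "R \<le> sqrt (R\<^sup>2 + (eps n)\<^sup>2)" by (rule real_le_rsqrt) simp
    moreover from this have "sqrt (R\<^sup>2 + (eps n)\<^sup>2) > 0" using R by linarith
    ultimately have "R / sqrt (R\<^sup>2 + (eps n)\<^sup>2) \<le> 1" by (simp add: divide_le_eq_1_pos)
    then show ?thesis using R by (intro power_le_one) auto
  qed
  have Qb: "norm (Q n z) \<le> (6 * k + k\<^sup>2 * (R + 1)) * norm z powr (- 2)" if "z \<noteq> 0" "norm z < R" for n z
    unfolding Q_def P_def by (rule rdelta_minus_profile_bound[OF k eps_props(1,3) that])
  have Ql: "(\<lambda>n. Q n z) \<longlonglongrightarrow> 0" if z: "z \<noteq> 0" for z
  proof -
    have "(\<lambda>n. P n z) \<longlonglongrightarrow> 3 * 0\<^sup>2 / (4 * pi * sqrt ((norm z)\<^sup>2 + 0\<^sup>2) ^ 5)"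
      unfolding P_def regrad_def using z by (intro tendsto_intros eps_props) auto
    then have "(\<lambda>n. complex_of_real (P n z)) \<longlonglongrightarrow> of_real 0" by (intro tendsto_of_real) simp
    then show ?thesis unfolding Q_def
      using tendsto_diff[OF rgreen_limits(4)[OF z eps_props(4)]] by fastforce
  qed
  have "\<exists>c. c \<longlonglongrightarrow> 0 \<and> (\<forall>n x. norm x + R0 \<le> R \<longrightarrow> norm (conv (Q n) f x - conv (\<lambda>z. 0) f x) \<le> c n)"
    by (rule conv_uniform_limit(3)[where p=2, OF _ Qm _ Qb Ql f]) auto
  then obtain c where c: "c \<longlonglongrightarrow> 0" "\<And>n. norm (conv (Q n) f x) \<le> c n"
    using R(2) unfolding conv_def by auto
  have iQ: "integrable lborel (\<lambda>y. Q n (x - y) * f y)" for n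
    by (rule conv_uniform_limit(2)[where p=2 and R=R, OF _ Qm _ Qb Ql f]) (use R in auto)
  have iPf: "integrable lborel (\<lambda>y. of_real (P n (x - y)) * f y)" for n
    using conv_bound(1)[of "\<lambda>z. of_real (P n z)" f M R0 x R] f R Pi(1)[of n] P0 by auto
  have ind: "(indicator (ball 0 R) (x - y) :: real) = 1" if "norm y < R0" for y
    using that norm_triangle_ineq4[of x y] unfolding R_def by (auto simp: indicator_def)
  define J where "J n = (LINT y|lborel. of_real (indicator (ball 0 R) (x - y) * P n (x - y)) * (f y - f x))" for n
  have iJ0: "integrable lborel (\<lambda>y. complex_of_real (indicator (ball 0 R) (x - y) * P n (x - y)))" for n
    by (rule integrable_of_real, rule integrable_reflect, rule Pi(1))
  have iJ1: "integrable lborel (\<lambda>y. of_real (indicator (ball 0 R) (x - y) * P n (x - y)) * f y)"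
    and eqJ: "(\<lambda>y. of_real (indicator (ball 0 R) (x - y) * P n (x - y)) * f y) = (\<lambda>y. of_real (P n (x - y)) * f y)" for n
  proof -
    show e: "(\<lambda>y. of_real (indicator (ball 0 R) (x - y) * P n (x - y)) * f y) = (\<lambda>y. of_real (P n (x - y)) * f y)"
    proof
      fix y show "of_real (indicator (ball 0 R) (x - y) * P n (x - y)) * f y = of_real (P n (x - y)) * f y"
        using ind[of y] f(3)[of y] by (cases "norm y < R0") auto
    qed
    show "integrable lborel (\<lambda>y. of_real (indicator (ball 0 R) (x - y) * P n (x - y)) * f y)"
      unfolding e by (rule iPf)
  qed
  have J_eq: "conv (rdelta k (eps n)) f x = J n + f x * of_real ((R / sqrt (R\<^sup>2 + (eps n)\<^sup>2)) ^ 3) + conv (Q n) f x" for n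
  proof -
    have "conv (rdelta k (eps n)) f x = (LINT y|lborel. of_real (P n (x - y)) * f y + Q n (x - y) * f y)"
      unfolding conv_def Q_def by (simp add: algebra_simps)
    also have "\<dots> = (LINT y|lborel. of_real (P n (x - y)) * f y) + conv (Q n) f x"
      unfolding conv_def using iPf iQ by (rule Bochner_Integration.integral_add)
    also have "(LINT y|lborel. of_real (P n (x - y)) * f y) =
        J n + (LINT y|lborel. complex_of_real (indicator (ball 0 R) (x - y) * P n (x - y)) * f x)"
      unfolding eqJ[symmetric] J_def
      using iJ1 iJ0 by (subst Bochner_Integration.integral_add[symmetric])
        (auto simp: algebra_simps simp del: of_real_mult intro!: Bochner_Integration.integral_cong)
    also have "(LINT y|lborel. complex_of_real (indicator (ball 0 R) (x - y) * P n (x - y)) * f x)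
       = of_real (LINT y|lborel. indicator (ball 0 R) (x - y) * P n (x - y)) * f x"
      by (simp del: of_real_mult)
    also have "(LINT y|lborel. indicator (ball 0 R) (x - y) * P n (x - y)) = (R / sqrt (R\<^sup>2 + (eps n)\<^sup>2)) ^ 3"
      using integral_reflect[of "\<lambda>z. indicator (ball 0 R) z * P n z" x] Pi(2) by simp
    finally show ?thesis by (simp add: mult.commute)
  qed
  have "J \<longlonglongrightarrow> 0"
  proof (rule tendsto_norm_zero_cancel, rule LIMSEQ_I)
    fix r :: real assume r: "r > 0"
    obtain d where d: "d > 0" "\<And>y. dist y x < d \<Longrightarrow> dist (f y) (f x) < r / 2"
      using cont r unfolding continuous_at_eps_delta by (meson half_gt_zero)
    define V where "V = (LINT z|lborel. indicator (ball 0 R) (z :: real^3) * (1 :: real))"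
    have "integrable lborel (indicator (ball 0 R) :: real^3 \<Rightarrow> real)"
      by (intro integrable_real_indicator emeasure_lborel_ball_finite) simp
    then have iV: "integrable lborel (\<lambda>z. indicator (ball 0 R) (z :: real^3) * (1 :: real))" by simp
    have V: "V \<ge> 0" unfolding V_def by simp
    let ?b = "\<lambda>n. r / 2 + 2 * M * (3 * (eps n)\<^sup>2 / d ^ 5) * V"
    have b: "norm (J n) \<le> ?b n" for n
    proof -
      have "norm (J n) \<le> (LINT y|lborel. (r / 2) * (indicator (ball 0 R) (x - y) * P n (x - y)) +
          2 * M * (3 * (eps n)\<^sup>2 / d ^ 5) * (indicator (ball 0 R) (x - y) * 1))"
        unfolding J_def
      proof (rule Bochner_Integration.integral_norm_bound_integral)
        show "integrable lborel (\<lambda>y. of_real (indicator (ball 0 R) (x - y) * P n (x - y)) * (f y - f x))"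
          unfolding right_diff_distrib using iJ1[of n] iJ0[of n] by (intro Bochner_Integration.integrable_diff) auto
        show "integrable lborel (\<lambda>y. (r / 2) * (indicator (ball 0 R) (x - y) * P n (x - y)) +
          2 * M * (3 * (eps n)\<^sup>2 / d ^ 5) * (indicator (ball 0 R) (x - y) * 1))"
          using integrable_reflect[OF Pi(1), of x n] integrable_reflect[OF iV, of x] by auto
        fix y
        (* Close to x the continuity of f gives the first term; at distance at least d
           the profile itself is of order eps n squared. *)
        have "P n (x - y) * norm (f y - f x) \<le> (r / 2) * P n (x - y) + 2 * M * (3 * (eps n)\<^sup>2 / d ^ 5)"
        proof (cases "norm (x - y) < d")
          case True
          then have "norm (f y - f x) \<le> r / 2"
            using d(2)[of y] by (simp add: dist_norm norm_minus_commute)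
          then have "P n (x - y) * norm (f y - f x) \<le> P n (x - y) * (r / 2)"
            using P0 by (intro mult_left_mono)
          moreover have "0 \<le> 2 * M * (3 * (eps n)\<^sup>2 / d ^ 5)" using M d by simp
          ultimately show ?thesis by (simp add: mult.commute)
        next
          case False
          have "norm (f y - f x) \<le> 2 * M"
            using norm_triangle_ineq4[of "f y" "f x"] f(2)[of x] f(2)[of y] by linarith
          moreover have "P n (x - y) \<le> 3 * (eps n)\<^sup>2 / d ^ 5"
            unfolding P_def
          proof (rule divide_left_mono)
            have "d ^ 5 \<le> regrad (eps n) (x - y) ^ 5"
              using False d norm_le_regrad[of "x - y" "eps n"] by (intro power_mono) auto
            also have "\<dots> \<le> 4 * pi * regrad (eps n) (x - y) ^ 5"
              using mult_right_mono[of 1 "4 * pi" "regrad (eps n) (x - y) ^ 5"] pi_ge_two by simp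
            finally show "d ^ 5 \<le> 4 * pi * regrad (eps n) (x - y) ^ 5" .
          qed (use sp d in auto)
          ultimately have "P n (x - y) * norm (f y - f x) \<le> (3 * (eps n)\<^sup>2 / d ^ 5) * (2 * M)"
            using d by (intro mult_mono) auto
          moreover have "0 \<le> (r / 2) * P n (x - y)" using r P0 by simp
          ultimately show ?thesis by (simp add: mult.commute)
        qed
        then show "norm (of_real (indicator (ball 0 R) (x - y) * P n (x - y)) * (f y - f x)) \<le>
          (r / 2) * (indicator (ball 0 R) (x - y) * P n (x - y)) +
          2 * M * (3 * (eps n)\<^sup>2 / d ^ 5) * (indicator (ball 0 R) (x - y) * 1)"
          using P0 unfolding norm_mult norm_of_real by (auto simp: indicator_def)
      qed
      also have "\<dots> = (r / 2) * (R / sqrt (R\<^sup>2 + (eps n)\<^sup>2)) ^ 3 + 2 * M * (3 * (eps n)\<^sup>2 / d ^ 5) * V"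
        unfolding Pi(2)[symmetric] V_def
        using integrable_reflect[OF Pi(1), of x n] integrable_reflect[OF iV, of x]
          integral_reflect[of "\<lambda>z. indicator (ball 0 R) z * P n z" x]
          integral_reflect[of "\<lambda>z. indicator (ball 0 R) (z::real^3) * (1::real)" x]
        by (subst Bochner_Integration.integral_add) auto
      also have "\<dots> \<le> ?b n" using Ple[of n] r mult_left_mono[of _ 1 "r/2"] by simp
      finally show ?thesis .
    qed
    have "?b \<longlonglongrightarrow> r / 2 + 2 * M * (3 * 0\<^sup>2 / d ^ 5) * V"
      using d by (intro tendsto_intros eps_props) auto
    then have "\<forall>\<^sub>F n in sequentially. ?b n < r" by (rule order_tendstoD(2)) (use r in simp)
    then show "\<exists>no. \<forall>n\<ge>no. norm (norm (J n) - 0) < r"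
      unfolding eventually_sequentially using b by (auto intro: le_less_trans)
  qed
  moreover have "(\<lambda>n. f x * complex_of_real ((R / sqrt (R\<^sup>2 + (eps n)\<^sup>2)) ^ 3)) \<longlonglongrightarrow> f x * of_real 1"
    by (intro tendsto_intros tendsto_of_real Plim)
  moreover have "(\<lambda>n. conv (Q n) f x) \<longlonglongrightarrow> 0"
    by (rule Lim_null_comparison[OF _ c(1)]) (use c(2) in auto)
  ultimately have "(\<lambda>n. J n + f x * complex_of_real ((R / sqrt (R\<^sup>2 + (eps n)\<^sup>2)) ^ 3) + conv (Q n) f x) \<longlonglongrightarrow> 0 + f x * of_real 1 + 0"
    by (intro tendsto_add)
  then show ?thesis unfolding J_eq by simp
qed

section \<open>Second derivatives of potentials\<close>

text \<open>The second derivatives of the Green function have the non-integrable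
  singularity \<open>norm z powr (-3)\<close>. Since \<open>near2\<close> has integral
  zero before the limit, \<open>f y\<close> may be replaced by \<open>f y - f x\<close>
  in the near part, and Hoelder continuity turns the singularity into the integrable
  \<open>norm z powr (\<alpha> - 3)\<close>. So the second derivatives of the
  regularised potentials converge uniformly, and the equation is the limit of
  \<open>rgreen2_trace\<close> by \<open>delta_limit\<close>. The radii are chosen such
  that \<open>y\<close> stays in the large ball when \<open>x\<close> is in the small
  one and \<open>x - y\<close> in the support of \<open>near2\<close>.\<close>

lemma potential_C2:
  assumes f: "f \<in> borel_measurable borel" "\<And>y. norm (f y) \<le> M" "\<And>y. R0 \<le> norm y \<Longrightarrow> f y = 0"
    and k: "k \<ge> 0" and \<rho>: "\<rho> > 0" and \<alpha>: "\<alpha> > 0"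
    and hol: "\<And>x y. x \<in> ball c (4 * \<rho>) \<Longrightarrow> y \<in> ball c (4 * \<rho>) \<Longrightarrow> norm (f x - f y) \<le> H * norm (x - y) powr \<alpha>"
  shows "C2_on (ball c (2 * \<rho>)) (conv (rgreen k 0) f)"
    and "\<And>x. x \<in> ball c (2 * \<rho>) \<Longrightarrow>
      laplacian (conv (rgreen k 0) f) x = - (of_real k)\<^sup>2 * conv (rgreen k 0) f x - f x"
proof -
  note fm [measurable] = f(1)
  note fi = bounded_support_integrable[OF f]
  let ?B = "ball c (2 * \<rho>)"
  have H: "H \<ge> 0"
  proof -
    have "c + \<rho> *\<^sub>R axis 1 1 \<in> ball c (4 * \<rho>)" "c \<in> ball c (4 * \<rho>)" using \<rho> by (auto simp: dist_norm)
    from order.trans[OF norm_ge_zero hol[OF this]] have "0 \<le> H * \<rho> powr \<alpha>" using \<rho> by simp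
    then show ?thesis using \<rho> by (simp add: zero_le_mult_iff)
  qed
  define R where "R = norm c + 2 * \<rho> + \<bar>R0\<bar>"
  have R: "norm x + R0 \<le> R" if "x \<in> ?B" for x
    using that norm_triangle_ineq2[of x c] unfolding R_def by (auto simp: dist_norm norm_minus_commute)
  have Rpos: "R > 0" unfolding R_def using \<rho> norm_ge_zero[of c] by linarith
  define Cb where "Cb R = 2 * (3 + 3 * k * (R + 1) + (k * (R + 1))\<^sup>2) +
      8 / \<rho>\<^sup>2 * R\<^sup>2 * (3 + 3 * k * (R + 1) + (k * (R + 1))\<^sup>2)" for R
  note nb = near2_far2_bounds[OF k eps_props(2) eps_props(3) _ _ \<rho>, folded Cb_def]
  define N where "N e i j z = near2 \<rho> k e i j z * of_real (norm z powr \<alpha>)" for e i j and z :: "real^3"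
  have Nm [measurable]: "N e i j \<in> borel_measurable borel" for e i j unfolding N_def by measurable
  have Nb: "norm (N (eps n) i j z) \<le> Cb (2 * \<rho>) * norm z powr (- (3 - \<alpha>))"
    if "z \<noteq> 0" "norm z < 2 * \<rho>" for n i j z
  proof -
    have "norm (N (eps n) i j z) \<le> Cb (2 * \<rho>) / norm z ^ 3 * norm z powr \<alpha>"
      unfolding N_def norm_mult norm_of_real using mult_right_mono[OF nb(1)[OF that], of "norm z powr \<alpha>"] by simp
    also have "\<dots> = Cb (2 * \<rho>) * norm z powr (- (3 - \<alpha>))"
      using that by (simp add: powr_diff powr_minus_divide powr_numeral)
    finally show ?thesis .
  qed
  have lim12: "(\<lambda>n. near2 \<rho> k (eps n) i j z) \<longlonglongrightarrow> near2 \<rho> k 0 i j z"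
    "(\<lambda>n. far2 \<rho> k (eps n) i j z) \<longlonglongrightarrow> far2 \<rho> k 0 i j z" if "z \<noteq> 0" for z i j
    unfolding near2_def far2_def by (intro tendsto_intros rgreen_limits that eps_props(4))+
  have Nl: "(\<lambda>n. N (eps n) i j z) \<longlonglongrightarrow> N 0 i j z" if "z \<noteq> 0" for i j z
    unfolding N_def by (intro tendsto_intros lim12 that)
  have p3: "3 - \<alpha> < 3" using \<alpha> by simp
  note kN = kernel_L1_limit[where p="3 - \<alpha>" and R="2 * \<rho>" and K="\<lambda>n. N (eps n) i j" and K'="N 0 i j" and C="Cb (2 * \<rho>)" for i j,
      OF p3 Nm Nm Nb Nl]
  define J where "J e i j x = (LINT y|lborel. near2 \<rho> k e i j (x - y) * (f y - f x))" for e i j x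
  have Jle: "norm (near2 \<rho> k e i j (x - y) * (f y - f x)) \<le> H * (indicator (ball 0 (2 * \<rho>)) (x - y) * norm (N e i j (x - y)))"
    if x: "x \<in> ?B" for e i j x y
  proof (cases "norm (x - y) < 2 * \<rho>")
    case True
    have "dist c y < 4 * \<rho>" using x True dist_triangle[of c y x] by (simp add: dist_norm)
    then have "norm (f y - f x) \<le> H * norm (x - y) powr \<alpha>"
      using hol[of y x] x \<rho> by (simp add: norm_minus_commute)
    then have "norm (near2 \<rho> k e i j (x - y)) * norm (f y - f x) \<le> norm (near2 \<rho> k e i j (x - y)) * (H * norm (x - y) powr \<alpha>)"
      by (rule mult_left_mono) simp
    then show ?thesis using True unfolding N_def by (simp add: norm_mult mult_ac)
  next
    case False
    then show ?thesis using near2_outside[OF \<rho>, of "x - y"] by simp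
  qed
  have iJ: "integrable lborel (\<lambda>y. near2 \<rho> k e i j (x - y) * (f y - f x))"
    if x: "x \<in> ?B" and N: "integrable lborel (\<lambda>z. indicator (ball 0 (2 * \<rho>)) z * norm (N e i j z))" for e i j x
  proof (rule Bochner_Integration.integrable_bound)
    show "integrable lborel (\<lambda>y. H * (indicator (ball 0 (2 * \<rho>)) (x - y) * norm (N e i j (x - y))))"
      using integrable_reflect[OF N, of x] by simp
    show "AE y in lborel. norm (near2 \<rho> k e i j (x - y) * (f y - f x)) \<le>
        norm (H * (indicator (ball 0 (2 * \<rho>)) (x - y) * norm (N e i j (x - y))))"
      by (rule AE_I2, unfold real_norm_def, rule order.trans[OF Jle[OF x] abs_ge_self])
  qed measurable
  have Junif: "\<exists>a. a \<longlonglongrightarrow> 0 \<and> (\<forall>n. \<forall>x\<in>?B. norm (J (eps n) i j x - J 0 i j x) \<le> a n)" for i j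
  proof (intro exI conjI allI ballI)
    let ?a = "\<lambda>n. H * (LINT z|lborel. indicator (ball 0 (2 * \<rho>)) z * norm (N (eps n) i j z - N 0 i j z))"
    show "?a \<longlonglongrightarrow> 0" using tendsto_mult_right_zero[OF kN(4)] .
    fix n x assume x: "x \<in> ?B"
    have D: "N (eps n) i j z - N 0 i j z = (near2 \<rho> k (eps n) i j z - near2 \<rho> k 0 i j z) * of_real (norm z powr \<alpha>)" for z
      unfolding N_def by (simp add: algebra_simps)
    have "J (eps n) i j x - J 0 i j x = (LINT y|lborel. (near2 \<rho> k (eps n) i j (x - y) * (f y - f x)) - (near2 \<rho> k 0 i j (x - y) * (f y - f x)))"
      unfolding J_def using iJ[OF x kN(2)] iJ[OF x kN(1)] by (rule Bochner_Integration.integral_diff[symmetric])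
    also have "norm \<dots> \<le> (LINT y|lborel. H * (indicator (ball 0 (2 * \<rho>)) (x - y) * norm (N (eps n) i j (x - y) - N 0 i j (x - y))))"
    proof (rule Bochner_Integration.integral_norm_bound_integral)
      show "integrable lborel (\<lambda>y. (near2 \<rho> k (eps n) i j (x - y) * (f y - f x)) - (near2 \<rho> k 0 i j (x - y) * (f y - f x)))"
        using iJ[OF x kN(2)] iJ[OF x kN(1)] by (rule Bochner_Integration.integrable_diff)
      show "integrable lborel (\<lambda>y. H * (indicator (ball 0 (2 * \<rho>)) (x - y) * norm (N (eps n) i j (x - y) - N 0 i j (x - y))))"
        using integrable_reflect[OF kN(3), of x] by simp
      fix y
      show "norm ((near2 \<rho> k (eps n) i j (x - y) * (f y - f x)) - (near2 \<rho> k 0 i j (x - y) * (f y - f x)))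
        \<le> H * (indicator (ball 0 (2 * \<rho>)) (x - y) * norm (N (eps n) i j (x - y) - N 0 i j (x - y)))"
      proof (cases "norm (x - y) < 2 * \<rho>")
        case True
        have "dist c y < 4 * \<rho>" using x True dist_triangle[of c y x] by (simp add: dist_norm)
        then have "norm (f y - f x) \<le> H * norm (x - y) powr \<alpha>"
          using hol[of y x] x \<rho> by (simp add: norm_minus_commute)
        then have "norm (near2 \<rho> k (eps n) i j (x - y) - near2 \<rho> k 0 i j (x - y)) * norm (f y - f x)
          \<le> norm (near2 \<rho> k (eps n) i j (x - y) - near2 \<rho> k 0 i j (x - y)) * (H * norm (x - y) powr \<alpha>)"
          by (rule mult_left_mono) simp
        then show ?thesis using True unfolding D left_diff_distrib[symmetric] norm_mult by (simp add: mult_ac)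
      next
        case False
        then show ?thesis using near2_outside[OF \<rho>, of "x - y"] by simp
      qed
    qed
    also have "\<dots> = ?a n"
      using integral_reflect[of "\<lambda>z. indicator (ball 0 (2 * \<rho>)) z * norm (N (eps n) i j z - N 0 i j z)" x] by simp
    finally show "norm (J (eps n) i j x - J 0 i j x) \<le> ?a n" .
  qed
  have Fb: "norm (far2 \<rho> k (eps n) i j z) \<le> Cb R / \<rho> ^ 3 * norm z powr (- 0)" if "z \<noteq> 0" "norm z < R" for n i j z
  proof -
    have C0: "0 \<le> Cb R" using order.trans[OF norm_ge_zero nb(2)[OF that]] that by (simp add: zero_le_divide_iff)
    show ?thesis
    proof (cases "norm z \<le> \<rho>")
      case True
      then show ?thesis using far2_inside[OF \<rho> True] C0 \<rho> that by simp
    next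
      case False
      then have "Cb R / norm z ^ 3 \<le> Cb R / \<rho> ^ 3"
        using \<rho> C0 that by (intro divide_left_mono power_mono) auto
      then show ?thesis using nb(2)[OF that, of n i j] that by simp
    qed
  qed
  have Funif: "\<exists>a. a \<longlonglongrightarrow> 0 \<and> (\<forall>n x. norm x + R0 \<le> R \<longrightarrow> norm (conv (far2 \<rho> k (eps n) i j) f x - conv (far2 \<rho> k 0 i j) f x) \<le> a n)" for i j
    by (rule conv_uniform_limit(3)[where p=0, OF _ _ _ Fb lim12(2) f]) auto
  have Fint: "integrable lborel (\<lambda>y. far2 \<rho> k (eps n) i j (x - y) * f y)" if "x \<in> ?B" for n i j x
    by (rule conv_uniform_limit(2)[where p=0 and R=R, OF _ _ _ Fb lim12(2) f]) (use R[OF that] in auto)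
  have split: "conv (rgreen2 k (eps n) i j) f x = J (eps n) i j x + conv (far2 \<rho> k (eps n) i j) f x" if x: "x \<in> ?B" for n i j x
  proof -
    have cN: "continuous_on UNIV (near2 \<rho> k (eps n) i j)"
      unfolding near2_def by (intro continuous_intros bump_continuous rgreen_continuous) (use eps_props in auto)
    have iN: "integrable lborel (near2 \<rho> k (eps n) i j)"
      by (rule integrable_continuous_support[OF cN, of "2 * \<rho>"]) (use near2_outside[OF \<rho>] in auto)
    have i0: "integrable lborel (\<lambda>y. near2 \<rho> k (eps n) i j (x - y))" by (rule integrable_reflect[OF iN])
    have z: "(LINT y|lborel. near2 \<rho> k (eps n) i j (x - y)) = 0"
      using integral_reflect[of "near2 \<rho> k (eps n) i j" x] near2_integral[OF eps_props(1) \<rho>] by simp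
    have "J (eps n) i j x = J (eps n) i j x + (LINT y|lborel. near2 \<rho> k (eps n) i j (x - y) * f x)"
      using z by simp
    also have "\<dots> = (LINT y|lborel. near2 \<rho> k (eps n) i j (x - y) * (f y - f x) + near2 \<rho> k (eps n) i j (x - y) * f x)"
      unfolding J_def
      by (rule Bochner_Integration.integral_add[symmetric]) (use iJ[OF x kN(2)] i0 in auto)
    also have "\<dots> = (LINT y|lborel. near2 \<rho> k (eps n) i j (x - y) * f y)" by (simp add: algebra_simps)
    finally have "J (eps n) i j x + conv (far2 \<rho> k (eps n) i j) f x =
       (LINT y|lborel. near2 \<rho> k (eps n) i j (x - y) * f y) + (LINT y|lborel. far2 \<rho> k (eps n) i j (x - y) * f y)"
      unfolding conv_def by simp
    also have "\<dots> = (LINT y|lborel. near2 \<rho> k (eps n) i j (x - y) * f y + far2 \<rho> k (eps n) i j (x - y) * f y)"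
      by (rule Bochner_Integration.integral_add[symmetric])
         (use conv_integrable_continuous[OF cN fi f(3)] Fint[OF x] in auto)
    also have "\<dots> = conv (rgreen2 k (eps n) i j) f x"
      unfolding conv_def near_far[of k _ i j _ \<rho>] by (simp add: algebra_simps)
    finally show ?thesis by simp
  qed
  define W where "W i j x = J 0 i j x + conv (far2 \<rho> k 0 i j) f x" for i j x
  have Wunif: "\<exists>a. a \<longlonglongrightarrow> 0 \<and> (\<forall>n. \<forall>x\<in>?B. norm (conv (rgreen2 k (eps n) i j) f x - W i j x) \<le> a n)" for i j
  proof -
    obtain a where a: "a \<longlonglongrightarrow> 0" "\<And>n x. x \<in> ?B \<Longrightarrow> norm (J (eps n) i j x - J 0 i j x) \<le> a n"
      using Junif by blast
    obtain b where b: "b \<longlonglongrightarrow> 0" "\<And>n x. norm x + R0 \<le> R \<Longrightarrow> norm (conv (far2 \<rho> k (eps n) i j) f x - conv (far2 \<rho> k 0 i j) f x) \<le> b n"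
      using Funif by blast
    have "(\<lambda>n. a n + b n) \<longlonglongrightarrow> 0" using tendsto_add[OF a(1) b(1)] by simp
    moreover have "norm (conv (rgreen2 k (eps n) i j) f x - W i j x) \<le> a n + b n" if x: "x \<in> ?B" for n x
      unfolding split[OF x] W_def
      using norm_triangle_ineq[of "J (eps n) i j x - J 0 i j x" "conv (far2 \<rho> k (eps n) i j) f x - conv (far2 \<rho> k 0 i j) f x"]
        a(2)[OF x, of n] b(2)[OF R[OF x], of n] by (simp add: algebra_simps)
    ultimately show ?thesis by blast
  qed
  have Wlim: "(\<lambda>n. conv (rgreen2 k (eps n) i j) f x) \<longlonglongrightarrow> W i j x" if x: "x \<in> ?B" for i j x
  proof -
    obtain a where a: "a \<longlonglongrightarrow> 0" "\<And>n. norm (conv (rgreen2 k (eps n) i j) f x - W i j x) \<le> a n"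
      using Wunif[of i j] x by blast
    show ?thesis by (rule LIMSEQ_of_norm_le[OF a(2,1)])
  qed
  have pd1: "pd i (rgreen1 k (eps n) j) = rgreen2 k (eps n) i j" for i j n
    using rgreen_C2(4)[of UNIV "eps n"] eps_props(1) by auto
  have C1: "C1_on UNIV (rgreen1 k (eps n) j)" for n j
    using rgreen_C2(3)[of UNIV "eps n"] eps_props(1) by auto
  have gr: "has_grad (conv (rgreen1 k (eps n) j) f) (\<lambda>i. conv (rgreen2 k (eps n) i j) f x) x" for n j x
    using conv_has_grad[OF C1 fi f(3)] unfolding pd1 .
  have ct: "continuous_on ?B (conv (rgreen2 k (eps n) i j) f)" for n i j
  proof -
    have "continuous_on UNIV (rgreen2 k (eps n) i j)"
      by (rule rgreen_continuous(3)) (simp add: eps_props(1))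
    from conv_continuous[OF this fi f(3)] show ?thesis by (rule continuous_on_subset) auto
  qed
  note L1 = regularized_potential(3)[OF f k]
  have g2: "has_grad (conv (rgreen1 k 0 j) f) (\<lambda>i. W i j x) x" if "x \<in> ?B" for j x
    by (rule C1_uniform_limit(1)[where S="?B" and f="\<lambda>n. conv (rgreen1 k (eps n) j) f"
          and g="\<lambda>n x i. conv (rgreen2 k (eps n) i j) f x"])
       (use gr ct L1 Wunif that in auto)
  have c2: "continuous_on ?B (W i j)" for i j
    using C1_uniform_limit(2)[where S="?B" and f="\<lambda>n. conv (rgreen1 k (eps n) j) f" and F="conv (rgreen1 k 0 j) f"
          and g="\<lambda>n x i. conv (rgreen2 k (eps n) i j) f x" and G="\<lambda>x i. W i j x" and j=i]
       gr ct L1 Wunif by auto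
  note g1 = potential_C1[OF f k]
  have p1: "pd j (conv (rgreen k 0) f) = conv (rgreen1 k 0 j) f" for j
    using has_grad_pd[OF g1(1)] by auto
  have CV: "C1_on ?B (conv (rgreen k 0) f)"
    by (rule C1_onI[OF g1(1)]) (use g1(2) in \<open>auto intro: continuous_on_subset\<close>)
  have CW: "C1_on ?B (conv (rgreen1 k 0 j) f)" for j
    by (rule C1_onI[OF g2]) (use c2 in auto)
  show "C2_on ?B (conv (rgreen k 0) f)" unfolding C2_on_def p1 using CV CW by blast
  fix x assume x: "x \<in> ?B"
  have lap: "laplacian (conv (rgreen k 0) f) x = (\<Sum>j\<in>UNIV. W j j x)"
    unfolding laplacian_def p1 using has_grad_pd[OF g2[OF x]] by simp
  have sum_eq: "(\<Sum>j\<in>UNIV. conv (rgreen2 k (eps n) j j) f x) =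
      - (of_real k)\<^sup>2 * conv (rgreen k (eps n)) f x - conv (rdelta k (eps n)) f x" for n
  proof -
    note ci = conv_integrable_continuous[OF _ fi f(3)]
    have i2: "integrable lborel (\<lambda>y. rgreen2 k (eps n) j j (x - y) * f y)" for j
      by (intro ci rgreen_continuous) (simp add: eps_props)
    have i0: "integrable lborel (\<lambda>y. rgreen k (eps n) (x - y) * f y)"
      by (intro ci rgreen_continuous) (simp add: eps_props)
    have id: "integrable lborel (\<lambda>y. rdelta k (eps n) (x - y) * f y)"
      by (intro ci rgreen_continuous) (simp add: eps_props)
    have "(\<Sum>j\<in>UNIV. conv (rgreen2 k (eps n) j j) f x) = (LINT y|lborel. (\<Sum>j\<in>UNIV. rgreen2 k (eps n) j j (x - y) * f y))"
      unfolding conv_def using i2 by (intro Bochner_Integration.integral_sum[symmetric]) auto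
    also have "\<dots> = (LINT y|lborel. - (of_real k)\<^sup>2 * (rgreen k (eps n) (x - y) * f y) - rdelta k (eps n) (x - y) * f y)"
    proof -
      have tr: "(\<Sum>j\<in>UNIV. rgreen2 k (eps n) j j (x - y)) =
          - (of_real k)\<^sup>2 * rgreen k (eps n) (x - y) - rdelta k (eps n) (x - y)" for y
        by (rule rgreen2_trace) (simp add: eps_props)
      show ?thesis unfolding sum_distrib_right[symmetric] tr by (simp add: algebra_simps)
    qed
    also have "\<dots> = - (of_real k)\<^sup>2 * conv (rgreen k (eps n)) f x - conv (rdelta k (eps n)) f x"
      unfolding conv_def using i0 id by (subst Bochner_Integration.integral_diff) auto
    finally show ?thesis .
  qed
  have cf: "isCont f x"
  proof -
    have xb: "x \<in> ball c (4 * \<rho>)" using x \<rho> by simp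
    have "\<forall>\<^sub>F y in at x. y \<in> ball c (4 * \<rho>)"
      using xb by (intro eventually_at_in_open') auto
    then have "\<forall>\<^sub>F y in at x. norm (f y - f x) \<le> H * norm (y - x) powr \<alpha>"
      by eventually_elim (use hol xb in blast)
    from tendsto_of_holder[OF this \<alpha>] show ?thesis unfolding isCont_def .
  qed
  have "(\<lambda>n. \<Sum>j\<in>UNIV. conv (rgreen2 k (eps n) j j) f x) \<longlonglongrightarrow> (\<Sum>j\<in>UNIV. W j j x)"
    by (intro tendsto_sum Wlim x)
  moreover have "(\<lambda>n. \<Sum>j\<in>UNIV. conv (rgreen2 k (eps n) j j) f x) \<longlonglongrightarrow> - (of_real k)\<^sup>2 * conv (rgreen k 0) f x - f x"
    unfolding sum_eq by (intro tendsto_intros regularized_potential(2)[OF f k] delta_limit[OF f k cf])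
  ultimately show "laplacian (conv (rgreen k 0) f) x = - (of_real k)\<^sup>2 * conv (rgreen k 0) f x - f x"
    unfolding lap using LIMSEQ_unique by blast
qed

section \<open>The incident wave and the far field\<close>

lemma has_grad_shift:
  assumes "has_grad f g (x - c)"
  shows "has_grad (\<lambda>x. f (x - c)) g x"
proof -
  have "((\<lambda>x. x - c) has_derivative (\<lambda>h. h)) (at x)" by (auto intro!: derivative_eq_intros)
  from diff_chain_at[OF this assms[unfolded has_grad_def]] show ?thesis
    unfolding has_grad_def by (simp add: o_def)
qed

lemma incident_C2:
  shows "C2_on (- {x0}) (incident k0 x0)"
    and "x \<noteq> x0 \<Longrightarrow> laplacian (incident k0 x0) x = - (of_real k0)\<^sup>2 * incident k0 x0 x"
proof -
  have inc: "incident k0 x0 = (\<lambda>x. rgreen k0 0 (x - x0))"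
    unfolding incident_def green_def rgreen_def profile0_def by simp
  let ?S = "- {x0}"
  have o: "open ?S" by auto
  have g0: "has_grad (incident k0 x0) (\<lambda>j. rgreen1 k0 0 j (x - x0)) x" if "x \<in> ?S" for x
    unfolding inc by (rule has_grad_shift, rule rgreen_has_grad) (use that in auto)
  have g1: "has_grad (\<lambda>x. rgreen1 k0 0 j (x - x0)) (\<lambda>i. rgreen2 k0 0 i j (x - x0)) x" if "x \<in> ?S" for x j
    by (rule has_grad_shift, rule rgreen1_has_grad) (use that in auto)
  have c: "continuous_on ?S (\<lambda>x. rgreen1 k0 0 j (x - x0))" "continuous_on ?S (\<lambda>x. rgreen2 k0 0 i j (x - x0))" for i j
    by (intro continuous_on_compose2[OF rgreen_continuous(2)[where S="-{0}" and e=0]]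
        continuous_on_compose2[OF rgreen_continuous(3)[where S="-{0}" and e=0]] continuous_intros; auto)+
  have p0: "pd j (incident k0 x0) x = rgreen1 k0 0 j (x - x0)" if "x \<in> ?S" for x j
    by (rule has_grad_pd[OF g0[OF that]])
  have C0: "C1_on ?S (incident k0 x0)" by (rule C1_onI[OF g0]) (use c in auto)
  have C1: "C1_on ?S (\<lambda>x. rgreen1 k0 0 j (x - x0))" for j by (rule C1_onI[OF g1]) (use c in auto)
  have C1': "C1_on ?S (pd j (incident k0 x0))" for j
    by (rule C1_on_cong[OF o _ C1]) (simp add: p0)
  show "C2_on ?S (incident k0 x0)" unfolding C2_on_def using C0 C1' by blast
  assume "x \<noteq> x0"
  then have x: "x \<in> ?S" by simp
  have "pd j (pd j (incident k0 x0)) x = rgreen2 k0 0 j j (x - x0)" for j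
    using pd_cong_open[of ?S x "pd j (incident k0 x0)" "\<lambda>x. rgreen1 k0 0 j (x - x0)" j] o x p0 has_grad_pd[OF g1[OF x]]
    by simp
  then have "laplacian (incident k0 x0) x = - (of_real k0)\<^sup>2 * rgreen k0 0 (x - x0) - rdelta k0 0 (x - x0)"
    unfolding laplacian_def using rgreen2_trace[of 0 "x - x0" k0] x by simp
  then show "laplacian (incident k0 x0) x = - (of_real k0)\<^sup>2 * incident k0 x0 x"
    unfolding inc rdelta_def by simp
qed

lemma incident_measurable [measurable]: "incident k0 x0 \<in> borel_measurable borel"
  unfolding incident_def[abs_def] green_def by measurable

lemma green_eq_rgreen: "green k0 x y = rgreen k0 0 (x - y)"
  unfolding green_def rgreen_def profile0_def by simp

text \<open>The radial derivative of the spherical wave around \<open>y\<close> is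
  \<open>\<i> * k\<close> times the wave, up to a factor that involves only the cosine
  of the angle between \<open>w\<close> and \<open>w - y\<close>. This cosine differs
  from 1 by at most \<open>2 * M / norm (w - y)\<close>.\<close>

lemma far_field_kernel:
  assumes k: "k \<ge> 0" and y: "norm y \<le> M" and w: "norm w \<ge> 2 * M + 1"
  shows "norm ((\<Sum>j\<in>UNIV. ((w /\<^sub>R norm w) $ j) *\<^sub>R rgreen1 k 0 j (w - y)) - \<i> * of_real k * rgreen k 0 (w - y))
      \<le> 4 * (2 * k * M + 1) / (norm w)\<^sup>2"
    and "norm (rgreen k 0 (w - y)) \<le> 2 / norm w"
proof -
  define z where "z = w - y"
  define r where "r = norm z"
  define \<omega> where "\<omega> = w /\<^sub>R norm w"
  have M: "M \<ge> 0" using y norm_ge_zero order.trans by blast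
  have w0: "norm w > 0" using w M by linarith
  have rw: "r \<ge> norm w / 2"
    using norm_triangle_ineq2[of w y] y w M unfolding r_def z_def by linarith
  then have r: "r > 0" using w0 by linarith
  have \<omega>: "norm \<omega> = 1" unfolding \<omega>_def using w0 by simp
  define t where "t = \<omega> \<bullet> z / r"
  have t1: "\<bar>t\<bar> \<le> 1"
    using Cauchy_Schwarz_ineq2[of \<omega> z] r unfolding t_def r_def \<omega> by simp
  have t2: "\<bar>t - 1\<bar> \<le> 2 * M / r"
  proof -
    have "\<omega> \<bullet> w = norm w" unfolding \<omega>_def using w0 by (simp add: dot_square_norm power2_eq_square)
    then have "\<omega> \<bullet> z - r = (norm w - r) - \<omega> \<bullet> y" unfolding z_def by (simp add: inner_diff_right)
    moreover have "\<bar>norm w - r\<bar> \<le> norm y" using norm_triangle_ineq3[of w z] unfolding r_def z_def by simp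
    moreover have "\<bar>\<omega> \<bullet> y\<bar> \<le> norm y" using Cauchy_Schwarz_ineq2[of \<omega> y] \<omega> by simp
    ultimately have "\<bar>\<omega> \<bullet> z - r\<bar> \<le> 2 * M" using y by linarith
    moreover have "t - 1 = (\<omega> \<bullet> z - r) / r" unfolding t_def using r by (simp add: field_simps)
    ultimately show ?thesis using r by (simp add: divide_right_mono)
  qed
  define E where "E = exp (\<i> * of_real (k * r))"
  have E: "norm E = 1" unfolding E_def by (simp only: norm_exp_i_times)
  have pi4: "1 \<le> 4 * pi" using pi_ge_two by simp
  have ge: "(\<Sum>j\<in>UNIV. (\<omega> $ j) *\<^sub>R rgreen1 k 0 j z) = of_real (\<omega> \<bullet> z) * profile1 k r"
    unfolding rgreen1_def r_def[symmetric] regrad_0 inner_vec_def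
    by (simp add: scaleR_conv_of_real sum_distrib_right mult.assoc)
  have "(\<Sum>j\<in>UNIV. (\<omega> $ j) *\<^sub>R rgreen1 k 0 j z) - \<i> * of_real k * rgreen k 0 z
     = E / of_real (4 * pi * r) * (\<i> * of_real (k * (t - 1)) - of_real (t / r))"
    unfolding ge rgreen_def profile0_def profile1_def regrad_0 r_def[symmetric] E_def[symmetric] t_def
    using r by (simp add: field_simps power3_eq_cube)
  also have "norm \<dots> \<le> 1 / (4 * pi * r) * ((2 * k * M + 1) / r)"
  proof -
    have "norm (\<i> * of_real (k * (t - 1)) - complex_of_real (t / r)) \<le> \<bar>k * (t - 1)\<bar> + \<bar>t / r\<bar>"
      by (rule order.trans[OF norm_triangle_ineq4]) (simp only: norm_mult[of \<i>] norm_of_real norm_ii mult_1 order.refl)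
    also have "\<dots> \<le> k * (2 * M / r) + 1 / r"
      unfolding abs_mult abs_divide using t1 t2 k r
      by (intro add_mono mult_mono frac_le) auto
    finally have le: "norm (\<i> * of_real (k * (t - 1)) - complex_of_real (t / r)) \<le> (2 * k * M + 1) / r"
      by (simp add: add_divide_distrib mult_ac)
    have "norm (E / of_real (4 * pi * r)) = 1 / (4 * pi * r)"
      unfolding norm_divide E norm_of_real using r by simp
    then show ?thesis unfolding norm_mult[of "E / of_real (4 * pi * r)"] using le r
      by (simp only:) (rule mult_left_mono, auto)
  qed
  also have "\<dots> \<le> 4 * (2 * k * M + 1) / (norm w)\<^sup>2"
  proof -
    have "(norm w)\<^sup>2 \<le> (2 * r)\<^sup>2" using rw w0 by (intro power_mono) auto
    then have "(norm w)\<^sup>2 \<le> 4 * r\<^sup>2" by (simp add: power_mult_distrib)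
    also have "\<dots> \<le> 4 * (4 * pi * r * r)" using mult_right_mono[OF pi4, of "r * r"] by (simp add: power2_eq_square)
    finally have "(2 * k * M + 1) * (norm w)\<^sup>2 \<le> (2 * k * M + 1) * (4 * (4 * pi * r * r))"
      using k M by (intro mult_left_mono) auto
    then show ?thesis using r w0 by (simp add: field_simps)
  qed
  finally show "norm ((\<Sum>j\<in>UNIV. ((w /\<^sub>R norm w) $ j) *\<^sub>R rgreen1 k 0 j (w - y)) - \<i> * of_real k * rgreen k 0 (w - y))
      \<le> 4 * (2 * k * M + 1) / (norm w)\<^sup>2" unfolding \<omega>_def z_def .
  have "norm (rgreen k 0 z) = 1 / (4 * pi * r)"
    unfolding rgreen_def profile0_def regrad_0 r_def[symmetric] E_def[symmetric] norm_divide E norm_of_real using r by simp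
  also have "\<dots> \<le> 1 / r" using r pi4 mult_right_mono[OF pi4, of r] by (intro divide_left_mono) auto
  also have "\<dots> \<le> 1 / (norm w / 2)" using rw w0 r by (intro divide_left_mono) auto
  finally show "norm (rgreen k 0 (w - y)) \<le> 2 / norm w" unfolding z_def by simp
qed

lemma potential_radiating:
  assumes f: "f \<in> borel_measurable borel" "\<And>y. norm (f y) \<le> M" "\<And>y. R0 \<le> norm y \<Longrightarrow> f y = 0"
    and k: "k \<ge> 0"
  shows "radiating k (conv (rgreen k 0) f)"
proof -
  note fm [measurable] = f(1)
  note fi = bounded_support_integrable[OF f]
  define A where "A = (LINT y|lborel. norm (f y))"
  define C where "C = 4 * (2 * k * \<bar>R0\<bar> + 1) * A"
  let ?V = "conv (rgreen k 0) f"
  let ?E = "\<lambda>x. norm (frechet_derivative ?V (at x) (x /\<^sub>R norm x) - \<i> * of_real k * ?V x)"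
  have le: "?E x \<le> C / (norm x)\<^sup>2" if x: "norm x \<ge> 2 * \<bar>R0\<bar> + 1" for x
  proof -
    note i0 = regularized_potential(4)[OF f k] and i1 = regularized_potential(5)[OF f k]
    let ?K = "\<lambda>y. (\<Sum>j\<in>UNIV. ((x /\<^sub>R norm x) $ j) *\<^sub>R rgreen1 k 0 j (x - y)) - \<i> * of_real k * rgreen k 0 (x - y)"
    have Kf: "(\<lambda>y. ?K y * f y) = (\<lambda>y. (\<Sum>j\<in>UNIV. ((x /\<^sub>R norm x) $ j) *\<^sub>R (rgreen1 k 0 j (x - y) * f y))
         - \<i> * of_real k * (rgreen k 0 (x - y) * f y))"
      by (auto simp: algebra_simps sum_distrib_left)
    have iK: "integrable lborel (\<lambda>y. ?K y * f y)"
      unfolding Kf by (intro Bochner_Integration.integrable_diff Bochner_Integration.integrable_sum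
          integrable_scaleR_right integrable_mult_right i0 i1)
    have "frechet_derivative ?V (at x) (x /\<^sub>R norm x) - \<i> * of_real k * ?V x = (LINT y|lborel. ?K y * f y)"
    proof -
      have fr: "frechet_derivative ?V (at x) (x /\<^sub>R norm x) =
          (\<Sum>j\<in>UNIV. ((x /\<^sub>R norm x) $ j) *\<^sub>R conv (rgreen1 k 0 j) f x)"
        by (rule has_grad_frechet[OF potential_C1(1)[OF f k]])
      show ?thesis unfolding Kf fr
        unfolding conv_def using i0 i1 by (simp add: Bochner_Integration.integral_diff)
    qed
    then have "?E x \<le> (LINT y|lborel. 4 * (2 * k * \<bar>R0\<bar> + 1) / (norm x)\<^sup>2 * norm (f y))"
    proof (simp only:, intro Bochner_Integration.integral_norm_bound_integral iK)
      show "integrable lborel (\<lambda>y. 4 * (2 * k * \<bar>R0\<bar> + 1) / (norm x)\<^sup>2 * norm (f y))"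
        using fi by (intro integrable_mult_right integrable_norm)
      fix y
      show "norm (?K y * f y) \<le> 4 * (2 * k * \<bar>R0\<bar> + 1) / (norm x)\<^sup>2 * norm (f y)"
      proof (cases "R0 \<le> norm y")
        case False
        then have "norm (?K y) \<le> 4 * (2 * k * \<bar>R0\<bar> + 1) / (norm x)\<^sup>2"
          by (intro far_field_kernel(1)[OF k _ x]) auto
        then show ?thesis unfolding norm_mult by (rule mult_right_mono) simp
      qed (use f(3) in auto)
    qed
    also have "\<dots> = C / (norm x)\<^sup>2" unfolding C_def A_def by simp
    finally show ?thesis .
  qed
  show ?thesis unfolding radiating_def
  proof (rule smalloI_tendsto)
    show "\<forall>\<^sub>F x in at_infinity. 1 / norm (x::real^3) \<noteq> 0"
      unfolding eventually_at_infinity by (rule exI[of _ 1]) auto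
    have inv: "((\<lambda>x::real^3. C * inverse (norm x)) \<longlongrightarrow> C * 0) at_infinity"
      by (intro tendsto_mult_left tendsto_inverse_0_at_top filterlim_norm_at_top)
    show "((\<lambda>x. ?E x / (1 / norm x)) \<longlongrightarrow> 0) at_infinity"
    proof (rule Lim_null_comparison[OF _ inv[simplified]])
      show "\<forall>\<^sub>F x in at_infinity. norm (?E x / (1 / norm x)) \<le> C * inverse (norm x)"
        unfolding eventually_at_infinity
      proof (intro exI allI impI)
        fix x :: "real^3" assume x: "2 * \<bar>R0\<bar> + 1 \<le> norm x"
        then have "norm x > 0" by linarith
        then show "norm (?E x / (1 / norm x)) \<le> C * inverse (norm x)"
          using mult_right_mono[OF le[OF x], of "norm x"] by (simp add: field_simps power2_eq_square)
      qed
    qed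
  qed
qed

section \<open>Weak derivatives\<close>

text \<open>The classical derivatives are the weak ones: the product with a test
  function, extended by zero, is \<open>C\<^sup>1\<close> on the whole space, so
  \<open>integral_pd_eq_0\<close> applies to it.\<close>

lemma H1_loc_of_C1:
  assumes S: "open S" and u: "C1_on S u"
  shows "H1_loc_on S u"
  unfolding H1_loc_on_def
proof (intro exI[of _ "\<lambda>j. pd j u"] conjI allI impI)
  fix j
  show "weak_pd_on S j u (pd j u)"
    unfolding weak_pd_on_def
  proof (intro allI impI)
    fix \<phi> assume \<phi>: "test_function S \<phi>"
    define Z where "Z = closure {x. \<phi> x \<noteq> 0}"
    have d: "foldr pd js \<phi> differentiable (at x)" for js x using \<phi> unfolding test_function_def by blast
    have cpt: "compact Z" and sub: "Z \<subseteq> S" using \<phi> unfolding test_function_def Z_def by auto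
    have C\<phi>: "C1_on UNIV \<phi>"
    proof (rule C1_onI)
      show "has_grad \<phi> (\<lambda>j. pd j \<phi> x) x" for x using differentiable_has_grad d[of "[]"] by simp
      show "continuous_on UNIV (\<lambda>x. pd j \<phi> x)" for j
        using d[of "[j]"] differentiable_imp_continuous_within
        by (auto intro!: continuous_at_imp_continuous_on)
    qed
    have oZ: "open (- Z)" unfolding Z_def by auto
    have \<phi>0: "\<phi> x = 0" if "x \<in> - Z" for x using that closure_subset[of "{x. \<phi> x \<noteq> 0}"] unfolding Z_def by auto
    have pd0: "pd i \<phi> x = 0" if "x \<in> - Z" for x i
    proof -
      have "pd i \<phi> x = pd i (\<lambda>_. 0) x" by (rule pd_cong_open[OF oZ that \<phi>0])
      then show ?thesis by (simp add: has_grad_pd[OF has_grad_const])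
    qed
    obtain R where R: "\<And>x. x \<in> Z \<Longrightarrow> norm x \<le> R"
      using compact_imp_bounded[OF cpt] unfolding bounded_iff by blast
    have far: "x \<in> - Z" if "R < norm x" for x using R[of x] that by auto
    have cover: "x \<in> S \<or> x \<in> - Z" for x using sub by blast
    have ext: "continuous_on UNIV (\<lambda>x. indicator S x *\<^sub>R (v x * \<psi> x))"
      if v: "continuous_on S v" and \<psi>: "continuous_on UNIV \<psi>" "\<And>x. x \<in> - Z \<Longrightarrow> \<psi> x = 0" for v \<psi> :: "real^3 \<Rightarrow> complex"
    proof (rule continuous_at_imp_continuous_on, rule ballI)
      fix x
      have "continuous_on S (\<lambda>x. v x * \<psi> x)"
        by (intro continuous_on_mult v continuous_on_subset[OF \<psi>(1) subset_UNIV])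
      then have 1: "continuous_on S (\<lambda>x. indicator S x *\<^sub>R (v x * \<psi> x))"
        by (rule continuous_on_eq) simp
      have 2: "continuous_on (- Z) (\<lambda>x. indicator S x *\<^sub>R (v x * \<psi> x))"
        by (rule continuous_on_eq[of _ "\<lambda>x. 0"]) (use \<psi>(2) in fastforce)+
      show "isCont (\<lambda>x. indicator S x *\<^sub>R (v x * \<psi> x)) x"
        using cover[of x] bspec[OF iffD1[OF continuous_on_eq_continuous_at[OF S] 1], of x]
          bspec[OF iffD1[OF continuous_on_eq_continuous_at[OF oZ] 2], of x] by linarith
    qed
    have int: "integrable lborel (\<lambda>x. indicator S x *\<^sub>R (v x * \<psi> x))"
      if "continuous_on S v" "continuous_on UNIV \<psi>" "\<And>x. x \<in> - Z \<Longrightarrow> \<psi> x = 0" for v \<psi> :: "real^3 \<Rightarrow> complex"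
    proof (rule integrable_continuous_support[OF ext[OF that], of R])
      fix x :: "real^3" assume "R < norm x"
      then have "\<psi> x = 0" by (intro that(3) far)
      then show "indicator S x *\<^sub>R (v x * \<psi> x) = 0" by simp
    qed
    let ?F = "\<lambda>x. indicator S x *\<^sub>R (u x * \<phi> x)"
    let ?a = "\<lambda>x. indicator S x *\<^sub>R (u x * pd j \<phi> x)" and ?b = "\<lambda>x. indicator S x *\<^sub>R (pd j u x * \<phi> x)"
    have CF: "C1_on UNIV ?F"
    proof (rule C1_on_local)
      fix x
      have 1: "C1_on S ?F"
        by (rule C1_on_cong[OF S _ C1_on_mult[OF u C1_on_subset[OF C\<phi> subset_UNIV]]]) simp
      have 2: "C1_on (- Z) ?F"
        by (rule C1_on_cong[OF oZ _ C1_on_const[of _ 0]]) (use \<phi>0 in fastforce)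
      show "\<exists>T. open T \<and> x \<in> T \<and> C1_on T ?F"
        using cover[of x]
      proof
        assume "x \<in> S" with 1 S show ?thesis by blast
      next
        assume "x \<in> - Z" with 2 oZ show ?thesis by blast
      qed
    qed
    have pdF: "pd j ?F x = ?a x + ?b x" for x
    proof (cases "x \<in> S")
      case True
      have "pd j ?F x = pd j (\<lambda>x. u x * \<phi> x) x" by (rule pd_cong_open[OF S True]) simp
      also have "\<dots> = u x * pd j \<phi> x + pd j u x * \<phi> x"
        by (rule has_grad_pd[OF has_grad_mult]) (use C1_on_has_grad u C\<phi> True in auto)
      finally show ?thesis using True by simp
    next
      case False
      then have x: "x \<in> - Z" using cover by blast
      have "pd j ?F x = pd j (\<lambda>x. 0) x" by (rule pd_cong_open[OF oZ x]) (use \<phi>0 in fastforce)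
      then show ?thesis using False has_grad_pd[OF has_grad_const] by simp
    qed
    have ia: "integrable lborel ?a"
      by (rule int) (use C1_on_continuous[OF u] C1_on_pd_continuous[OF C\<phi>] pd0 in auto)
    have ib: "integrable lborel ?b"
      by (rule int) (use C1_on_pd_continuous[OF u] C1_on_continuous[OF C\<phi>] \<phi>0 in auto)
    have "integral\<^sup>L lborel (pd j ?F) = 0"
    proof (rule integral_pd_eq_0[OF CF, of R])
      fix x :: "real^3" assume "R < norm x"
      then have "\<phi> x = 0" by (intro \<phi>0 far)
      then show "?F x = 0" by simp
    qed
    then have "integral\<^sup>L lborel ?a + integral\<^sup>L lborel ?b = 0"
      unfolding pdF using ia ib by simp
    moreover have "(LINT x:S|lebesgue. u x * pd j \<phi> x) = integral\<^sup>L lborel ?a"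
      unfolding set_lebesgue_integral_def by (rule integral_completion) (use ia in auto)
    moreover have "(LINT x:S|lebesgue. pd j u x * \<phi> x) = integral\<^sup>L lborel ?b"
      unfolding set_lebesgue_integral_def by (rule integral_completion) (use ib in auto)
    ultimately show "(LINT x:S|lebesgue. u x * pd j \<phi> x) = - (LINT x:S|lebesgue. pd j u x * \<phi> x)"
      by (simp add: add_eq_0_iff)
  qed
next
  fix K :: "(real^3) set" assume K: "compact K \<and> K \<subseteq> S"
  have L2: "L2_on K v" if v: "continuous_on S v" for v
  proof -
    have vK: "continuous_on K v" using v K continuous_on_subset by blast
    have Km: "K \<in> sets lebesgue" using K by (simp add: compact_imp_closed)
    have "integrable lborel (\<lambda>x. indicator K x *\<^sub>R (norm (v x))\<^sup>2)"
      using K vK by (intro borel_integrable_compact continuous_intros) auto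
    then have "integrable lebesgue (\<lambda>x. indicator K x *\<^sub>R (norm (v x))\<^sup>2)"
      by (subst integrable_completion) auto
    then have "integrable (lebesgue_on K) (\<lambda>x. (norm (v x))\<^sup>2)"
      using Km by (subst integrable_restrict_space) auto
    moreover have "v \<in> borel_measurable (lebesgue_on K)"
      by (rule continuous_imp_measurable_on_sets_lebesgue[OF vK Km])
    ultimately show ?thesis unfolding L2_on_def by blast
  qed
  show "L2_on K u" by (rule L2[OF C1_on_continuous[OF u]])
  show "L2_on K (pd j u)" for j by (rule L2[OF C1_on_pd_continuous[OF u]])
qed

section \<open>Potentials of square integrable densities\<close>

lemma mult_le_weighted_squares:
  fixes a b \<eta> :: real
  assumes "\<eta> > 0" shows "a * b \<le> a\<^sup>2 / (2 * \<eta>) + \<eta> / 2 * b\<^sup>2"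
proof -
  have "0 \<le> (a - \<eta> * b)\<^sup>2" by simp
  then have "2 * \<eta> * (a * b) \<le> a\<^sup>2 + \<eta>\<^sup>2 * b\<^sup>2" by (simp add: power2_eq_square algebra_simps)
  then have "2 * \<eta> * (a * b) / (2 * \<eta>) \<le> (a\<^sup>2 + \<eta>\<^sup>2 * b\<^sup>2) / (2 * \<eta>)"
    using assms by (intro divide_right_mono) auto
  then show ?thesis using assms by (simp add: add_divide_distrib power2_eq_square)
qed

text \<open>The Green function is locally square integrable. Splitting the product of
  the kernel error and the density by \<open>mult_le_weighted_squares\<close> makes the
  term with the density small by the choice of the weight and then the term with the
  kernel error small by the regularisation, both uniformly in \<open>x\<close>.\<close>

lemma L2_potential_continuous:
  assumes fm [measurable]: "f \<in> borel_measurable borel"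
    and f2: "integrable lborel (\<lambda>y. (norm (f y))\<^sup>2)" and f0: "\<And>y. R0 \<le> norm y \<Longrightarrow> f y = 0"
    and k: "k \<ge> 0"
  shows "continuous_on UNIV (conv (rgreen k 0) f)"
proof -
  have fi: "integrable lborel f"
  proof (rule Bochner_Integration.integrable_bound)
    show "integrable lborel (\<lambda>y. indicator (cball 0 R0) y *\<^sub>R (1::real) + (norm (f y))\<^sup>2)"
      by (intro Bochner_Integration.integrable_add f2 borel_integrable_compact) auto
    show "AE y in lborel. norm (f y) \<le> norm (indicator (cball 0 R0) y *\<^sub>R (1::real) + (norm (f y))\<^sup>2)"
    proof (rule AE_I2)
      fix y
      have "norm (f y) \<le> 1 + (norm (f y))\<^sup>2"
      proof -
        have "norm (f y) \<le> 1 / 2 + (norm (f y))\<^sup>2 / 2"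
          using mult_le_weighted_squares[of 1 1 "norm (f y)"] by simp
        then show ?thesis using zero_le_power2[of "norm (f y)"] by linarith
      qed
      then show "norm (f y) \<le> norm (indicator (cball 0 R0) y *\<^sub>R (1::real) + (norm (f y))\<^sup>2)"
        using f0[of y] by (cases "R0 \<le> norm y") auto
    qed
  qed measurable
  define F where "F = (LINT y|lborel. (norm (f y))\<^sup>2)"
  have F: "F \<ge> 0" unfolding F_def by simp
  have cont: "continuous_on (ball 0 r) (conv (rgreen k 0) f)" for r
  proof -
    define R where "R = r + R0"
    define D where "D n z = (rgreen k (eps n) z - rgreen k 0 z)\<^sup>2" for n z
    have Dm: "D n \<in> borel_measurable borel" for n unfolding D_def by measurable
    have b1: "norm (rgreen k (eps n) z) \<le> norm z powr (- 1)" "norm (rgreen k 0 z) \<le> norm z powr (- 1)"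
      if "z \<noteq> 0" "norm z < R" for n z
      using rgreen_powr_bounds(1)[OF k eps_props(2,3) that] rgreen_powr_bounds(1)[OF k _ _ that, of 0] by auto
    have sq: "(norm z powr (- 1))\<^sup>2 = norm z powr (- 2)" for z :: "real^3"
      by (cases "z = 0") (auto simp: powr_minus_divide powr_numeral power_divide)
    have Db: "norm (D n z) \<le> 4 * norm z powr (- 2)" if "z \<noteq> 0" "norm z < R" for n z
    proof -
      have "norm (rgreen k (eps n) z - rgreen k 0 z) \<le> 2 * norm z powr (- 1)"
        using norm_triangle_ineq4[of "rgreen k (eps n) z" "rgreen k 0 z"] b1(1)[OF that, of n] b1(2)[OF that] by linarith
      then have "(norm (rgreen k (eps n) z - rgreen k 0 z))\<^sup>2 \<le> (2 * norm z powr (- 1))\<^sup>2"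
        by (rule power_mono) simp
      then have "(norm (rgreen k (eps n) z - rgreen k 0 z))\<^sup>2 \<le> 2\<^sup>2 * norm z powr (- 2)"
        by (simp only: power_mult_distrib sq)
      then show ?thesis unfolding D_def norm_power by simp
    qed
    have Dl: "(\<lambda>n. D n z) \<longlonglongrightarrow> 0" if "z \<noteq> 0" for z
    proof -
      have "(\<lambda>n. D n z) \<longlonglongrightarrow> (rgreen k 0 z - rgreen k 0 z)\<^sup>2"
        unfolding D_def by (intro tendsto_intros rgreen_limits that eps_props)
      then show ?thesis by simp
    qed
    have kD: "integrable lborel (\<lambda>z. indicator (ball 0 R) z * norm (D n z))"
      "(\<lambda>n. LINT z|lborel. indicator (ball 0 R) z * norm (D n z)) \<longlonglongrightarrow> 0" for n
      using kernel_L1_limit(2,4)[where p=2 and R=R and K=D and K'="\<lambda>_. 0" and C=4, OF _ Dm _ Db Dl] by auto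
    have k0: "integrable lborel (\<lambda>z. indicator (ball 0 R) z * norm ((rgreen k 0 z)\<^sup>2))"
    proof (rule kernel_L1_limit(1)[where p=2 and K="\<lambda>_ z. (rgreen k 0 z)\<^sup>2" and C=1])
      fix z :: "real^3" assume "z \<noteq> 0" "norm z < R"
      from power_mono[OF b1(2)[OF this], of 2] show "norm ((rgreen k 0 z)\<^sup>2) \<le> 1 * norm z powr (- 2)"
        unfolding norm_power sq by simp
    qed auto
    have i0: "integrable lborel (\<lambda>y. rgreen k 0 (x - y) * f y)" if x: "x \<in> ball 0 r" for x
    proof (rule Bochner_Integration.integrable_bound)
      show "integrable lborel (\<lambda>y. 1 / 2 * (indicator (ball 0 R) (x - y) * norm ((rgreen k 0 (x - y))\<^sup>2)) + 1 / 2 * (norm (f y))\<^sup>2)"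
        by (intro Bochner_Integration.integrable_add integrable_mult_right integrable_reflect[OF k0] f2)
      show "AE y in lborel. norm (rgreen k 0 (x - y) * f y) \<le>
          norm (1 / 2 * (indicator (ball 0 R) (x - y) * norm ((rgreen k 0 (x - y))\<^sup>2)) + 1 / 2 * (norm (f y))\<^sup>2)"
      proof (rule AE_I2)
        fix y
        show "norm (rgreen k 0 (x - y) * f y) \<le>
          norm (1 / 2 * (indicator (ball 0 R) (x - y) * norm ((rgreen k 0 (x - y))\<^sup>2)) + 1 / 2 * (norm (f y))\<^sup>2)"
        proof (cases "R0 \<le> norm y")
          case False
          then have "norm (x - y) < R" using x norm_triangle_ineq4[of x y] unfolding R_def by simp
          then show ?thesis
            using mult_le_weighted_squares[of 1 "norm (rgreen k 0 (x - y))" "norm (f y)"]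
            by (simp add: norm_mult norm_power)
        qed (simp add: f0)
      qed
    qed measurable
    have "uniform_limit (ball 0 r) (\<lambda>n. conv (rgreen k (eps n)) f) (conv (rgreen k 0) f) sequentially"
      unfolding uniform_limit_iff
    proof (intro allI impI)
      fix e :: real assume e: "e > 0"
      (* The summand 1 avoids a division by zero when f vanishes. *)
      define \<eta> where "\<eta> = e / (F + 1)"
      have \<eta>: "\<eta> > 0" "\<eta> / 2 * F < e / 2" using e F unfolding \<eta>_def by (auto simp: field_simps)
      have "\<forall>\<^sub>F n in sequentially. (LINT z|lborel. indicator (ball 0 R) z * norm (D n z)) < \<eta> * e"
        using order_tendstoD(2)[OF kD(2)] \<eta> e by simp
      then show "\<forall>\<^sub>F n in sequentially. \<forall>x\<in>ball 0 r. dist (conv (rgreen k (eps n)) f x) (conv (rgreen k 0) f x) < e"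
      proof eventually_elim
        case (elim n)
        show ?case
        proof
          fix x :: "real^3" assume x: "x \<in> ball 0 r"
          have i1: "integrable lborel (\<lambda>y. rgreen k (eps n) (x - y) * f y)"
            by (rule conv_integrable_continuous[OF rgreen_continuous(1) fi f0]) (auto simp: eps_props)
          have "norm (conv (rgreen k (eps n)) f x - conv (rgreen k 0) f x)
            = norm (LINT y|lborel. rgreen k (eps n) (x - y) * f y - rgreen k 0 (x - y) * f y)"
            unfolding conv_def using i1 i0[OF x] by simp
          also have "\<dots> \<le> (LINT y|lborel. 1 / (2 * \<eta>) * (indicator (ball 0 R) (x - y) * norm (D n (x - y))) + \<eta> / 2 * (norm (f y))\<^sup>2)"
          proof (rule Bochner_Integration.integral_norm_bound_integral)
            show "integrable lborel (\<lambda>y. rgreen k (eps n) (x - y) * f y - rgreen k 0 (x - y) * f y)"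
              using i1 i0[OF x] by simp
            show "integrable lborel (\<lambda>y. 1 / (2 * \<eta>) * (indicator (ball 0 R) (x - y) * norm (D n (x - y))) + \<eta> / 2 * (norm (f y))\<^sup>2)"
              by (intro Bochner_Integration.integrable_add integrable_mult_right integrable_reflect[OF kD(1)] f2)
            fix y
            show "norm (rgreen k (eps n) (x - y) * f y - rgreen k 0 (x - y) * f y) \<le>
               1 / (2 * \<eta>) * (indicator (ball 0 R) (x - y) * norm (D n (x - y))) + \<eta> / 2 * (norm (f y))\<^sup>2"
            proof (cases "R0 \<le> norm y")
              case False
              then have "norm (x - y) < R" using x norm_triangle_ineq4[of x y] unfolding R_def by simp
              then show ?thesis
                using mult_le_weighted_squares[OF \<eta>(1), of "norm (rgreen k (eps n) (x - y) - rgreen k 0 (x - y))" "norm (f y)"]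
                unfolding left_diff_distrib[symmetric] norm_mult D_def norm_power by simp
            qed (use \<eta> in \<open>simp add: f0\<close>)
          qed
          also have "\<dots> = 1 / (2 * \<eta>) * (LINT z|lborel. indicator (ball 0 R) z * norm (D n z)) + \<eta> / 2 * F"
          proof -
            have "(LINT y|lborel. indicator (ball 0 R) (x - y) * norm (D n (x - y))) = (LINT z|lborel. indicator (ball 0 R) z * norm (D n z))"
              using integral_reflect[of "\<lambda>z. indicator (ball 0 R) z * norm (D n z)" x] Dm[of n] by simp
            then show ?thesis
              unfolding F_def using integrable_reflect[OF kD(1), of x n] f2
              by (subst Bochner_Integration.integral_add) auto
          qed
          also have "\<dots> < 1 / (2 * \<eta>) * (\<eta> * e) + e / 2"
            using elim \<eta> by (intro add_strict_mono mult_strict_left_mono) auto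
          also have "\<dots> = e" using \<eta> by simp
          finally show "dist (conv (rgreen k (eps n)) f x) (conv (rgreen k 0) f x) < e" by (simp add: dist_norm)
        qed
      qed
    qed
    then show ?thesis
    proof (rule uniform_limit_theorem[rotated])
      show "\<forall>\<^sub>F n in sequentially. continuous_on (ball 0 r) (conv (rgreen k (eps n)) f)"
      proof (rule always_eventually, rule allI)
        fix n
        have "continuous_on UNIV (rgreen k (eps n))" by (rule rgreen_continuous(1)) (simp add: eps_props)
        from conv_continuous[OF this fi f0] show "continuous_on (ball 0 r) (conv (rgreen k (eps n)) f)"
          by (rule continuous_on_subset) auto
      qed
    qed simp
  qed
  have "isCont (conv (rgreen k 0) f) x" for x
    by (rule continuous_on_interior[OF cont[of "norm x + 1"]]) simp
  then show ?thesis by (simp add: continuous_at_imp_continuous_on)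
qed

section \<open>The weak equation across planes\<close>

lemma pd_zero_outside:
  assumes "\<And>x. R < norm x \<Longrightarrow> \<psi> x = 0" "R < norm x"
  shows "pd j \<psi> x = 0"
proof -
  have "open {x :: real^3. R < norm x}" by (intro open_Collect_less continuous_intros)
  then have "pd j \<psi> x = pd j (\<lambda>_. 0) x"
    by (rule pd_cong_open) (use assms in auto)
  then show ?thesis by (simp add: has_grad_pd[OF has_grad_const])
qed

text \<open>A pair \<open>(j, c)\<close> stands for the coordinate plane \<open>x $ j =
  c\<close>.\<close>

definition vanishes_near :: "(3 \<times> real) set \<Rightarrow> (real^3 \<Rightarrow> complex) \<Rightarrow> bool" where
  "vanishes_near B \<psi> \<longleftrightarrow> (\<exists>d>0. \<forall>x j c. (j, c) \<in> B \<longrightarrow> \<bar>x $ j - c\<bar> < d \<longrightarrow> \<psi> x = 0)"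

text \<open>The equation \<open>laplacian v = - w\<close>, tested with
  \<open>\<psi>\<close> and integrated by parts once.\<close>

definition weak_identity :: "(real^3 \<Rightarrow> complex) \<Rightarrow> (real^3 \<Rightarrow> complex) \<Rightarrow> (real^3 \<Rightarrow> complex) \<Rightarrow> bool" where
  "weak_identity v w \<psi> \<longleftrightarrow>
     (\<Sum>j\<in>UNIV. LINT x|lborel. pd j v x * pd j \<psi> x) = (LINT x|lborel. w x * \<psi> x)"

text \<open>Although \<open>v\<close> is only \<open>C\<^sup>1\<close> across the
  planes, the products of \<open>\<psi>\<close> and the partial derivatives of
  \<open>v\<close> are \<open>C\<^sup>1\<close> everywhere, because
  \<open>\<psi>\<close> vanishes near the planes.\<close>

lemma weak_identity_off_planes:
  assumes v: "C1_on UNIV v"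
    and off: "\<And>x. (\<And>j c. (j, c) \<in> B \<Longrightarrow> x $ j \<noteq> c) \<Longrightarrow>
       \<exists>T. open T \<and> x \<in> T \<and> C2_on T v \<and> laplacian v x = - w x"
    and \<psi>: "C1_on UNIV \<psi>" "\<And>x. R < norm x \<Longrightarrow> \<psi> x = 0" "vanishes_near B \<psi>"
  shows "weak_identity v w \<psi>"
proof -
  obtain d where d: "d > 0" "\<And>x j c. (j, c) \<in> B \<Longrightarrow> \<bar>x $ j - c\<bar> < d \<Longrightarrow> \<psi> x = 0"
    using \<psi>(3) unfolding vanishes_near_def by blast
  define F where "F j x = \<psi> x * pd j v x" for j x
  have slab: "\<exists>T. open T \<and> x \<in> T \<and> (\<forall>y\<in>T. \<psi> y = 0)" if p: "(j, c) \<in> B" "x $ j = c" for x j c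
  proof (intro exI conjI ballI)
    show "open {y :: real^3. \<bar>y $ j - c\<bar> < d}" by (intro open_Collect_less continuous_intros)
  qed (use d p in auto)
  have FC1: "C1_on UNIV (F j)" for j
  proof (rule C1_on_local)
    fix x
    show "\<exists>T. open T \<and> x \<in> T \<and> C1_on T (F j)"
    proof (cases "\<exists>j c. (j, c) \<in> B \<and> x $ j = c")
      case True
      then obtain j' c where p: "(j', c) \<in> B" "x $ j' = c" by blast
      obtain T where T: "open T" "x \<in> T" "\<And>y. y \<in> T \<Longrightarrow> \<psi> y = 0" using slab[OF p] by blast
      have "C1_on T (F j)"
        by (rule C1_on_cong[OF T(1) _ C1_on_const[of T 0]]) (simp add: F_def T(3))
      with T show ?thesis by blast
    next
      case False
      then obtain T where T: "open T" "x \<in> T" "C2_on T v" using off[of x] by blast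
      have "C1_on T (\<lambda>x. \<psi> x * pd j v x)"
        using T(3) by (intro C1_on_mult C1_on_subset[OF \<psi>(1)]) (auto simp: C2_on_def)
      then have "C1_on T (F j)" unfolding F_def .
      with T show ?thesis by blast
    qed
  qed
  have sum_pd: "(\<Sum>j\<in>UNIV. pd j (F j) x) = (\<Sum>j\<in>UNIV. pd j v x * pd j \<psi> x) - w x * \<psi> x" for x
  proof (cases "\<exists>j c. (j, c) \<in> B \<and> x $ j = c")
    case True
    then obtain j' c where p: "(j', c) \<in> B" "x $ j' = c" by blast
    obtain T where T: "open T" "x \<in> T" "\<And>y. y \<in> T \<Longrightarrow> \<psi> y = 0" using slab[OF p] by blast
    have "pd j (F j) x = pd j (\<lambda>_. 0) x" for j
      by (rule pd_cong_open[OF T(1,2)]) (simp add: F_def T(3))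
    moreover have "pd j \<psi> x = pd j (\<lambda>_. 0) x" for j
      by (rule pd_cong_open[OF T(1,2)]) (simp add: T(3))
    ultimately show ?thesis using T by (simp add: has_grad_pd[OF has_grad_const])
  next
    case False
    then obtain T where T: "open T" "x \<in> T" "C2_on T v" "laplacian v x = - w x" using off[of x] by blast
    have "pd j (F j) x = \<psi> x * pd j (pd j v) x + pd j \<psi> x * pd j v x" for j
    proof -
      have "has_grad (pd j v) (\<lambda>i. pd i (pd j v) x) x"
        using T(2,3) C1_on_has_grad unfolding C2_on_def by blast
      then show ?thesis
        using has_grad_pd[OF has_grad_mult[OF C1_on_has_grad[OF \<psi>(1) UNIV_I]]] unfolding F_def by blast
    qed
    then have "(\<Sum>j\<in>UNIV. pd j (F j) x) = \<psi> x * laplacian v x + (\<Sum>j\<in>UNIV. pd j \<psi> x * pd j v x)"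
      unfolding laplacian_def by (simp add: sum.distrib sum_distrib_left)
    then show ?thesis unfolding T(4) by (simp add: mult.commute)
  qed
  have F0: "F j x = 0" if "R < norm x" for j x unfolding F_def using \<psi>(2)[OF that] by simp
  have iF: "integrable lborel (pd j (F j))" for j
    by (rule integrable_continuous_support[OF C1_on_pd_continuous[OF FC1]]) (rule pd_zero_outside[OF F0])
  have i1: "integrable lborel (\<lambda>x. pd j v x * pd j \<psi> x)" for j
    by (rule integrable_continuous_support[of _ R])
       (auto intro!: continuous_intros C1_on_pd_continuous v \<psi>(1) simp: pd_zero_outside[OF \<psi>(2)])
  have iw: "integrable lborel (\<lambda>x. w x * \<psi> x)"
  proof -
    have "integrable lborel (\<lambda>x. (\<Sum>j\<in>UNIV. pd j v x * pd j \<psi> x) - (\<Sum>j\<in>UNIV. pd j (F j) x))"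
      by (intro Bochner_Integration.integrable_diff Bochner_Integration.integrable_sum i1 iF)
    then show ?thesis unfolding sum_pd by simp
  qed
  have "(\<Sum>j\<in>UNIV. LINT x|lborel. pd j v x * pd j \<psi> x) - (LINT x|lborel. w x * \<psi> x)
      = (LINT x|lborel. (\<Sum>j\<in>UNIV. pd j v x * pd j \<psi> x) - w x * \<psi> x)"
    using i1 iw by (subst Bochner_Integration.integral_diff) (auto simp: Bochner_Integration.integral_sum)
  also have "\<dots> = (LINT x|lborel. (\<Sum>j\<in>UNIV. pd j (F j) x))" unfolding sum_pd ..
  also have "\<dots> = (\<Sum>j\<in>UNIV. integral\<^sup>L lborel (pd j (F j)))"
    using iF by (rule Bochner_Integration.integral_sum)
  also have "\<dots> = 0" using integral_pd_eq_0[OF FC1 F0] by simp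
  finally show ?thesis unfolding weak_identity_def by simp
qed

text \<open>Vanishes at distance less than \<open>d\<close> from the plane and equals 1
  at distance at least \<open>2 * d\<close>. Both flanks come from translates of one
  transition, so the derivative of \<open>slab_cut\<close> is the difference of
  \<open>slab_slope\<close> and its translate by \<open>3 * d\<close> across the
  plane.\<close>

definition slab_cut :: "3 \<Rightarrow> real \<Rightarrow> real \<Rightarrow> real^3 \<Rightarrow> complex" where
  "slab_cut j c d x = of_real (1 - step ((x $ j - c) / d) + step ((x $ j - c) / d + 3))"

definition slab_slope :: "3 \<Rightarrow> real \<Rightarrow> real \<Rightarrow> real^3 \<Rightarrow> real" where
  "slab_slope j c d x = step_slope ((x $ j - c) / d) / d"

lemma scaled_coordinate_deriv:
  "((\<lambda>x::real^3. (x $ j - c) / d) has_derivative (\<lambda>h. \<Sum>i\<in>UNIV. (h $ i) * (if i = j then 1 / d else 0))) (at x)"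
proof -
  have "((\<lambda>x::real^3. (x $ j - c) / d) has_derivative (\<lambda>h. (h $ j - 0) / d)) (at x)"
    unfolding divide_inverse
    by (intro has_derivative_mult_left has_derivative_diff has_derivative_const
        bounded_linear.has_derivative[OF bounded_linear_vec_nth] has_derivative_ident)
  then show ?thesis by (simp add: if_distrib cong: if_cong)
qed

lemma step_coordinate_has_grad:
  "has_grad (\<lambda>x. of_real (- step ((x $ j - c) / d))) (\<lambda>i. if i = j then of_real (slab_slope j c d x) else 0) x"
proof -
  have "((\<lambda>t. complex_of_real (- step t)) has_vector_derivative of_real (step_slope t)) (at t)" for t
    using has_vector_derivative_minus[OF of_real_step_deriv[of t]] by simp
  from has_grad_compose_real[OF scaled_coordinate_deriv this]
  show ?thesis unfolding slab_slope_def
    by (simp add: has_grad_def if_distrib[of "\<lambda>t. _ *\<^sub>R t"] if_distrib[of of_real] if_distrib[of "\<lambda>t. t * _"] cong: if_cong)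
qed

lemma slab_cut_has_grad:
  assumes "d > 0"
  shows "has_grad (slab_cut j c d)
     (\<lambda>i. if i = j then of_real (slab_slope j c d x - slab_slope j c d (x + (3 * d) *\<^sub>R axis j 1)) else 0) x"
proof -
  have t3: "(x $ j - (c - 3 * d)) / d = (x $ j - c) / d + 3" for x :: "real^3"
    using assms by (simp add: field_simps)
  have eq: "slab_cut j c d = (\<lambda>x. (1 + of_real (- step ((x $ j - c) / d))) - of_real (- step ((x $ j - (c - 3 * d)) / d)))"
    unfolding slab_cut_def[abs_def] t3 by simp
  have sl: "slab_slope j (c - 3 * d) d x = slab_slope j c d (x + (3 * d) *\<^sub>R axis j 1)"
    unfolding slab_slope_def t3 using assms by (simp add: field_simps)
  have "has_grad (slab_cut j c d) (\<lambda>i. (0 + (if i = j then of_real (slab_slope j c d x) else 0)) -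
      (if i = j then of_real (slab_slope j (c - 3 * d) d x) else 0)) x"
    unfolding eq by (intro has_grad_diff has_grad_add has_grad_const step_coordinate_has_grad)
  then show ?thesis unfolding sl
    by (rule back_subst[where P="\<lambda>g. has_grad (slab_cut j c d) g x"]) auto
qed

lemma slab_slope_continuous: "continuous_on S (slab_slope j c d)"
  unfolding slab_slope_def[abs_def] divide_inverse
  by (intro continuous_intros continuous_on_compose2[OF step_continuous(2)[of UNIV]]) auto

lemma slab_cut_C1: "d > 0 \<Longrightarrow> C1_on S (slab_cut j c d)"
proof (rule C1_onI[OF slab_cut_has_grad])
  fix i assume "d > 0"
  have "continuous_on S (\<lambda>x. slab_slope j c d x - slab_slope j c d (x + (3 * d) *\<^sub>R axis j 1))"
    by (intro continuous_intros slab_slope_continuous continuous_on_compose2[OF slab_slope_continuous[of UNIV]]) auto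
  then show "continuous_on S (\<lambda>x. if i = j then complex_of_real (slab_slope j c d x - slab_slope j c d (x + (3 * d) *\<^sub>R axis j 1)) else 0)"
    by (cases "i = j") (auto intro: continuous_on_of_real simp del: of_real_diff)
qed auto

lemma slab_cut_values:
  assumes d: "d > 0"
  shows "\<bar>x $ j - c\<bar> < d \<Longrightarrow> slab_cut j c d x = 0"
    and "\<bar>x $ j - c\<bar> \<ge> 2 * d \<Longrightarrow> slab_cut j c d x = 1"
    and "norm (slab_cut j c d x) \<le> 2"
proof -
  let ?t = "(x $ j - c) / d"
  have at: "\<bar>?t\<bar> = \<bar>x $ j - c\<bar> / d" using d by simp
  show "slab_cut j c d x = 0" if "\<bar>x $ j - c\<bar> < d"
  proof -
    have "\<bar>?t\<bar> < 1" unfolding at using that d by simp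
    then have "?t \<le> 1" "?t + 3 \<ge> 2" by linarith+
    then show ?thesis unfolding slab_cut_def by (simp add: step_eq)
  qed
  show "slab_cut j c d x = 1" if "\<bar>x $ j - c\<bar> \<ge> 2 * d"
  proof -
    have "\<bar>?t\<bar> \<ge> 2" unfolding at using that d by (simp add: field_simps)
    then consider "?t \<ge> 2" | "?t \<le> -2" by linarith
    then show ?thesis
    proof cases
      case 1
      then have "step ?t = 0" "step (?t + 3) = 0" by (auto intro: step_eq)
      then show ?thesis unfolding slab_cut_def by simp
    next
      case 2
      then have "step ?t = 1" "step (?t + 3) = 1" by (auto intro: step_eq)
      then show ?thesis unfolding slab_cut_def by simp
    qed
  qed
  show "norm (slab_cut j c d x) \<le> 2"
    unfolding slab_cut_def norm_of_real using step_bounds[of ?t] step_bounds[of "?t + 3"] by linarith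
qed

text \<open>Although \<open>slab_slope\<close> has size \<open>1 / d\<close>, it is a
  partial derivative of a function with values between -1 and 0; integrating by parts
  moves the derivative to the bump and leaves a bound without \<open>d\<close>.\<close>

lemma slab_slope_mass:
  assumes d: "d > 0" and \<rho>: "\<rho> > 0"
  shows "(LINT x|lborel. slab_slope j c d x * Re (bump \<rho> x)) \<le> (LINT x|lborel. norm (pd j (bump \<rho>) x))"
proof -
  let ?Q = "\<lambda>x. complex_of_real (- step ((x $ j - c) / d))"
  let ?F = "\<lambda>x. ?Q x * bump \<rho> x"
  have bR: "bump \<rho> x = 0" if "2 * \<rho> < norm x" for x using bump_outside \<rho> that by auto
  have cs: "continuous_on UNIV (\<lambda>x. if i = j then complex_of_real (slab_slope j c d x) else 0)" for i
    by (cases "i = j") (auto intro!: continuous_intros slab_slope_continuous)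
  have QC: "C1_on UNIV ?Q" by (rule C1_onI[OF step_coordinate_has_grad cs])
  have FC: "C1_on UNIV ?F" by (intro C1_on_mult QC bump_C1)
  have p: "pd j ?F x = ?Q x * pd j (bump \<rho>) x + of_real (slab_slope j c d x) * bump \<rho> x" for x
    using has_grad_pd[OF has_grad_mult[OF step_coordinate_has_grad C1_on_has_grad[OF bump_C1[of UNIV] UNIV_I]], of j j c d \<rho> x]
    by simp
  have i1: "integrable lborel (\<lambda>x. ?Q x * pd j (bump \<rho>) x)"
    by (rule integrable_continuous_support[of _ "2 * \<rho>"])
       (auto intro!: continuous_on_mult C1_on_continuous[OF QC] C1_on_pd_continuous bump_C1 simp: pd_zero_outside[OF bR] simp del: of_real_minus)
  have i2: "integrable lborel (\<lambda>x. of_real (slab_slope j c d x) * bump \<rho> x)"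
    by (rule integrable_continuous_support[of _ "2 * \<rho>"])
       (auto intro!: continuous_intros slab_slope_continuous bump_continuous simp: bR)
  have i3: "integrable lborel (\<lambda>x. norm (pd j (bump \<rho>) x))"
    by (rule integrable_norm, rule integrable_continuous_support[of _ "2 * \<rho>"])
       (auto intro!: C1_on_pd_continuous bump_C1 simp: pd_zero_outside[OF bR])
  have "integral\<^sup>L lborel (pd j ?F) = 0"
    by (rule integral_pd_eq_0[OF FC, of "2 * \<rho>"]) (simp add: bR)
  then have "(LINT x|lborel. ?Q x * pd j (bump \<rho>) x) + (LINT x|lborel. of_real (slab_slope j c d x) * bump \<rho> x) = 0"
    unfolding p Bochner_Integration.integral_add[OF i1 i2] .
  then have e: "(LINT x|lborel. of_real (slab_slope j c d x) * bump \<rho> x) = - (LINT x|lborel. ?Q x * pd j (bump \<rho>) x)"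
    by (simp add: add_eq_0_iff add.commute)
  have "(LINT x|lborel. slab_slope j c d x * Re (bump \<rho> x)) = Re (LINT x|lborel. of_real (slab_slope j c d x) * bump \<rho> x)"
    using integral_bounded_linear[OF bounded_linear_Re i2] by simp
  also have "\<dots> \<le> norm (LINT x|lborel. of_real (slab_slope j c d x) * bump \<rho> x)" by (rule complex_Re_le_cmod)
  also have "\<dots> = norm (LINT x|lborel. ?Q x * pd j (bump \<rho>) x)" unfolding e by (rule norm_minus_cancel)
  also have "\<dots> \<le> (LINT x|lborel. norm (pd j (bump \<rho>) x))"
  proof (rule Bochner_Integration.integral_norm_bound_integral[OF i1 i3])
    fix x
    have "norm (?Q x) \<le> 1" unfolding norm_of_real using step_bounds by simp
    then show "norm (?Q x * pd j (bump \<rho>) x) \<le> norm (pd j (bump \<rho>) x)"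
      unfolding norm_mult by (rule mult_left_le_one_le[rotated 2]) auto
  qed
  finally show ?thesis .
qed

text \<open>The slopes on the two sides of the plane have opposite signs. Translating
  one flank onto the other leaves \<open>slab_slope\<close> times an increment of
  \<open>g\<close> over the distance \<open>3 * d\<close>, which is small by uniform
  continuity.\<close>

lemma slab_flux_vanishes:
  assumes g: "continuous_on UNIV g" "\<And>x. R < norm x \<Longrightarrow> g x = (0::complex)"
  shows "(\<lambda>m. LINT x|lborel. of_real (slab_slope j c (eps m) x - slab_slope j c (eps m) (x + (3 * eps m) *\<^sub>R axis j 1)) * g x) \<longlonglongrightarrow> 0"
proof (rule LIMSEQ_I)
  fix r :: real assume r: "r > 0"
  (* The translation moves points by 3 * eps m, which is at most 3, so the bump is 1
     wherever the increment of g is nonzero. *)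
  define \<rho> where "\<rho> = \<bar>R\<bar> + 3"
  have \<rho>: "\<rho> > 0" "\<rho> \<ge> R + 3" unfolding \<rho>_def by auto
  define C where "C = (LINT x|lborel. norm (pd j (bump \<rho>) x))"
  have C: "C \<ge> 0" unfolding C_def by simp
  define \<eta> where "\<eta> = r / (C + 1)"
  have \<eta>: "\<eta> > 0" "\<eta> * C < r" using r C unfolding \<eta>_def by (auto simp: field_simps)
  have "uniformly_continuous_on (cball 0 (\<rho> + 3)) g"
    by (rule compact_uniformly_continuous[OF continuous_on_subset[OF g(1)]]) auto
  then obtain \<delta> where \<delta>: "\<delta> > 0" "\<And>x y. x \<in> cball 0 (\<rho> + 3) \<Longrightarrow> y \<in> cball 0 (\<rho> + 3) \<Longrightarrow> dist y x < \<delta> \<Longrightarrow> dist (g y) (g x) < \<eta>"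
    using \<eta>(1) unfolding uniformly_continuous_on_def by metis
  have "\<forall>\<^sub>F m in sequentially. eps m < \<delta> / 3" using order_tendstoD(2)[OF eps_props(4), of "\<delta> / 3"] \<delta>(1) by simp
  then obtain N where N: "\<And>m. m \<ge> N \<Longrightarrow> eps m < \<delta> / 3" unfolding eventually_sequentially by blast
  show "\<exists>no. \<forall>m\<ge>no. norm ((LINT x|lborel. of_real (slab_slope j c (eps m) x -
      slab_slope j c (eps m) (x + (3 * eps m) *\<^sub>R axis j 1)) * g x) - 0) < r"
  proof (intro exI allI impI)
    fix m assume m: "m \<ge> N"
    define d where "d = eps m"
    have d: "d > 0" "d \<le> 1" "3 * d < \<delta>" using eps_props(1)[of m] eps_props(3)[of m] N[OF m] unfolding d_def by auto
    let ?e = "(3 * d) *\<^sub>R axis j 1 :: real^3"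
    let ?s = "slab_slope j c d"
    have ne: "norm ?e = 3 * d" using d by simp
    have s0: "?s x \<ge> 0" for x unfolding slab_slope_def using step_slope_bounds d by simp
    have cs: "continuous_on UNIV (\<lambda>x. complex_of_real (?s x))"
      by (intro continuous_intros slab_slope_continuous)
    have cs': "continuous_on UNIV (\<lambda>x. complex_of_real (?s (x + ?e)))"
      by (rule continuous_on_compose2[OF cs]) (auto intro!: continuous_intros)
    have ge0: "g (x - ?e) = 0" if "R + 3 < norm x" for x
      using that norm_triangle_ineq2[of x ?e] ne d by (intro g(2)) linarith
    have cge: "continuous_on UNIV (\<lambda>x. g (x - ?e))"
      by (intro continuous_on_compose2[OF g(1)] continuous_intros) auto
    have i1: "integrable lborel (\<lambda>x. of_real (?s x) * g x)"
      by (rule integrable_continuous_support[of _ R]) (auto intro!: continuous_on_mult cs g(1) simp: g(2))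
    have i2: "integrable lborel (\<lambda>x. of_real (?s (x + ?e)) * g x)"
      by (rule integrable_continuous_support[of _ R])
         (auto intro!: continuous_on_mult cs' g(1) simp: g(2) simp del: of_real_add)
    have i3: "integrable lborel (\<lambda>x. of_real (?s x) * g (x - ?e))"
      by (rule integrable_continuous_support[of _ "R + 3"])
         (auto intro!: continuous_on_mult cs cge simp: ge0)
    have m3: "(\<lambda>x. of_real (?s x) * g (x - ?e)) \<in> borel_measurable borel" using i3 by auto
    have "(LINT x|lborel. of_real (?s x - ?s (x + ?e)) * g x)
       = (LINT x|lborel. of_real (?s x) * g x) - (LINT x|lborel. of_real (?s (x + ?e)) * g x)"
      using i1 i2 by (simp add: left_diff_distrib)
    also have "(LINT x|lborel. of_real (?s (x + ?e)) * g x) = (LINT x|lborel. of_real (?s x) * g (x - ?e))"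
      using lborel_integral_translate[OF m3, of ?e] by simp
    also have "(LINT x|lborel. of_real (?s x) * g x) - \<dots> = (LINT x|lborel. of_real (?s x) * (g x - g (x - ?e)))"
      using i1 i3 by (simp add: right_diff_distrib)
    finally have eq: "(LINT x|lborel. of_real (?s x - ?s (x + ?e)) * g x) = (LINT x|lborel. of_real (?s x) * (g x - g (x - ?e)))" .
    have "norm (LINT x|lborel. of_real (?s x) * (g x - g (x - ?e))) \<le> (LINT x|lborel. \<eta> * (?s x * Re (bump \<rho> x)))"
    proof (rule Bochner_Integration.integral_norm_bound_integral)
      show "integrable lborel (\<lambda>x. of_real (?s x) * (g x - g (x - ?e)))"
        using i1 i3 by (simp add: right_diff_distrib)
      show "integrable lborel (\<lambda>x. \<eta> * (?s x * Re (bump \<rho> x)))"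
        by (rule integrable_continuous_support[of _ "2 * \<rho>"])
           (use bump_outside \<rho> in \<open>auto intro!: continuous_intros slab_slope_continuous bump_continuous\<close>)
      fix x
      have le: "norm (g x - g (x - ?e)) \<le> \<eta> * Re (bump \<rho> x)"
      proof (cases "norm x \<le> \<rho>")
        case True
        have "norm (x - ?e) \<le> norm x + 3 * d" "norm (?e - x) \<le> norm x + 3 * d"
          using norm_triangle_ineq4[of x ?e] norm_triangle_ineq4[of ?e x] ne by simp_all
        then have "dist (g x) (g (x - ?e)) < \<eta>"
          using True d ne by (intro \<delta>(2)) (auto simp: dist_norm)
        then show ?thesis using bump_inside[OF \<rho>(1) True] by (simp add: dist_norm)
      next
        case False
        then have "g x = 0" "g (x - ?e) = 0" using \<rho> ge0[of x] g(2)[of x] by auto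
        moreover have "Re (bump \<rho> x) \<ge> 0" unfolding bump_def using step_bounds by simp
        ultimately show ?thesis using \<eta> by simp
      qed
      show "norm (of_real (?s x) * (g x - g (x - ?e))) \<le> \<eta> * (?s x * Re (bump \<rho> x))"
        using mult_left_mono[OF le s0[of x]] s0[of x] by (simp add: norm_mult mult_ac)
    qed
    also have "\<dots> \<le> \<eta> * C"
      using mult_left_mono[OF slab_slope_mass[OF d(1) \<rho>(1), of j c], of \<eta>] \<eta> unfolding C_def by simp
    also have "\<dots> < r" by (rule \<eta>)
    finally show "norm ((LINT x|lborel. of_real (slab_slope j c (eps m) x -
      slab_slope j c (eps m) (x + (3 * eps m) *\<^sub>R axis j 1)) * g x) - 0) < r"
      unfolding d_def[symmetric] eq by simp
  qed
qed

lemma slab_cut_limit: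
  assumes h: "integrable lborel h"
  shows "(\<lambda>m. LINT x|lborel. slab_cut j c (eps m) x * h x) \<longlonglongrightarrow> integral\<^sup>L lborel h"
proof (rule integral_dominated_convergence[where w="\<lambda>x. 2 * norm (h x)"])
  have [measurable]: "h \<in> borel_measurable borel" using h by auto
  show "h \<in> borel_measurable lborel" by measurable
  show "(\<lambda>x. slab_cut j c (eps m) x * h x) \<in> borel_measurable lborel" for m
  proof -
    have [measurable]: "slab_cut j c (eps m) \<in> borel_measurable borel"
      by (rule borel_measurable_continuous_onI[OF C1_on_continuous[OF slab_cut_C1[OF eps_props(1)]]])
    show ?thesis by measurable
  qed
  show "integrable lborel (\<lambda>x. 2 * norm (h x))" using h by auto
  show "AE x in lborel. norm (slab_cut j c (eps m) x * h x) \<le> 2 * norm (h x)" for m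
    unfolding norm_mult by (intro AE_I2 mult_right_mono slab_cut_values(3) eps_props(1)) auto
  have "negligible {x :: real^3. x \<bullet> axis j 1 = c}"
    by (rule negligible_standard_hyperplane) (auto simp: Basis_vec_def)
  then have "negligible {x :: real^3. x $ j = c}" by (simp add: inner_axis)
  then have "AE x in lebesgue. x \<notin> {x :: real^3. x $ j = c}"
    unfolding negligible_iff_null_sets by (rule AE_not_in)
  then have "AE x in lborel. (x :: real^3) $ j \<noteq> c" by (simp add: AE_completion_iff)
  then show "AE x in lborel. (\<lambda>m. slab_cut j c (eps m) x * h x) \<longlonglongrightarrow> h x"
  proof eventually_elim
    case (elim x)
    have "\<forall>\<^sub>F m in sequentially. eps m < \<bar>x $ j - c\<bar> / 2"
      using order_tendstoD(2)[OF eps_props(4), of "\<bar>x $ j - c\<bar> / 2"] elim by simp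
    then have "\<forall>\<^sub>F m in sequentially. slab_cut j c (eps m) x * h x = h x"
      by eventually_elim (simp add: slab_cut_values(2)[OF eps_props(1)])
    then show ?case by (rule tendsto_eventually)
  qed
qed

text \<open>Testing with \<open>slab_cut * \<psi>\<close> produces one extra term, the
  derivative of the cutoff times \<open>\<psi> * pd j v\<close>. The latter is
  continuous across the plane since \<open>v\<close> is \<open>C\<^sup>1\<close>, and
  \<open>slab_flux_vanishes\<close> disposes of the term. This is where the continuity
  of the normal derivative is used.\<close>

lemma weak_identity_drop_plane:
  assumes v: "C1_on UNIV v" and w: "\<And>\<psi>. C1_on UNIV \<psi> \<Longrightarrow> (\<And>x. R < norm x \<Longrightarrow> \<psi> x = 0) \<Longrightarrow> integrable lborel (\<lambda>x. w x * \<psi> x)"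
    and IH: "\<And>\<psi>. C1_on UNIV \<psi> \<Longrightarrow> (\<And>x. R < norm x \<Longrightarrow> \<psi> x = 0) \<Longrightarrow> vanishes_near (insert (j, c) B) \<psi> \<Longrightarrow> weak_identity v w \<psi>"
    and \<psi>: "C1_on UNIV \<psi>" "\<And>x. R < norm x \<Longrightarrow> \<psi> x = 0" "vanishes_near B \<psi>"
  shows "weak_identity v w \<psi>"
proof -
  obtain d0 where d0: "d0 > 0" "\<And>x j c. (j, c) \<in> B \<Longrightarrow> \<bar>x $ j - c\<bar> < d0 \<Longrightarrow> \<psi> x = 0"
    using \<psi>(3) unfolding vanishes_near_def by blast
  define ch where "ch m = slab_cut j c (eps m)" for m
  define kap where "kap m x = complex_of_real (slab_slope j c (eps m) x - slab_slope j c (eps m) (x + (3 * eps m) *\<^sub>R axis j 1))" for m x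
  have chC: "C1_on UNIV (ch m)" for m unfolding ch_def by (rule slab_cut_C1[OF eps_props(1)])
  have \<psi>mC: "C1_on UNIV (\<lambda>x. ch m x * \<psi> x)" for m by (intro C1_on_mult chC \<psi>(1))
  have id: "weak_identity v w (\<lambda>x. ch m x * \<psi> x)" for m
  proof (rule IH[OF \<psi>mC])
    show "ch m x * \<psi> x = 0" if "R < norm x" for x using \<psi>(2)[OF that] by simp
    show "vanishes_near (insert (j, c) B) (\<lambda>x. ch m x * \<psi> x)"
      unfolding vanishes_near_def
    proof (intro exI[of _ "min d0 (eps m)"] conjI allI impI)
      show "min d0 (eps m) > 0" using d0 eps_props(1) by simp
      fix x j' c' assume p: "(j', c') \<in> insert (j, c) B" and x: "\<bar>x $ j' - c'\<bar> < min d0 (eps m)"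
      then consider "j' = j" "c' = c" | "(j', c') \<in> B" by blast
      then show "ch m x * \<psi> x = 0"
      proof cases
        case 1
        then have "ch m x = 0" unfolding ch_def using x by (intro slab_cut_values(1) eps_props(1)) simp
        then show ?thesis by simp
      next
        case 2
        then show ?thesis using d0(2)[of j' c' x] x by simp
      qed
    qed
  qed
  have p: "pd i (\<lambda>x. ch m x * \<psi> x) x = ch m x * pd i \<psi> x + (if i = j then kap m x else 0) * \<psi> x" for i m x
    using has_grad_pd[OF has_grad_mult[OF slab_cut_has_grad[OF eps_props(1)] C1_on_has_grad[OF \<psi>(1) UNIV_I]]]
    unfolding ch_def kap_def by simp
  define g where "g x = \<psi> x * pd j v x" for x
  have cg: "continuous_on UNIV g" unfolding g_def
    by (intro continuous_on_mult C1_on_continuous C1_on_pd_continuous v \<psi>(1))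
  have g0: "g x = 0" if "R < norm x" for x unfolding g_def using \<psi>(2)[OF that] by simp
  have ckap: "continuous_on UNIV (kap m)" for m
    unfolding kap_def[abs_def]
    by (intro continuous_intros slab_slope_continuous continuous_on_compose2[OF slab_slope_continuous[of UNIV]]) auto
  have ik: "integrable lborel (\<lambda>x. kap m x * g x)" for m
    by (rule integrable_continuous_support[of _ R]) (auto intro!: continuous_on_mult ckap cg simp: g0)
  have i1: "integrable lborel (\<lambda>x. pd i v x * pd i \<psi> x)" for i
    by (rule integrable_continuous_support[of _ R])
       (auto intro!: continuous_on_mult C1_on_pd_continuous v \<psi>(1) simp: pd_zero_outside[OF \<psi>(2)])
  have i2: "integrable lborel (\<lambda>x. ch m x * (pd i v x * pd i \<psi> x))" for i m
    by (rule integrable_continuous_support[of _ R])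
       (auto intro!: continuous_on_mult C1_on_continuous[OF chC] C1_on_pd_continuous v \<psi>(1) simp: pd_zero_outside[OF \<psi>(2)])
  have eq: "(\<Sum>i\<in>UNIV. LINT x|lborel. ch m x * (pd i v x * pd i \<psi> x)) + (LINT x|lborel. kap m x * g x)
      = (LINT x|lborel. ch m x * (w x * \<psi> x))" for m
  proof -
    have "(LINT x|lborel. pd i v x * pd i (\<lambda>x. ch m x * \<psi> x) x)
       = (LINT x|lborel. ch m x * (pd i v x * pd i \<psi> x)) + (if i = j then (LINT x|lborel. kap m x * g x) else 0)" for i
    proof (cases "i = j")
      case True
      have "(LINT x|lborel. pd i v x * pd i (\<lambda>x. ch m x * \<psi> x) x)
         = (LINT x|lborel. ch m x * (pd i v x * pd i \<psi> x) + kap m x * g x)"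
        unfolding p g_def True by (simp add: algebra_simps)
      then show ?thesis using i2[of m i] ik[of m] True by simp
    next
      case False
      then show ?thesis unfolding p by (simp add: mult_ac)
    qed
    then have "(\<Sum>i\<in>UNIV. LINT x|lborel. pd i v x * pd i (\<lambda>x. ch m x * \<psi> x) x)
       = (\<Sum>i\<in>UNIV. LINT x|lborel. ch m x * (pd i v x * pd i \<psi> x)) + (LINT x|lborel. kap m x * g x)"
      by (simp add: sum.distrib)
    moreover have "(LINT x|lborel. w x * (ch m x * \<psi> x)) = (LINT x|lborel. ch m x * (w x * \<psi> x))"
      by (simp add: mult_ac)
    ultimately show ?thesis using id[of m] unfolding weak_identity_def by simp
  qed
  have "(\<lambda>m. (\<Sum>i\<in>UNIV. LINT x|lborel. ch m x * (pd i v x * pd i \<psi> x)) + (LINT x|lborel. kap m x * g x))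
     \<longlonglongrightarrow> (\<Sum>i\<in>UNIV. LINT x|lborel. pd i v x * pd i \<psi> x) + 0"
    unfolding ch_def kap_def
    by (intro tendsto_add tendsto_sum slab_cut_limit i1 slab_flux_vanishes[OF cg g0])
  moreover have "(\<lambda>m. LINT x|lborel. ch m x * (w x * \<psi> x)) \<longlonglongrightarrow> (LINT x|lborel. w x * \<psi> x)"
    unfolding ch_def by (rule slab_cut_limit[OF w[OF \<psi>(1,2)]])
  ultimately show ?thesis
    unfolding eq weak_identity_def using LIMSEQ_unique by fastforce
qed

lemma weak_identity_across_planes:
  assumes v: "C1_on UNIV v" and B: "finite B"
    and wm: "w \<in> borel_measurable borel" and wb: "\<And>x. norm x \<le> R \<Longrightarrow> norm (w x) \<le> M"
    and off: "\<And>x. (\<And>j c. (j, c) \<in> B \<Longrightarrow> x $ j \<noteq> c) \<Longrightarrow>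
       \<exists>T. open T \<and> x \<in> T \<and> C2_on T v \<and> laplacian v x = - w x"
    and \<psi>: "C1_on UNIV \<psi>" "\<And>x. R < norm x \<Longrightarrow> \<psi> x = 0"
  shows "weak_identity v w \<psi>"
proof -
  have wi: "integrable lborel (\<lambda>x. w x * \<phi> x)" if \<phi>: "C1_on UNIV \<phi>" "\<And>x. R < norm x \<Longrightarrow> \<phi> x = 0" for \<phi>
  proof (rule Bochner_Integration.integrable_bound)
    have c: "continuous_on UNIV \<phi>" by (rule C1_on_continuous[OF \<phi>(1)])
    have [measurable]: "\<phi> \<in> borel_measurable borel" by (rule borel_measurable_continuous_onI[OF c])
    note wm [measurable]
    show "integrable lborel (\<lambda>x. M * norm (\<phi> x))"
      using integrable_continuous_support[OF c \<phi>(2)] by auto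
    show "(\<lambda>x. w x * \<phi> x) \<in> borel_measurable lborel" by measurable
    have "norm (w x * \<phi> x) \<le> norm (M * norm (\<phi> x))" for x
    proof (cases "R < norm x")
      case False
      then have "norm (w x) \<le> \<bar>M\<bar>" using wb[of x] by simp
      then show ?thesis by (simp add: norm_mult abs_mult mult_right_mono)
    qed (simp add: \<phi>(2))
    then show "AE x in lborel. norm (w x * \<phi> x) \<le> norm (M * norm (\<phi> x))" by simp
  qed
  define P where "P A \<longleftrightarrow> (\<forall>\<psi>. C1_on UNIV \<psi> \<longrightarrow> (\<forall>x. R < norm x \<longrightarrow> \<psi> x = 0) \<longrightarrow> vanishes_near A \<psi> \<longrightarrow> weak_identity v w \<psi>)" for A
  have PB: "P B" unfolding P_def using weak_identity_off_planes[OF v off] by blast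
  have step: "P A" if "P (insert p A)" for p A
  proof (cases p)
    case (Pair j c)
    show ?thesis unfolding P_def
    proof (intro allI impI)
      fix \<psi> assume h: "C1_on UNIV \<psi>" "\<forall>x. R < norm x \<longrightarrow> \<psi> x = 0" "vanishes_near A \<psi>"
      show "weak_identity v w \<psi>"
      proof (rule weak_identity_drop_plane[OF v wi _ h(1) _ h(3)])
        show "weak_identity v w \<phi>" if "C1_on UNIV \<phi>" "\<And>x. R < norm x \<Longrightarrow> \<phi> x = 0" "vanishes_near (insert (j, c) A) \<phi>" for \<phi>
          using \<open>P (insert p A)\<close> that unfolding P_def Pair by blast
      qed (use h(2) in auto)
    qed
  qed
  have "P A \<Longrightarrow> P {}" if "finite A" for A
    using that by (induction A rule: finite_induct) (auto dest: step)
  from this[OF B PB] have "P {}" .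
  moreover have "vanishes_near {} \<psi>" unfolding vanishes_near_def by (auto intro: exI[of _ 1])
  ultimately show ?thesis unfolding P_def using \<psi> by blast
qed

section \<open>Representation with a cutoff\<close>

lemma rgreen_reflect:
  "rgreen k e (y - x) = rgreen k e (x - y)" "rgreen1 k e j (y - x) = - rgreen1 k e j (x - y)"
  "rdelta k e (y - x) = rdelta k e (x - y)"
  unfolding rgreen_def rgreen1_def rdelta_def regrad_def by (simp_all add: norm_minus_commute algebra_simps)

lemma continuous_support_bounded:
  fixes h :: "real^3 \<Rightarrow> complex"
  assumes "continuous_on UNIV h" "\<And>x. R < norm x \<Longrightarrow> h x = 0"
  obtains M where "\<And>x. norm (h x) \<le> M"
proof -
  obtain M where M: "\<And>x. norm x \<le> R \<Longrightarrow> norm (h x) \<le> M"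
    using continuous_bounded_on_cball[OF assms(1)] by blast
  show ?thesis
  proof (rule that[of "\<bar>M\<bar>"])
    fix x show "norm (h x) \<le> \<bar>M\<bar>" using M[of x] assms(2)[of x] by (cases "R < norm x") auto
  qed
qed

lemma bump_support: "\<rho> > 0 \<Longrightarrow> 2 * \<rho> < norm x \<Longrightarrow> bump \<rho> x = 0"
  using bump_outside by simp

lemma pd_bump_support: "\<rho> > 0 \<Longrightarrow> 2 * \<rho> \<le> norm x \<Longrightarrow> pd j (bump \<rho>) x = 0"
  using bump_outside unfolding pd_bump by simp

text \<open>Green's second identity for \<open>v\<close> and the regularised Green
  function, cut off by the bump: the weak identity tested with \<open>bump * E\<close>
  and the vanishing integral of the divergence of \<open>bump * v * grad E\<close> are
  subtracted, so that the products of gradients of \<open>v\<close> and \<open>E\<close>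
  cancel. The error terms contain a derivative of the bump and hence live on the shell
  between the radii \<open>\<rho>\<close> and \<open>2 * \<rho>\<close>.\<close>

lemma cutoff_representation:
  assumes v: "C1_on UNIV v"
    and f: "f \<in> borel_measurable borel" "\<And>y. norm (f y) \<le> M" "\<And>y. R0 \<le> norm y \<Longrightarrow> f y = 0"
    and k: "k \<ge> 0" and \<rho>: "\<rho> > 0"
    and weak: "\<And>\<psi> R. C1_on UNIV \<psi> \<Longrightarrow> (\<And>x. R < norm x \<Longrightarrow> \<psi> x = 0) \<Longrightarrow>
      weak_identity v (\<lambda>x. (of_real k)\<^sup>2 * v x + f x) \<psi>"
  shows "bump \<rho> x * v x = conv (rgreen k 0) (\<lambda>y. bump \<rho> y * f y) x
    - (\<Sum>j\<in>UNIV. conv (rgreen k 0) (\<lambda>y. pd j (bump \<rho>) y * pd j v y) x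
        + conv (rgreen1 k 0 j) (\<lambda>y. pd j (bump \<rho>) y * v y) x)"
proof -
  note fm [measurable] = f(1)
  let ?\<phi> = "bump \<rho>"
  have cv: "continuous_on UNIV v" and cpv: "continuous_on UNIV (pd j v)" for j
    using C1_on_continuous[OF v] C1_on_pd_continuous[OF v] by auto
  have c\<phi>: "continuous_on UNIV ?\<phi>" and cp\<phi>: "continuous_on UNIV (pd j ?\<phi>)" for j
    using C1_on_continuous[OF bump_C1] C1_on_pd_continuous[OF bump_C1] by auto
  note b0 = bump_support[OF \<rho>]
  have pb0: "pd j ?\<phi> y = 0" if "2 * \<rho> < norm y" for y j using pd_bump_support[OF \<rho>] that by simp
  have key: "conv (rdelta k (eps n)) (\<lambda>y. ?\<phi> y * v y) x = conv (rgreen k (eps n)) (\<lambda>y. ?\<phi> y * f y) x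
    - (\<Sum>j\<in>UNIV. conv (rgreen k (eps n)) (\<lambda>y. pd j ?\<phi> y * pd j v y) x
        + conv (rgreen1 k (eps n) j) (\<lambda>y. pd j ?\<phi> y * v y) x)" for n
  proof -
    define e where "e = eps n"
    have e: "e > 0" unfolding e_def by (rule eps_props)
    define E where "E y = rgreen k e (y - x)" for y
    define E1 where "E1 j y = rgreen1 k e j (y - x)" for j y
    have gE: "has_grad E (\<lambda>j. E1 j y) y" for y
      unfolding E_def[abs_def] E1_def using e by (intro has_grad_shift rgreen_has_grad) simp
    have gE1: "has_grad (E1 j) (\<lambda>i. rgreen2 k e i j (y - x)) y" for j y
      unfolding E1_def[abs_def] using e by (intro has_grad_shift rgreen1_has_grad) simp
    have cE: "continuous_on UNIV E" "continuous_on UNIV (E1 j)" "continuous_on UNIV (\<lambda>y. rgreen2 k e i j (y - x))" for i j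
      unfolding E_def[abs_def] E1_def[abs_def] using e
      by (auto intro!: continuous_on_compose2[OF rgreen_continuous(1)[of UNIV]] continuous_on_compose2[OF rgreen_continuous(2)[of UNIV]]
          continuous_on_compose2[OF rgreen_continuous(3)[of UNIV]] continuous_intros)
    have EC: "C1_on UNIV E" by (rule C1_onI[OF gE]) (rule cE)
    have E1C: "C1_on UNIV (E1 j)" for j by (rule C1_onI[OF gE1]) (rule cE)
    have [measurable]: "E \<in> borel_measurable borel" by (rule borel_measurable_continuous_onI[OF cE(1)])
    have [measurable]: "bump \<rho> \<in> borel_measurable borel" by (rule bump_measurable)
    have I: "integrable lborel h" if "continuous_on UNIV h" "\<And>y. 2 * \<rho> < norm y \<Longrightarrow> h y = 0" for h :: "real^3 \<Rightarrow> complex"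
      by (rule integrable_continuous_support[OF that])
    have ia: "integrable lborel (\<lambda>y. pd j v y * (?\<phi> y * E1 j y))" for j
      by (rule I) (auto intro!: continuous_on_mult cpv c\<phi> cE simp: b0)
    have ib: "integrable lborel (\<lambda>y. pd j v y * (pd j ?\<phi> y * E y))" for j
      by (rule I) (auto intro!: continuous_on_mult cpv cp\<phi> cE simp: pb0)
    have ic: "integrable lborel (\<lambda>y. pd j ?\<phi> y * v y * E1 j y)" for j
      by (rule I) (auto intro!: continuous_on_mult cv cp\<phi> cE simp: pb0)
    have id: "integrable lborel (\<lambda>y. ?\<phi> y * v y * rgreen2 k e j j (y - x))" for j
      by (rule I) (auto intro!: continuous_on_mult cv c\<phi> cE simp: b0)
    have iE: "integrable lborel (\<lambda>y. v y * (?\<phi> y * E y))"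
      by (rule I) (auto intro!: continuous_on_mult cv c\<phi> cE simp: b0)
    have iD: "integrable lborel (\<lambda>y. rdelta k e (x - y) * (?\<phi> y * v y))"
    proof (rule I)
      have "continuous_on UNIV (\<lambda>y. rdelta k e (x - y))"
        using e by (intro continuous_on_compose2[OF rgreen_continuous(4)[of UNIV]] continuous_intros) auto
      then show "continuous_on UNIV (\<lambda>y. rdelta k e (x - y) * (?\<phi> y * v y))"
        by (intro continuous_on_mult cv c\<phi>)
    qed (simp add: b0)
    have if': "integrable lborel (\<lambda>y. f y * (?\<phi> y * E y))"
    proof (rule Bochner_Integration.integrable_bound[where f="\<lambda>y. M * norm (?\<phi> y * E y)"])
      have "integrable lborel (\<lambda>y. ?\<phi> y * E y)"
        by (rule I) (auto intro!: continuous_on_mult c\<phi> cE simp: b0)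
      then show "integrable lborel (\<lambda>y. M * norm (?\<phi> y * E y))" by auto
      show "(\<lambda>y. f y * (?\<phi> y * E y)) \<in> borel_measurable lborel" by measurable
      show "AE y in lborel. norm (f y * (?\<phi> y * E y)) \<le> norm (M * norm (?\<phi> y * E y))"
      proof (rule AE_I2)
        fix y
        have "norm (f y) \<le> \<bar>M\<bar>" using f(2)[of y] by linarith
        then show "norm (f y * (?\<phi> y * E y)) \<le> norm (M * norm (?\<phi> y * E y))"
          unfolding norm_mult[of "f y"] real_norm_def abs_mult abs_norm_cancel by (rule mult_right_mono) simp
      qed
    qed
    have A: "(\<Sum>j\<in>UNIV. (LINT y|lborel. pd j v y * (?\<phi> y * E1 j y)) + (LINT y|lborel. pd j v y * (pd j ?\<phi> y * E y)))
        = (of_real k)\<^sup>2 * (LINT y|lborel. v y * (?\<phi> y * E y)) + (LINT y|lborel. f y * (?\<phi> y * E y))"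
    proof -
      have C: "C1_on UNIV (\<lambda>y. ?\<phi> y * E y)" by (intro C1_on_mult bump_C1 EC)
      have p: "pd j (\<lambda>y. ?\<phi> y * E y) y = ?\<phi> y * E1 j y + pd j ?\<phi> y * E y" for j y
        by (rule has_grad_pd[OF has_grad_mult[OF C1_on_has_grad[OF bump_C1[of UNIV] UNIV_I] gE]])
      have "weak_identity v (\<lambda>x. (of_real k)\<^sup>2 * v x + f x) (\<lambda>y. ?\<phi> y * E y)"
        by (rule weak[OF C, of "2 * \<rho>"]) (simp add: b0)
      moreover have "(LINT y|lborel. pd j v y * pd j (\<lambda>y. ?\<phi> y * E y) y)
         = (LINT y|lborel. pd j v y * (?\<phi> y * E1 j y)) + (LINT y|lborel. pd j v y * (pd j ?\<phi> y * E y))" for j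
        unfolding p distrib_left[of "pd j v _"] by (rule Bochner_Integration.integral_add[OF ia ib])
      moreover have "(LINT y|lborel. ((of_real k)\<^sup>2 * v y + f y) * (?\<phi> y * E y))
         = (of_real k)\<^sup>2 * (LINT y|lborel. v y * (?\<phi> y * E y)) + (LINT y|lborel. f y * (?\<phi> y * E y))"
        unfolding distrib_right mult.assoc using iE if' by simp
      ultimately show ?thesis unfolding weak_identity_def by simp
    qed
    have Bj: "(LINT y|lborel. ?\<phi> y * v y * rgreen2 k e j j (y - x)) + (LINT y|lborel. pd j v y * (?\<phi> y * E1 j y))
         + (LINT y|lborel. pd j ?\<phi> y * v y * E1 j y) = 0" for j
    proof -
      let ?F = "\<lambda>y. (?\<phi> y * v y) * E1 j y"
      have C: "C1_on UNIV ?F" by (intro C1_on_mult bump_C1 v E1C)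
      have p: "pd j ?F y = ?\<phi> y * v y * rgreen2 k e j j (y - x) + (pd j v y * (?\<phi> y * E1 j y) + pd j ?\<phi> y * v y * E1 j y)" for y
      proof -
        have "has_grad ?F (\<lambda>i. ?\<phi> y * v y * rgreen2 k e i j (y - x) + (?\<phi> y * pd i v y + pd i ?\<phi> y * v y) * E1 j y) y"
          by (rule has_grad_mult[OF has_grad_mult[OF C1_on_has_grad[OF bump_C1[of UNIV] UNIV_I] C1_on_has_grad[OF v UNIV_I]] gE1])
        from has_grad_pd[OF this, of j] show ?thesis by (simp add: algebra_simps)
      qed
      have "0 = integral\<^sup>L lborel (pd j ?F)"
        by (rule integral_pd_eq_0[OF C, of "2 * \<rho>", symmetric]) (simp add: b0)
      then show ?thesis unfolding p using ia[of j] ic[of j] id[of j] by (simp add: add.assoc)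
    qed
    have tr: "(\<Sum>j\<in>UNIV. LINT y|lborel. ?\<phi> y * v y * rgreen2 k e j j (y - x))
        = - (of_real k)\<^sup>2 * (LINT y|lborel. v y * (?\<phi> y * E y)) - conv (rdelta k e) (\<lambda>y. ?\<phi> y * v y) x"
    proof -
      have "(\<Sum>j\<in>UNIV. LINT y|lborel. ?\<phi> y * v y * rgreen2 k e j j (y - x))
         = (LINT y|lborel. (\<Sum>j\<in>UNIV. ?\<phi> y * v y * rgreen2 k e j j (y - x)))"
        using id by (rule Bochner_Integration.integral_sum[symmetric])
      also have "\<dots> = (LINT y|lborel. - (of_real k)\<^sup>2 * (v y * (?\<phi> y * E y)) - rdelta k e (x - y) * (?\<phi> y * v y))"
      proof -
        have t: "(\<Sum>j\<in>UNIV. rgreen2 k e j j (y - x)) = - (of_real k)\<^sup>2 * E y - rdelta k e (x - y)" for y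
          unfolding E_def rgreen_reflect(3)[of k e x y] by (rule rgreen2_trace) (simp add: e)
        show ?thesis unfolding sum_distrib_left[symmetric] t by (simp add: algebra_simps)
      qed
      also have "\<dots> = - (of_real k)\<^sup>2 * (LINT y|lborel. v y * (?\<phi> y * E y)) - conv (rdelta k e) (\<lambda>y. ?\<phi> y * v y) x"
        unfolding conv_def using iE iD by (subst Bochner_Integration.integral_diff) auto
      finally show ?thesis .
    qed
    have "(\<Sum>j\<in>UNIV. (LINT y|lborel. ?\<phi> y * v y * rgreen2 k e j j (y - x)) + (LINT y|lborel. pd j v y * (?\<phi> y * E1 j y))
         + (LINT y|lborel. pd j ?\<phi> y * v y * E1 j y)) = 0"
      unfolding Bj by simp
    then have "conv (rdelta k e) (\<lambda>y. ?\<phi> y * v y) x = (LINT y|lborel. f y * (?\<phi> y * E y))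
       - (\<Sum>j\<in>UNIV. (LINT y|lborel. pd j v y * (pd j ?\<phi> y * E y)) - (LINT y|lborel. pd j ?\<phi> y * v y * E1 j y))"
    proof -
      (* Eliminating the common term a, with the products of gradients, and the
         zero-order term K * I. *)
      have lin: "D = F - (b' - c)" if "d + a + c = 0" "a + b' = K * I + F" "d = - K * I - D"
        for D F a b' c d K I :: complex
        using that by algebra
      show ?thesis unfolding sum_subtractf
        by (rule lin[OF _ A[unfolded sum.distrib] tr])
           (use \<open>(\<Sum>j\<in>UNIV. (LINT y|lborel. ?\<phi> y * v y * rgreen2 k e j j (y - x)) + (LINT y|lborel. pd j v y * (?\<phi> y * E1 j y))
         + (LINT y|lborel. pd j ?\<phi> y * v y * E1 j y)) = 0\<close> in \<open>simp only: sum.distrib\<close>)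
    qed
    moreover have "(LINT y|lborel. f y * (?\<phi> y * E y)) = conv (rgreen k e) (\<lambda>y. ?\<phi> y * f y) x"
      unfolding conv_def E_def rgreen_reflect(1)[of k e _ x] by (simp add: mult_ac)
    moreover have "(LINT y|lborel. pd j v y * (pd j ?\<phi> y * E y)) = conv (rgreen k e) (\<lambda>y. pd j ?\<phi> y * pd j v y) x" for j
      unfolding conv_def E_def rgreen_reflect(1)[of k e _ x] by (simp add: mult_ac)
    moreover have "(LINT y|lborel. pd j ?\<phi> y * v y * E1 j y) = - conv (rgreen1 k e j) (\<lambda>y. pd j ?\<phi> y * v y) x" for j
      unfolding conv_def E1_def rgreen_reflect(2)[of k e j _ x] by (simp add: mult_ac)
    ultimately show ?thesis unfolding e_def by simp
  qed
  have lim_of: "(\<lambda>n. conv (rgreen k (eps n)) h x) \<longlonglongrightarrow> conv (rgreen k 0) h x"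
    "(\<lambda>n. conv (rgreen1 k (eps n) j) h x) \<longlonglongrightarrow> conv (rgreen1 k 0 j) h x"
    "isCont h x \<Longrightarrow> (\<lambda>n. conv (rdelta k (eps n)) h x) \<longlonglongrightarrow> h x"
    if h: "h \<in> borel_measurable borel" "\<And>y. norm (h y) \<le> Mh" "\<And>y. 2 * \<rho> < norm y \<Longrightarrow> h y = 0" for h j Mh
  proof -
    have h0: "h y = 0" if "2 * \<rho> + 1 \<le> norm y" for y using h(3) that by simp
    show "(\<lambda>n. conv (rgreen k (eps n)) h x) \<longlonglongrightarrow> conv (rgreen k 0) h x"
      "(\<lambda>n. conv (rgreen1 k (eps n) j) h x) \<longlonglongrightarrow> conv (rgreen1 k 0 j) h x"
      using regularized_potential(2,3)[OF h(1,2) h0 k] by auto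
    show "isCont h x \<Longrightarrow> (\<lambda>n. conv (rdelta k (eps n)) h x) \<longlonglongrightarrow> h x"
      by (rule delta_limit[OF h(1,2) h0 k])
  qed
  have cont_bd: "\<exists>Mh. \<forall>y. norm (h y) \<le> Mh" if "continuous_on UNIV h" "\<And>y. 2 * \<rho> < norm y \<Longrightarrow> h y = 0" for h :: "real^3 \<Rightarrow> complex"
    using continuous_support_bounded[OF that] by metis
  have L1: "(\<lambda>n. conv (rdelta k (eps n)) (\<lambda>y. ?\<phi> y * v y) x) \<longlonglongrightarrow> ?\<phi> x * v x"
  proof -
    have c: "continuous_on UNIV (\<lambda>y. ?\<phi> y * v y)" by (intro continuous_on_mult cv c\<phi>)
    have ic: "isCont (\<lambda>y. ?\<phi> y * v y) x"
      by (rule bspec[OF iffD1[OF continuous_on_eq_continuous_at[OF open_UNIV] c] UNIV_I])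
    have z: "?\<phi> y * v y = 0" if "2 * \<rho> < norm y" for y using b0[OF that] by simp
    obtain Mh where "\<And>y. norm (?\<phi> y * v y) \<le> Mh" using cont_bd[OF c z] by blast
    then show ?thesis
      by (rule lim_of(3)[OF borel_measurable_continuous_onI[OF c] _ z]) (assumption | rule ic)+
  qed
  have L2: "(\<lambda>n. conv (rgreen k (eps n)) (\<lambda>y. ?\<phi> y * f y) x) \<longlonglongrightarrow> conv (rgreen k 0) (\<lambda>y. ?\<phi> y * f y) x"
  proof (rule lim_of(1)[where Mh=M])
    show "(\<lambda>y. ?\<phi> y * f y) \<in> borel_measurable borel" by measurable
    show "norm (?\<phi> y * f y) \<le> M" for y
      using mult_mono[OF bump_bounds(1)[of \<rho> y] f(2)[of y]] by (simp add: norm_mult)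
  qed (simp add: b0)
  have L3: "(\<lambda>n. conv (rgreen k (eps n)) (\<lambda>y. pd j ?\<phi> y * pd j v y) x) \<longlonglongrightarrow> conv (rgreen k 0) (\<lambda>y. pd j ?\<phi> y * pd j v y) x" for j
  proof -
    have c: "continuous_on UNIV (\<lambda>y. pd j ?\<phi> y * pd j v y)" by (intro continuous_on_mult cpv cp\<phi>)
    have z: "pd j ?\<phi> y * pd j v y = 0" if "2 * \<rho> < norm y" for y using pb0[OF that] by simp
    obtain Mh where "\<And>y. norm (pd j ?\<phi> y * pd j v y) \<le> Mh" using cont_bd[OF c z] by blast
    then show ?thesis by (rule lim_of(1)[OF borel_measurable_continuous_onI[OF c] _ z])
  qed
  have L4: "(\<lambda>n. conv (rgreen1 k (eps n) j) (\<lambda>y. pd j ?\<phi> y * v y) x) \<longlonglongrightarrow> conv (rgreen1 k 0 j) (\<lambda>y. pd j ?\<phi> y * v y) x" for j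
  proof -
    have c: "continuous_on UNIV (\<lambda>y. pd j ?\<phi> y * v y)" by (intro continuous_on_mult cv cp\<phi>)
    have z: "pd j ?\<phi> y * v y = 0" if "2 * \<rho> < norm y" for y using pb0[OF that] by simp
    obtain Mh where "\<And>y. norm (pd j ?\<phi> y * v y) \<le> Mh" using cont_bd[OF c z] by blast
    then show ?thesis by (rule lim_of(2)[OF borel_measurable_continuous_onI[OF c] _ z])
  qed
  have "(\<lambda>n. conv (rgreen k (eps n)) (\<lambda>y. ?\<phi> y * f y) x
    - (\<Sum>j\<in>UNIV. conv (rgreen k (eps n)) (\<lambda>y. pd j ?\<phi> y * pd j v y) x
        + conv (rgreen1 k (eps n) j) (\<lambda>y. pd j ?\<phi> y * v y) x)) \<longlonglongrightarrow> conv (rgreen k 0) (\<lambda>y. ?\<phi> y * f y) x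
    - (\<Sum>j\<in>UNIV. conv (rgreen k 0) (\<lambda>y. pd j ?\<phi> y * pd j v y) x
        + conv (rgreen1 k 0 j) (\<lambda>y. pd j ?\<phi> y * v y) x)"
    by (intro tendsto_diff tendsto_sum tendsto_add L2 L3 L4)
  then show ?thesis using L1 unfolding key[symmetric] by (rule LIMSEQ_unique[rotated])
qed

section \<open>Energy on spherical shells\<close>

text \<open>The quantity that the Sommerfeld condition requires to be \<open>o(1 / norm
  y)\<close>.\<close>

definition radial_defect :: "real \<Rightarrow> (real^3 \<Rightarrow> complex) \<Rightarrow> real^3 \<Rightarrow> complex" where
  "radial_defect k v y = frechet_derivative v (at y) (y /\<^sub>R norm y) - \<i> * of_real k * v y"

lemma radiating_defect:
  assumes "radiating k v" "c > 0"
  obtains \<rho> where "\<rho> > 0" "\<And>y. norm y \<ge> \<rho> \<Longrightarrow> norm (radial_defect k v y) \<le> c / norm y"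
proof -
  have "\<forall>\<^sub>F y in at_infinity. norm (norm (radial_defect k v y)) \<le> c * norm (1 / norm y)"
    using landau_o.smallD[OF assms(1)[unfolded radiating_def] assms(2)] unfolding radial_defect_def .
  then obtain b where b: "\<And>y. b \<le> norm y \<Longrightarrow> norm (radial_defect k v y) \<le> c * norm (1 / norm y)"
    unfolding eventually_at_infinity by auto
  show ?thesis
  proof (rule that[of "max b 1"])
    show "norm (radial_defect k v y) \<le> c / norm y" if "max b 1 \<le> norm y" for y
      using b[of y] that by simp
  qed simp
qed

lemma radial_sum_pd:
  assumes v: "C1_on UNIV v" and y: "y \<noteq> 0"
  shows "(\<Sum>j\<in>UNIV. of_real (y $ j) * pd j v y) = of_real (norm y) * (\<i> * of_real k * v y + radial_defect k v y)"
proof -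
  have "of_real (norm y) * (\<i> * of_real k * v y + radial_defect k v y) =
     norm y *\<^sub>R (\<Sum>j\<in>UNIV. ((y /\<^sub>R norm y) $ j) *\<^sub>R pd j v y)"
    unfolding radial_defect_def has_grad_frechet[OF C1_on_has_grad[OF v UNIV_I]] by (simp add: scaleR_conv_of_real)
  also have "\<dots> = (\<Sum>j\<in>UNIV. of_real (y $ j) * pd j v y)"
    unfolding scaleR_sum_right using y by (intro sum.cong) (auto simp: scaleR_conv_of_real[symmetric])
  finally show ?thesis ..
qed

lemma ball_volume:
  "r \<ge> 0 \<Longrightarrow> (LINT y|lborel. indicator (ball 0 r) (y :: real^3)) = unit_ball_vol 3 * r ^ 3"
  by (simp add: content_ball)

lemma integrable_indicator_ball: "integrable lborel (\<lambda>y :: real^3. c * indicator (ball 0 r) y :: real)"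
  by (intro integrable_mult_right integrable_real_indicator emeasure_lborel_ball_finite) simp

lemma bump_shell:
  assumes \<rho>: "\<rho> > 0"
  shows "bump_slope \<rho> y * norm y \<le> 16 / \<rho> * indicator (ball 0 (2 * \<rho>)) y"
    and "bump_slope \<rho> y \<noteq> 0 \<Longrightarrow> \<rho> < norm y \<and> norm y < 2 * \<rho>"
proof -
  show nz: "bump_slope \<rho> y \<noteq> 0 \<Longrightarrow> \<rho> < norm y \<and> norm y < 2 * \<rho>"
    using bump_inside(2)[OF \<rho>, of y] bump_outside(2)[OF \<rho>, of y] by linarith
  show "bump_slope \<rho> y * norm y \<le> 16 / \<rho> * indicator (ball 0 (2 * \<rho>)) y"
  proof (cases "bump_slope \<rho> y = 0")
    case True
    then show ?thesis using \<rho> by (simp add: indicator_def)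
  next
    case False
    then have y: "norm y < 2 * \<rho>" using nz by blast
    have "bump_slope \<rho> y * norm y \<le> 8 / \<rho>\<^sup>2 * (2 * \<rho>)"
      using y bump_bounds by (intro mult_mono) auto
    also have "\<dots> = 16 / \<rho>" using \<rho> by (simp add: field_simps power2_eq_square)
    finally show ?thesis using y by simp
  qed
qed

text \<open>Conservation of energy. Test with \<open>bump * cnj v\<close> and take
  imaginary parts: the terms with \<open>\<bar>grad v\<bar>\<^sup>2\<close> and
  \<open>\<bar>v\<bar>\<^sup>2\<close> are real and drop out, so the flux through the
  shell is bounded by an integral over the support of \<open>f\<close>. By the radiation
  condition the flux is \<open>k * \<bar>v\<bar>\<^sup>2\<close> up to
  \<open>radial_defect\<close>, half of the former absorbing part of the error.\<close>

lemma shell_energy_bound: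
  assumes v: "C1_on UNIV v" and rad: "radiating k v"
    and f: "f \<in> borel_measurable borel" "\<And>y. norm (f y) \<le> M" "\<And>y. R0 \<le> norm y \<Longrightarrow> f y = 0"
    and k: "k > 0"
    and weak: "\<And>\<psi> R. C1_on UNIV \<psi> \<Longrightarrow> (\<And>x. R < norm x \<Longrightarrow> \<psi> x = 0) \<Longrightarrow>
      weak_identity v (\<lambda>x. (of_real k)\<^sup>2 * v x + f x) \<psi>"
  obtains C \<rho>0 where "\<rho>0 > 0" "\<And>\<rho>. \<rho> \<ge> \<rho>0 \<Longrightarrow> (LINT y|lborel. bump_slope \<rho> y * norm y * (norm (v y))\<^sup>2) \<le> C"
proof -
  note fm [measurable] = f(1)
  have cv: "continuous_on UNIV v" and cpv: "continuous_on UNIV (pd j v)" for j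
    using C1_on_continuous[OF v] C1_on_pd_continuous[OF v] by auto
  have [measurable]: "v \<in> borel_measurable borel" by (rule borel_measurable_continuous_onI[OF cv])
  obtain Mv where Mv: "\<And>y. norm y \<le> R0 \<Longrightarrow> norm (v y) \<le> Mv" using continuous_bounded_on_cball[OF cv] by blast
  have M0: "M \<ge> 0" using f(2)[of 0] norm_ge_zero order.trans by blast
  note fi = bounded_support_integrable[OF f]
  have ifv: "integrable lborel (\<lambda>y. norm (f y) * \<bar>Mv\<bar>)" using fi by auto
  define K where "K = (LINT y|lborel. norm (f y) * \<bar>Mv\<bar>)"
  define \<beta> where "\<beta> = unit_ball_vol (3 :: real)"
  obtain \<rho>0 where \<rho>0: "\<rho>0 > 0" "\<And>y. norm y \<ge> \<rho>0 \<Longrightarrow> norm (radial_defect k v y) \<le> 1 / norm y"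
    using radiating_defect[OF rad, of 1] by auto
  show ?thesis
  proof (rule that[of \<rho>0 "2 / k * (K + 32 * \<beta> / k)"])
    show "\<rho>0 > 0" by (rule \<rho>0)
    fix \<rho> assume \<rho>1: "\<rho> \<ge> \<rho>0"
    then have \<rho>: "\<rho> > 0" using \<rho>0 by simp
    let ?\<phi> = "bump \<rho>" and ?s = "bump_slope \<rho>"
    have c\<phi>: "continuous_on UNIV ?\<phi>" and cp\<phi>: "continuous_on UNIV (pd j ?\<phi>)" for j
      using C1_on_continuous[OF bump_C1] C1_on_pd_continuous[OF bump_C1] by auto
    note b0 = bump_support[OF \<rho>]
    have pb0: "pd j ?\<phi> y = 0" if "2 * \<rho> < norm y" for y j using pd_bump_support[OF \<rho>] that by simp
    define w where "w j y = pd j v y * (pd j ?\<phi> y * cnj (v y))" for j y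
    have C: "C1_on UNIV (\<lambda>y. ?\<phi> y * cnj (v y))" by (intro C1_on_mult bump_C1 C1_on_cnj v)
    have p: "pd j (\<lambda>y. ?\<phi> y * cnj (v y)) y = ?\<phi> y * cnj (pd j v y) + pd j ?\<phi> y * cnj (v y)" for j y
      by (rule has_grad_pd[OF has_grad_mult[OF C1_on_has_grad[OF bump_C1[of UNIV] UNIV_I] has_grad_cnj[OF C1_on_has_grad[OF v UNIV_I]]]])
    have iw: "integrable lborel (w j)" for j
      unfolding w_def
      by (rule integrable_continuous_support[of _ "2 * \<rho>"]) (auto intro!: continuous_on_mult continuous_on_cnj cpv cp\<phi> cv simp: pb0)
    have iG: "integrable lborel (\<lambda>y. pd j v y * (?\<phi> y * cnj (pd j v y)))" for j
      by (rule integrable_continuous_support[of _ "2 * \<rho>"]) (auto intro!: continuous_on_mult continuous_on_cnj cpv c\<phi> simp: b0)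
    have iV: "integrable lborel (\<lambda>y. v y * (?\<phi> y * cnj (v y)))"
      by (rule integrable_continuous_support[of _ "2 * \<rho>"]) (auto intro!: continuous_on_mult continuous_on_cnj cv c\<phi> simp: b0)
    have fle: "norm (f y * (?\<phi> y * cnj (v y))) \<le> norm (f y) * \<bar>Mv\<bar>" for y
    proof (cases "R0 \<le> norm y")
      case False
      have "norm (?\<phi> y) * norm (v y) \<le> 1 * \<bar>Mv\<bar>"
        using False Mv[of y] bump_bounds(1)[of \<rho> y] by (intro mult_mono) auto
      then show ?thesis unfolding norm_mult complex_mod_cnj by (intro mult_left_mono) auto
    qed (simp add: f(3))
    have iF: "integrable lborel (\<lambda>y. f y * (?\<phi> y * cnj (v y)))"
    proof (rule Bochner_Integration.integrable_bound[OF ifv])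
      show "(\<lambda>y. f y * (?\<phi> y * cnj (v y))) \<in> borel_measurable lborel"
      proof -
        have [measurable]: "(\<lambda>y. cnj (v y)) \<in> borel_measurable borel"
          by (rule borel_measurable_continuous_onI) (intro continuous_on_cnj cv)
        show ?thesis by measurable
      qed
      show "AE y in lborel. norm (f y * (?\<phi> y * cnj (v y))) \<le> norm (norm (f y) * \<bar>Mv\<bar>)"
        using fle by (simp add: abs_mult)
    qed
    have real_int: "Im (LINT y|lborel. h y) = 0" if "integrable lborel h" "\<And>y. Im (h y) = 0" for h :: "real^3 \<Rightarrow> complex"
      using integral_bounded_linear[OF bounded_linear_Im that(1)] that(2) by simp
    have \<phi>r: "Im (?\<phi> y) = 0" for y unfolding bump_def by simp
    have sumw: "Im (\<Sum>j\<in>UNIV. integral\<^sup>L lborel (w j)) = Im (LINT y|lborel. f y * (?\<phi> y * cnj (v y)))"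
    proof -
      have "weak_identity v (\<lambda>x. (of_real k)\<^sup>2 * v x + f x) (\<lambda>y. ?\<phi> y * cnj (v y))"
        by (rule weak[OF C, of "2 * \<rho>"]) (simp add: b0)
      moreover have "(LINT y|lborel. pd j v y * pd j (\<lambda>y. ?\<phi> y * cnj (v y)) y)
         = (LINT y|lborel. pd j v y * (?\<phi> y * cnj (pd j v y))) + integral\<^sup>L lborel (w j)" for j
        unfolding p distrib_left[of "pd j v _"] w_def[symmetric] by (rule Bochner_Integration.integral_add[OF iG iw])
      moreover have "(LINT y|lborel. ((of_real k)\<^sup>2 * v y + f y) * (?\<phi> y * cnj (v y)))
         = (of_real k)\<^sup>2 * (LINT y|lborel. v y * (?\<phi> y * cnj (v y))) + (LINT y|lborel. f y * (?\<phi> y * cnj (v y)))"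
        unfolding distrib_right mult.assoc using iV iF by simp
      ultimately have e: "(\<Sum>j\<in>UNIV. LINT y|lborel. pd j v y * (?\<phi> y * cnj (pd j v y))) + (\<Sum>j\<in>UNIV. integral\<^sup>L lborel (w j))
         = (of_real k)\<^sup>2 * (LINT y|lborel. v y * (?\<phi> y * cnj (v y))) + (LINT y|lborel. f y * (?\<phi> y * cnj (v y)))"
        unfolding weak_identity_def by (simp add: sum.distrib)
      have 1: "Im (LINT y|lborel. pd j v y * (?\<phi> y * cnj (pd j v y))) = 0" for j
        by (rule real_int[OF iG]) (simp add: \<phi>r algebra_simps)
      have 2: "Im (LINT y|lborel. v y * (?\<phi> y * cnj (v y))) = 0"
        by (rule real_int[OF iV]) (simp add: \<phi>r algebra_simps)
      have 3: "Im ((of_real k)\<^sup>2 * z) = k\<^sup>2 * Im z" for z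
        by (simp flip: of_real_power)
      show ?thesis using arg_cong[OF e, of Im] 1 2 unfolding plus_complex.sel 3 by simp
    qed
    let ?T = "\<lambda>y. - Im (\<Sum>j\<in>UNIV. w j y)"
    have iT: "integrable lborel ?T"
      by (intro Bochner_Integration.integrable_minus integrable_bounded_linear[OF bounded_linear_Im]
          Bochner_Integration.integrable_sum iw)
    have intT: "integral\<^sup>L lborel ?T \<le> K"
    proof -
      have "integral\<^sup>L lborel ?T = - Im (\<Sum>j\<in>UNIV. integral\<^sup>L lborel (w j))"
        using integral_bounded_linear[OF bounded_linear_Im, of lborel "\<lambda>y. \<Sum>j\<in>UNIV. w j y"] iw
        by (simp add: Bochner_Integration.integral_sum)
      also have "\<dots> \<le> norm (LINT y|lborel. f y * (?\<phi> y * cnj (v y)))"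
        unfolding sumw using abs_Im_le_cmod[of "LINT y|lborel. f y * (?\<phi> y * cnj (v y))"] by linarith
      also have "\<dots> \<le> K" unfolding K_def
        by (rule Bochner_Integration.integral_norm_bound_integral[OF iF ifv]) (rule fle)
      finally show ?thesis .
    qed
    have pt: "k / 2 * (?s y * norm y * (norm (v y))\<^sup>2) \<le> ?T y + 4 / (k * \<rho> ^ 3) * indicator (ball 0 (2 * \<rho>)) y" for y
    proof (cases "?s y = 0")
      case True
      then have "w j y = 0" for j unfolding w_def pd_bump by simp
      then show ?thesis using True k \<rho> by (simp add: indicator_def)
    next
      case False
      then have y: "\<rho> < norm y" "norm y < 2 * \<rho>" using bump_shell(2)[OF \<rho>] by auto
      then have y0: "y \<noteq> 0" using \<rho> by auto
      let ?\<epsilon> = "radial_defect k v y"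
      have s0: "?s y \<ge> 0" by (rule bump_bounds)
      have "(\<Sum>j\<in>UNIV. w j y) = - of_real (?s y) * cnj (v y) * (\<Sum>j\<in>UNIV. of_real (y $ j) * pd j v y)"
        unfolding w_def pd_bump by (simp add: sum_distrib_left sum_negf mult_ac)
      also have "\<dots> = - of_real (?s y * norm y) * (\<i> * of_real k * (v y * cnj (v y)) + ?\<epsilon> * cnj (v y))"
        unfolding radial_sum_pd[OF v y0, of k] by (simp add: algebra_simps)
      also have "v y * cnj (v y) = of_real ((norm (v y))\<^sup>2)" by (rule complex_norm_square[symmetric])
      finally have sw0: "(\<Sum>j\<in>UNIV. w j y) =
          - of_real (?s y * norm y) * (\<i> * of_real k * of_real ((norm (v y))\<^sup>2) + ?\<epsilon> * cnj (v y))" .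
      have Im_eq: "- Im (- of_real A * (\<i> * of_real k * of_real N + z)) = A * (k * N + Im z)"
        for A N :: real and z :: complex
        by simp
      have sw: "?T y = ?s y * norm y * (k * (norm (v y))\<^sup>2 + Im (?\<epsilon> * cnj (v y)))"
        unfolding sw0 by (rule Im_eq)
      have "norm ?\<epsilon> * norm (v y) \<le> (norm ?\<epsilon>)\<^sup>2 / (2 * k) + k / 2 * (norm (v y))\<^sup>2"
        by (rule mult_le_weighted_squares[OF k])
      moreover have "- Im (?\<epsilon> * cnj (v y)) \<le> norm ?\<epsilon> * norm (v y)"
        using abs_Im_le_cmod[of "?\<epsilon> * cnj (v y)"] by (simp add: norm_mult)
      moreover have "(norm ?\<epsilon>)\<^sup>2 / (2 * k) \<le> (1 / norm y)\<^sup>2 / (2 * k)"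
        using \<rho>0(2)[of y] y \<rho>1 k by (intro divide_right_mono power_mono) auto
      ultimately have "k / 2 * (norm (v y))\<^sup>2 \<le> (k * (norm (v y))\<^sup>2 + Im (?\<epsilon> * cnj (v y))) + (1 / norm y)\<^sup>2 / (2 * k)"
        by linarith
      then have "?s y * norm y * (k / 2 * (norm (v y))\<^sup>2) \<le>
          ?s y * norm y * ((k * (norm (v y))\<^sup>2 + Im (?\<epsilon> * cnj (v y))) + (1 / norm y)\<^sup>2 / (2 * k))"
        using s0 by (intro mult_left_mono) auto
      also have "\<dots> = ?T y + ?s y * norm y * ((1 / norm y)\<^sup>2 / (2 * k))"
        unfolding sw by (simp only: distrib_left)
      also have "?s y * norm y * ((1 / norm y)\<^sup>2 / (2 * k)) = ?s y * (1 / norm y) * (1 / (2 * k))"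
        using y0 by (simp add: field_simps power2_eq_square)
      also have "\<dots> \<le> 8 / \<rho>\<^sup>2 * (1 / \<rho>) * (1 / (2 * k))"
        using y \<rho> k bump_bounds[of \<rho> y] by (intro mult_right_mono mult_mono divide_left_mono mult_pos_pos) auto
      also have "\<dots> = 4 / (k * \<rho> ^ 3) * indicator (ball 0 (2 * \<rho>)) y"
        using y k \<rho> by (simp add: field_simps power2_eq_square power3_eq_cube)
      finally show ?thesis by (simp add: mult_ac)
    qed
    have isv: "integrable lborel (\<lambda>y. ?s y * norm y * (norm (v y))\<^sup>2)"
      by (rule integrable_continuous_support[of _ "2 * \<rho>"])
         (use bump_outside(2)[OF \<rho>] in \<open>auto intro!: continuous_intros bump_continuous cv\<close>)
    have "k / 2 * (LINT y|lborel. ?s y * norm y * (norm (v y))\<^sup>2) = (LINT y|lborel. k / 2 * (?s y * norm y * (norm (v y))\<^sup>2))"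
      by simp
    also have "\<dots> \<le> (LINT y|lborel. ?T y + 4 / (k * \<rho> ^ 3) * indicator (ball 0 (2 * \<rho>)) y)"
      by (rule integral_mono[OF integrable_mult_right[OF isv] Bochner_Integration.integrable_add[OF iT integrable_indicator_ball] pt])
    also have "\<dots> = integral\<^sup>L lborel ?T + 4 / (k * \<rho> ^ 3) * (\<beta> * (2 * \<rho>) ^ 3)"
      unfolding Bochner_Integration.integral_add[OF iT integrable_indicator_ball]
      unfolding integral_mult_right_zero \<beta>_def using ball_volume[of "2 * \<rho>"] \<rho> by simp
    also have "4 / (k * \<rho> ^ 3) * (\<beta> * (2 * \<rho>) ^ 3) = 32 * \<beta> / k"
      using \<rho> k by (simp add: field_simps power_mult_distrib)
    finally have "k / 2 * (LINT y|lborel. ?s y * norm y * (norm (v y))\<^sup>2) \<le> K + 32 * \<beta> / k" using intT by linarith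
    then have "2 / k * (k / 2 * (LINT y|lborel. ?s y * norm y * (norm (v y))\<^sup>2)) \<le> 2 / k * (K + 32 * \<beta> / k)"
      using k by (intro mult_left_mono) auto
    then show "(LINT y|lborel. ?s y * norm y * (norm (v y))\<^sup>2) \<le> 2 / k * (K + 32 * \<beta> / k)"
      using k by simp
  qed
qed

section \<open>Representation of radiating fields\<close>

text \<open>In the error terms of \<open>cutoff_representation\<close> the leading
  contributions \<open>\<i> * k\<close> of \<open>v\<close> and of the Green function
  cancel. What remains is the Green function, of size \<open>1 / \<rho>\<close>, times
  \<open>radial_defect\<close>, of size \<open>\<eta> / \<rho>\<close>, and
  \<open>v\<close> times the defect of the Green function, of size \<open>1 /
  \<rho>\<^sup>2\<close>; the gradient of the cutoff contributes a factor \<open>1 /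
  \<rho>\<close>. After integration over the shell the first is a multiple of
  \<open>\<eta>\<close> and the second, by \<open>shell_energy_bound\<close>, a multiple
  of \<open>1 / \<rho>\<close>.\<close>

theorem radiating_representation:
  assumes v: "C1_on UNIV v" and rad: "radiating k v"
    and f: "f \<in> borel_measurable borel" "\<And>y. norm (f y) \<le> M" "\<And>y. R0 \<le> norm y \<Longrightarrow> f y = 0"
    and k: "k > 0" and B: "finite B"
    and off: "\<And>x. (\<And>j c. (j, c) \<in> B \<Longrightarrow> x $ j \<noteq> c) \<Longrightarrow>
       \<exists>T. open T \<and> x \<in> T \<and> C2_on T v \<and> laplacian v x = - ((of_real k)\<^sup>2 * v x + f x)"
  shows "v x = conv (rgreen k 0) f x"
proof -
  note fm [measurable] = f(1)
  have k': "k \<ge> 0" using k by simp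
  have cv: "continuous_on UNIV v" and cpv: "continuous_on UNIV (pd j v)" for j
    using C1_on_continuous[OF v] C1_on_pd_continuous[OF v] by auto
  have vm [measurable]: "v \<in> borel_measurable borel" by (rule borel_measurable_continuous_onI[OF cv])
  have weak: "weak_identity v (\<lambda>x. (of_real k)\<^sup>2 * v x + f x) \<psi>"
    if \<psi>: "C1_on UNIV \<psi>" "\<And>x. R < norm x \<Longrightarrow> \<psi> x = 0" for \<psi> R
  proof -
    obtain Mv where Mv: "\<And>y. norm y \<le> R \<Longrightarrow> norm (v y) \<le> Mv" using continuous_bounded_on_cball[OF cv] by blast
    show ?thesis
    proof (rule weak_identity_across_planes[OF v B _ _ off \<psi>])
      show "(\<lambda>x. (of_real k)\<^sup>2 * v x + f x) \<in> borel_measurable borel" by measurable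
      fix x :: "real^3" assume "norm x \<le> R"
      have "norm ((of_real k)\<^sup>2 * v x + f x) \<le> k\<^sup>2 * norm (v x) + norm (f x)"
        by (rule order.trans[OF norm_triangle_ineq]) (simp add: norm_mult norm_power)
      also have "\<dots> \<le> k\<^sup>2 * Mv + M" using Mv[OF \<open>norm x \<le> R\<close>] f(2)[of x] by (intro add_mono mult_left_mono) auto
      finally show "norm ((of_real k)\<^sup>2 * v x + f x) \<le> k\<^sup>2 * Mv + M" .
    qed
  qed
  obtain Ce \<rho>e where E: "\<rho>e > 0" "\<And>\<rho>. \<rho> \<ge> \<rho>e \<Longrightarrow> (LINT y|lborel. bump_slope \<rho> y * norm y * (norm (v y))\<^sup>2) \<le> Ce"
  proof -
    have "\<exists>C \<rho>0. \<rho>0 > 0 \<and> (\<forall>\<rho>\<ge>\<rho>0. (LINT y|lborel. bump_slope \<rho> y * norm y * (norm (v y))\<^sup>2) \<le> C)"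
    proof (rule shell_energy_bound[OF v rad f(1), where M=M and ?R0.0=R0])
      fix C \<rho>0 assume "\<rho>0 > 0" "\<And>\<rho>. \<rho> \<ge> \<rho>0 \<Longrightarrow> (LINT y|lborel. bump_slope \<rho> y * norm y * (norm (v y))\<^sup>2) \<le> C"
      then show ?thesis by blast
    next
      show "weak_identity v (\<lambda>x. (of_real k)\<^sup>2 * v x + f x) \<psi>"
        if "C1_on UNIV \<psi>" "\<And>x. R < norm x \<Longrightarrow> \<psi> x = 0" for \<psi> R
        by (rule weak[OF that])
    qed (use f k in auto)
    then show ?thesis using that by blast
  qed
  define \<beta> where "\<beta> = unit_ball_vol (3 :: real)"
  have \<beta>: "\<beta> \<ge> 0" unfolding \<beta>_def by simp
  define C where "C = 4 * (2 * k * norm x + 1)"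
  have C: "C \<ge> 0" unfolding C_def using k by simp
  have bound: "norm (v x - conv (rgreen k 0) f x) \<le> 128 * \<beta> * \<eta> + C * (Ce / 2 + 64 * \<beta>) / \<rho>"
    if \<eta>: "\<eta> > 0" and def\<eta>: "\<And>y. \<rho> \<le> norm y \<Longrightarrow> norm (radial_defect k v y) \<le> \<eta> / norm y"
      and big: "\<rho> > 0" "\<rho> \<ge> \<rho>e" "\<rho> \<ge> R0" "\<rho> \<ge> 2 * norm x + 1" for \<eta> \<rho>
  proof -
    note \<rho> = big(1)
    let ?\<phi> = "bump \<rho>" and ?s = "bump_slope \<rho>"
    have cp\<phi>: "continuous_on UNIV (pd j ?\<phi>)" for j
      using C1_on_pd_continuous[OF bump_C1] by auto
    have pb0: "pd j ?\<phi> y = 0" if "2 * \<rho> < norm y" for y j using pd_bump_support[OF \<rho>] that by simp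
    have bx: "?\<phi> x = 1" using bump_inside(1)[OF \<rho>, of x] big(4) norm_ge_zero[of x] by linarith
    have bf: "(\<lambda>y. ?\<phi> y * f y) = f"
    proof
      fix y show "?\<phi> y * f y = f y"
        using bump_inside(1)[OF \<rho>, of y] f(3)[of y] big(3) by (cases "R0 \<le> norm y") auto
    qed
    have ints: "integrable lborel (\<lambda>y. rgreen k 0 (x - y) * h y)" "integrable lborel (\<lambda>y. rgreen1 k 0 j (x - y) * h y)"
      if h: "continuous_on UNIV h" "\<And>y. 2 * \<rho> < norm y \<Longrightarrow> h y = 0" for h j
    proof -
      obtain Mh where Mh: "\<And>y. norm (h y) \<le> Mh" using continuous_support_bounded[OF h] by blast
      have h0: "h y = 0" if "2 * \<rho> + 1 \<le> norm y" for y using h(2) that by simp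
      show "integrable lborel (\<lambda>y. rgreen k 0 (x - y) * h y)" "integrable lborel (\<lambda>y. rgreen1 k 0 j (x - y) * h y)"
        using regularized_potential(4)[where h=h and M=Mh and ?R0.0="2 * \<rho> + 1" and k=k and x=x]
          regularized_potential(5)[where h=h and M=Mh and ?R0.0="2 * \<rho> + 1" and k=k and x=x and j=j] Mh h0 k'
          borel_measurable_continuous_onI[OF h(1)] by auto
    qed
    have i1: "integrable lborel (\<lambda>y. rgreen k 0 (x - y) * (pd j ?\<phi> y * pd j v y))" for j
      by (rule ints(1)) (auto intro!: continuous_on_mult cpv cp\<phi> simp: pb0)
    have i2: "integrable lborel (\<lambda>y. rgreen1 k 0 j (x - y) * (pd j ?\<phi> y * v y))" for j
      by (rule ints(2)) (auto intro!: continuous_on_mult cv cp\<phi> simp: pb0)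
    let ?h = "\<lambda>y. \<Sum>j\<in>UNIV. rgreen k 0 (x - y) * (pd j ?\<phi> y * pd j v y) + rgreen1 k 0 j (x - y) * (pd j ?\<phi> y * v y)"
    have ih: "integrable lborel ?h"
      by (intro Bochner_Integration.integrable_sum Bochner_Integration.integrable_add i1 i2)
    have eq: "v x - conv (rgreen k 0) f x = - integral\<^sup>L lborel ?h"
    proof -
      have "integral\<^sup>L lborel ?h = (\<Sum>j\<in>UNIV. conv (rgreen k 0) (\<lambda>y. pd j ?\<phi> y * pd j v y) x
          + conv (rgreen1 k 0 j) (\<lambda>y. pd j ?\<phi> y * v y) x)"
        unfolding conv_def using i1 i2
        by (subst Bochner_Integration.integral_sum) (auto intro!: Bochner_Integration.integrable_add)
      moreover have "?\<phi> x * v x = conv (rgreen k 0) (\<lambda>y. ?\<phi> y * f y) x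
         - (\<Sum>j\<in>UNIV. conv (rgreen k 0) (\<lambda>y. pd j ?\<phi> y * pd j v y) x
              + conv (rgreen1 k 0 j) (\<lambda>y. pd j ?\<phi> y * v y) x)"
      proof (rule cutoff_representation[OF v f(1), where M=M and ?R0.0=R0])
        show "weak_identity v (\<lambda>x. (of_real k)\<^sup>2 * v x + f x) \<psi>"
          if "C1_on UNIV \<psi>" "\<And>x. R < norm x \<Longrightarrow> \<psi> x = 0" for \<psi> R
          by (rule weak[OF that])
      qed (use f k' \<rho> in auto)
      ultimately show ?thesis unfolding bx bf by simp
    qed
    have isv: "integrable lborel (\<lambda>y. ?s y * norm y * (norm (v y))\<^sup>2)"
      by (rule integrable_continuous_support[of _ "2 * \<rho>"])
         (use bump_outside(2)[OF \<rho>] in \<open>auto intro!: continuous_intros bump_continuous cv\<close>)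
    let ?b = "\<lambda>y. (16 * \<eta> / \<rho> ^ 3 + 8 * C / \<rho> ^ 4) * indicator (ball 0 (2 * \<rho>)) y + C / (2 * \<rho>) * (?s y * norm y * (norm (v y))\<^sup>2)"
    have ib: "integrable lborel ?b"
      by (intro Bochner_Integration.integrable_add integrable_indicator_ball integrable_mult_right isv)
    have pt: "norm (?h y) \<le> ?b y" for y
    proof (cases "?s y = 0")
      case True
      then have "?h y = 0" unfolding pd_bump by simp
      then show ?thesis using True \<eta> C \<rho> by (auto simp: indicator_def intro!: add_nonneg_nonneg)
    next
      case False
      then have y: "\<rho> < norm y" "norm y < 2 * \<rho>" using bump_shell(2)[OF \<rho>] by auto
      then have y0: "y \<noteq> 0" and ny: "norm y > 0" using \<rho> by auto
      let ?\<epsilon> = "radial_defect k v y"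
      let ?G = "rgreen k 0 (y - x)"
      define \<kappa> where "\<kappa> = (\<Sum>j\<in>UNIV. ((y /\<^sub>R norm y) $ j) *\<^sub>R rgreen1 k 0 j (y - x)) - \<i> * of_real k * ?G"
      have ff: "norm \<kappa> \<le> C / (norm y)\<^sup>2" "norm ?G \<le> 2 / norm y"
        using far_field_kernel[OF k', of x "norm x" y] big(4) y unfolding \<kappa>_def C_def by auto
      have s0: "?s y \<ge> 0" "?s y \<le> 8 / \<rho>\<^sup>2" by (rule bump_bounds)+
      have ksum: "(\<Sum>j\<in>UNIV. of_real (y $ j) * rgreen1 k 0 j (x - y)) = - of_real (norm y) * (\<i> * of_real k * ?G + \<kappa>)"
      proof -
        have "of_real (norm y) * (\<i> * of_real k * ?G + \<kappa>) = norm y *\<^sub>R (\<Sum>j\<in>UNIV. ((y /\<^sub>R norm y) $ j) *\<^sub>R rgreen1 k 0 j (y - x))"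
          unfolding \<kappa>_def by (simp add: scaleR_conv_of_real)
        also have "\<dots> = (\<Sum>j\<in>UNIV. of_real (y $ j) * rgreen1 k 0 j (y - x))"
          unfolding scaleR_sum_right using ny by (intro sum.cong) (auto simp: scaleR_conv_of_real[symmetric])
        also have "\<dots> = - (\<Sum>j\<in>UNIV. of_real (y $ j) * rgreen1 k 0 j (x - y))"
          unfolding rgreen_reflect(2)[of k 0 _ y x] by (simp add: sum_negf)
        finally show ?thesis by simp
      qed
      have "?h y = - of_real (?s y) * (?G * (\<Sum>j\<in>UNIV. of_real (y $ j) * pd j v y)
          + v y * (\<Sum>j\<in>UNIV. of_real (y $ j) * rgreen1 k 0 j (x - y)))"
        unfolding pd_bump rgreen_reflect(1)[of k 0 y x]
        by (simp add: sum.distrib sum_subtractf sum_distrib_left distrib_left sum_negf mult_ac)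
      also have "\<dots> = - of_real (?s y * norm y) * (?G * ?\<epsilon> - v y * \<kappa>)"
        unfolding radial_sum_pd[OF v y0, of k] ksum by (simp add: algebra_simps)
      finally have h_eq: "?h y = - of_real (?s y * norm y) * (?G * ?\<epsilon> - v y * \<kappa>)" .
      have "norm (?h y) = ?s y * norm y * norm (?G * ?\<epsilon> - v y * \<kappa>)"
        unfolding h_eq norm_mult norm_minus_cancel norm_of_real using s0 by simp
      also have "\<dots> \<le> ?s y * norm y * ((2 / norm y) * (\<eta> / norm y) + norm (v y) * (C / (norm y)\<^sup>2))"
      proof (rule mult_left_mono)
        have "norm (?G * ?\<epsilon> - v y * \<kappa>) \<le> norm ?G * norm ?\<epsilon> + norm (v y) * norm \<kappa>"
          by (rule order.trans[OF norm_triangle_ineq4]) (simp add: norm_mult)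
        also have "\<dots> \<le> (2 / norm y) * (\<eta> / norm y) + norm (v y) * (C / (norm y)\<^sup>2)"
          using ff def\<eta>[of y] y ny by (intro add_mono mult_mono) auto
        finally show "norm (?G * ?\<epsilon> - v y * \<kappa>) \<le> (2 / norm y) * (\<eta> / norm y) + norm (v y) * (C / (norm y)\<^sup>2)" .
      qed (use s0 in auto)
      also have "\<dots> = ?s y * (1 / norm y) * (2 * \<eta>) + C * (1 / (norm y)\<^sup>2) * (?s y * norm y * norm (v y))"
        using ny by (simp add: field_simps power2_eq_square)
      also have "\<dots> \<le> 8 / \<rho>\<^sup>2 * (1 / \<rho>) * (2 * \<eta>) + C * (1 / \<rho>\<^sup>2) * (?s y * norm y * norm (v y))"
      proof (rule add_mono)
        show "?s y * (1 / norm y) * (2 * \<eta>) \<le> 8 / \<rho>\<^sup>2 * (1 / \<rho>) * (2 * \<eta>)"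
          using y \<rho> \<eta> s0 by (intro mult_right_mono mult_mono divide_left_mono mult_pos_pos) auto
        show "C * (1 / (norm y)\<^sup>2) * (?s y * norm y * norm (v y)) \<le> C * (1 / \<rho>\<^sup>2) * (?s y * norm y * norm (v y))"
          using y \<rho> C s0 ny by (intro mult_right_mono mult_left_mono divide_left_mono power_mono mult_pos_pos) auto
      qed
      also have "C * (1 / \<rho>\<^sup>2) * (?s y * norm y * norm (v y)) \<le>
          C * (1 / \<rho>\<^sup>2) * (?s y * norm y * (\<rho> / 2 * (norm (v y))\<^sup>2 + 1 / (2 * \<rho>)))"
      proof (intro mult_left_mono)
        (* The weight rho balances the energy, which is bounded, against the volume of
           the shell. *)
        show "norm (v y) \<le> \<rho> / 2 * (norm (v y))\<^sup>2 + 1 / (2 * \<rho>)"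
          using mult_le_weighted_squares[OF \<rho>, of 1 "norm (v y)"] by simp
      qed (use s0 C in auto)
      also have "\<dots> = C / (2 * \<rho>) * (?s y * norm y * (norm (v y))\<^sup>2) + C / (2 * \<rho> ^ 3) * (?s y * norm y)"
        using \<rho> by (simp add: field_simps power2_eq_square power3_eq_cube)
      also have "C / (2 * \<rho> ^ 3) * (?s y * norm y) \<le> C / (2 * \<rho> ^ 3) * (16 / \<rho>)"
        using bump_shell(1)[OF \<rho>, of y] y C \<rho> by (intro mult_left_mono) auto
      finally have "norm (?h y) \<le> 8 / \<rho>\<^sup>2 * (1 / \<rho>) * (2 * \<eta>) +
         (C / (2 * \<rho>) * (?s y * norm y * (norm (v y))\<^sup>2) + C / (2 * \<rho> ^ 3) * (16 / \<rho>))" by linarith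
      also have "\<dots> = ?b y"
        using y \<rho> by (simp add: field_simps power2_eq_square eval_nat_numeral)
      finally show ?thesis .
    qed
    have "norm (v x - conv (rgreen k 0) f x) = norm (integral\<^sup>L lborel ?h)" unfolding eq by (rule norm_minus_cancel)
    also have "\<dots> \<le> integral\<^sup>L lborel ?b"
      by (rule Bochner_Integration.integral_norm_bound_integral[OF ih ib]) (rule pt)
    also have "\<dots> = (16 * \<eta> / \<rho> ^ 3 + 8 * C / \<rho> ^ 4) * (\<beta> * (2 * \<rho>) ^ 3) + C / (2 * \<rho>) * (LINT y|lborel. ?s y * norm y * (norm (v y))\<^sup>2)"
      unfolding Bochner_Integration.integral_add[OF integrable_indicator_ball integrable_mult_right[OF isv]]
      unfolding integral_mult_right_zero \<beta>_def using ball_volume[of "2 * \<rho>"] \<rho> by simp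
    also have "\<dots> \<le> (16 * \<eta> / \<rho> ^ 3 + 8 * C / \<rho> ^ 4) * (\<beta> * (2 * \<rho>) ^ 3) + C / (2 * \<rho>) * Ce"
      using E(2)[OF big(2)] C \<rho> by (intro add_left_mono mult_left_mono) auto
    also have "\<dots> = 128 * \<beta> * \<eta> + C * (Ce / 2 + 64 * \<beta>) / \<rho>"
      using \<rho> by (simp add: field_simps eval_nat_numeral)
    finally show ?thesis .
  qed
  have "norm (v x - conv (rgreen k 0) f x) \<le> r" if r: "r > 0" for r
  proof -
    (* First eta is chosen for the radiation condition, then rho for the remaining 1 /
       rho term. *)
    define \<eta> where "\<eta> = r / (2 * (128 * \<beta> + 1))"
    have \<eta>: "\<eta> > 0" "128 * \<beta> * \<eta> \<le> r / 2" unfolding \<eta>_def using r \<beta> by (auto simp: field_simps)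
    obtain \<rho>1 where \<rho>1: "\<rho>1 > 0" "\<And>y. norm y \<ge> \<rho>1 \<Longrightarrow> norm (radial_defect k v y) \<le> \<eta> / norm y"
      using radiating_defect[OF rad \<eta>(1)] by blast
    define D where "D = \<bar>C * (Ce / 2 + 64 * \<beta>)\<bar>"
    define \<rho> where "\<rho> = Max {\<rho>1, \<rho>e, R0, 2 * norm x + 1, 2 * D / r}"
    have \<rho>: "\<rho> \<ge> \<rho>1" "\<rho> \<ge> \<rho>e" "\<rho> \<ge> R0" "\<rho> \<ge> 2 * norm x + 1" "\<rho> \<ge> 2 * D / r"
      unfolding \<rho>_def by (auto intro: Max_ge)
    then have \<rho>0: "\<rho> > 0" using \<rho>1(1) by linarith
    have "norm (v x - conv (rgreen k 0) f x) \<le> 128 * \<beta> * \<eta> + C * (Ce / 2 + 64 * \<beta>) / \<rho>"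
      by (rule bound[OF \<eta>(1) _ \<rho>0 \<rho>(2-4)]) (use \<rho>1(2) \<rho>(1) in auto)
    also have "C * (Ce / 2 + 64 * \<beta>) / \<rho> \<le> D / \<rho>"
      unfolding D_def using \<rho>0 by (intro divide_right_mono) auto
    also have "D / \<rho> \<le> r / 2"
      using \<rho>(5) \<rho>0 r by (simp add: field_simps)
    finally show ?thesis using \<eta>(2) by linarith
  qed
  then have "norm (v x - conv (rgreen k 0) f x) \<le> 0" by (rule dense_ge)
  then show ?thesis by simp
qed

section \<open>The piecewise Hoelder scatterer\<close>

locale scatterer =
  fixes a b :: "real^3" and n :: nat and \<alpha> k0 :: real
    and kI :: "nat^3 \<Rightarrow> real^3 \<Rightarrow> complex" and k :: "real^3 \<Rightarrow> complex"
  assumes ab: "\<And>j. a $ j < b $ j" and n: "n \<ge> 1" and \<alpha>: "0 < \<alpha>" "\<alpha> \<le> 1"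
    and hol: "\<And>I. I \<in> grid_index n \<Longrightarrow> holder_on \<alpha> (cell a b n I) (kI I)"
    and k: "\<And>x. x \<in> box a b \<Longrightarrow>
           k x = (\<Sum>I\<in>grid_index n. kI I x * of_real (indicator (cell a b n I) x))"
    and k0: "k0 > 0"
begin

abbreviation "gp \<equiv> grid_point a b n"

lemma step_pos: "(b $ j - a $ j) / real n > 0"
  using ab[of j] n by simp

lemma gp_mono: "i \<le> i' \<Longrightarrow> gp j i \<le> gp j i'"
  unfolding grid_point_def using step_pos[of j] by (intro add_left_mono mult_left_mono) auto

lemma gp_0: "gp j 0 = a $ j" and gp_n: "gp j n = b $ j"
  unfolding grid_point_def using n by auto

lemma cell_eq_box: "cell a b n I = box (\<chi> j. gp j (I $ j)) (\<chi> j. gp j (I $ j + 1))"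
  unfolding cell_def by (auto simp: mem_box_cart)

lemma open_cell: "open (cell a b n I)"
  unfolding cell_eq_box by (rule open_box)

lemma cell_measurable [measurable]: "cell a b n I \<in> sets borel"
  using open_cell by (rule borel_open)

lemma box_measurable [measurable]: "box a b \<in> sets borel"
  by simp

lemma cell_subset_box: "I \<in> grid_index n \<Longrightarrow> cell a b n I \<subseteq> box a b"
proof
  fix x assume I: "I \<in> grid_index n" and x: "x \<in> cell a b n I"
  have "a $ j < x $ j \<and> x $ j < b $ j" for j
  proof -
    have "I $ j + 1 \<le> n" using I unfolding grid_index_def by (simp add: Suc_le_eq)
    then have "gp j 0 \<le> gp j (I $ j)" "gp j (I $ j + 1) \<le> gp j n" by (auto intro: gp_mono)
    then show ?thesis using x unfolding cell_def gp_0 gp_n by (auto intro: le_less_trans less_le_trans)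
  qed
  then show "x \<in> box a b" by (simp add: mem_box_cart)
qed

lemma cells_disjoint:
  assumes "x \<in> cell a b n I" "x \<in> cell a b n J"
  shows "I = J"
proof -
  have "\<not> I' $ j < J' $ j" if "x \<in> cell a b n I'" "x \<in> cell a b n J'" for I' J' j
  proof
    assume "I' $ j < J' $ j"
    then have "gp j (I' $ j + 1) \<le> gp j (J' $ j)" by (intro gp_mono) simp
    moreover have "x $ j < gp j (I' $ j + 1)" "gp j (J' $ j) < x $ j" using that unfolding cell_def by auto
    ultimately show False by linarith
  qed
  from this[OF assms] this[OF assms(2,1)] have "I $ j = J $ j" for j by (meson linorder_neqE_nat)
  then show ?thesis by (simp add: vec_eq_iff)
qed

lemma finite_grid_index: "finite (grid_index n)"
proof -
  have "grid_index n \<subseteq> (\<lambda>f. \<chi> j. f j) ` (Pi\<^sub>E (UNIV :: 3 set) (\<lambda>_. {..<n}))"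
  proof
    fix I assume "I \<in> grid_index n"
    then have "($) I \<in> Pi\<^sub>E UNIV (\<lambda>_. {..<n})" unfolding grid_index_def by auto
    moreover have "I = (\<chi> j. I $ j)" by simp
    ultimately show "I \<in> (\<lambda>f. \<chi> j. f j) ` (Pi\<^sub>E (UNIV :: 3 set) (\<lambda>_. {..<n}))" by blast
  qed
  then show ?thesis by (rule finite_subset) (auto intro!: finite_imageI finite_PiE)
qed

lemma k_cell:
  assumes "I \<in> grid_index n" "x \<in> cell a b n I" shows "k x = kI I x"
proof -
  have "k x = (\<Sum>J\<in>grid_index n. kI J x * of_real (indicator (cell a b n J) x))"
    using k cell_subset_box assms by blast
  also have "\<dots> = (\<Sum>J\<in>grid_index n. if J = I then kI I x else 0)"
    by (rule sum.cong) (use assms cells_disjoint in \<open>auto simp: indicator_def\<close>)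
  finally show ?thesis using assms finite_grid_index by simp
qed

lemma closure_box: "closure (box a b) = cbox a b"
proof -
  have "box a b \<noteq> {}"
    unfolding box_ne_empty Basis_vec_def using ab by (auto simp: inner_axis)
  then show ?thesis by (rule closure_box)
qed

lemma closure_cell_subset: "I \<in> grid_index n \<Longrightarrow> closure (cell a b n I) \<subseteq> closure (box a b)"
  by (rule closure_mono) (rule cell_subset_box)

lemma off_planes_cases:
  assumes off: "\<And>j i. i \<le> n \<Longrightarrow> x $ j \<noteq> gp j i"
  obtains "x \<in> - closure (box a b)" | I where "I \<in> grid_index n" "x \<in> cell a b n I"
proof (cases "x \<in> cbox a b")
  case True
  have "\<exists>i<n. gp j i < x $ j \<and> x $ j < gp j (i + 1)" for j
  proof -
    let ?P = "\<lambda>i. x $ j < gp j i"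
    have "x $ j \<le> gp j n" "gp j 0 \<le> x $ j" using True unfolding gp_0 gp_n by (auto simp: mem_box_cart)
    then have P: "?P n" "\<not> ?P 0" using off[of n j] off[of 0 j] by auto
    define m where "m = (LEAST i. ?P i)"
    have m: "?P m" "m \<le> n" unfolding m_def using P(1) by (auto intro: LeastI Least_le)
    have "m \<noteq> 0" using m P(2) by (metis)
    then obtain i where i: "m = Suc i" by (cases m) auto
    have "\<not> ?P i" using not_less_Least[of i ?P] i unfolding m_def by simp
    then have "gp j i < x $ j" using off[of i j] m i by force
    then show ?thesis using m i by (intro exI[of _ i]) auto
  qed
  then obtain I where I: "\<And>j. I j < n" "\<And>j. gp j (I j) < x $ j" "\<And>j. x $ j < gp j (I j + 1)" by metis
  show ?thesis
  proof (rule that(2)[of "\<chi> j. I j"])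
    show "(\<chi> j. I j) \<in> grid_index n" unfolding grid_index_def using I by simp
    show "x \<in> cell a b n (\<chi> j. I j)" unfolding cell_def using I by simp
  qed
next
  case False
  then show ?thesis using that(1) unfolding closure_box by blast
qed

text \<open>The coefficient \<open>k\<^sup>2 - k0\<^sup>2\<close>, extended by zero. It
  is written in terms of the functions \<open>kI\<close>, because \<open>k\<close> is
  arbitrary outside the box and the sum is visibly Borel measurable.\<close>

definition contrast :: "real^3 \<Rightarrow> complex" where
  "contrast y = indicator (box a b) y *\<^sub>R
     ((\<Sum>I\<in>grid_index n. indicator (cell a b n I) y *\<^sub>R kI I y)\<^sup>2 - (of_real k0)\<^sup>2)"

lemma contrast_eq: "y \<in> box a b \<Longrightarrow> contrast y = (k y)\<^sup>2 - (of_real k0)\<^sup>2"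
  unfolding contrast_def using k by (simp add: scaleR_conv_of_real mult.commute)

lemma contrast_outside: "y \<notin> box a b \<Longrightarrow> contrast y = 0"
  unfolding contrast_def by simp

lemma contrast_cell: "I \<in> grid_index n \<Longrightarrow> y \<in> cell a b n I \<Longrightarrow> contrast y = (kI I y)\<^sup>2 - (of_real k0)\<^sup>2"
  using contrast_eq k_cell cell_subset_box by fastforce

lemma kI_holder:
  assumes "I \<in> grid_index n"
  obtains C where "C \<ge> 0" "\<And>x y. x \<in> cell a b n I \<Longrightarrow> y \<in> cell a b n I \<Longrightarrow>
    norm (kI I x - kI I y) \<le> C * norm (x - y) powr \<alpha>"
proof -
  obtain C where C: "\<And>x y. x \<in> cell a b n I \<Longrightarrow> y \<in> cell a b n I \<Longrightarrow>
    dist (kI I x) (kI I y) \<le> C * dist x y powr \<alpha>"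
    using hol[OF assms] unfolding holder_on_def by blast
  show ?thesis
  proof (rule that[of "\<bar>C\<bar>"])
    fix x y assume "x \<in> cell a b n I" "y \<in> cell a b n I"
    from C[OF this] have "norm (kI I x - kI I y) \<le> C * norm (x - y) powr \<alpha>" by (simp add: dist_norm)
    also have "\<dots> \<le> \<bar>C\<bar> * norm (x - y) powr \<alpha>" by (intro mult_right_mono) auto
    finally show "norm (kI I x - kI I y) \<le> \<bar>C\<bar> * norm (x - y) powr \<alpha>" .
  qed simp
qed

lemma kI_continuous:
  assumes "I \<in> grid_index n" shows "continuous_on (cell a b n I) (kI I)"
proof -
  obtain C where C: "C \<ge> 0" "\<And>x y. x \<in> cell a b n I \<Longrightarrow> y \<in> cell a b n I \<Longrightarrow>
    norm (kI I x - kI I y) \<le> C * norm (x - y) powr \<alpha>" using kI_holder[OF assms] by blast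
  show ?thesis unfolding continuous_on_def
  proof
    fix x assume x: "x \<in> cell a b n I"
    have "\<forall>\<^sub>F y in at x within cell a b n I. norm (kI I y - kI I x) \<le> C * norm (y - x) powr \<alpha>"
      unfolding eventually_at_filter using C(2)[OF _ x] by (intro always_eventually) blast
    from tendsto_of_holder[OF this \<alpha>(1)] show "(kI I \<longlongrightarrow> kI I x) (at x within cell a b n I)" .
  qed
qed

lemma kI_bounded:
  assumes "I \<in> grid_index n"
  obtains B where "B \<ge> 0" "\<And>x. x \<in> cell a b n I \<Longrightarrow> norm (kI I x) \<le> B"
proof (cases "cell a b n I = {}")
  case False
  then obtain z where z: "z \<in> cell a b n I" by blast
  obtain C where C: "C \<ge> 0" "\<And>x y. x \<in> cell a b n I \<Longrightarrow> y \<in> cell a b n I \<Longrightarrow>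
    norm (kI I x - kI I y) \<le> C * norm (x - y) powr \<alpha>" using kI_holder[OF assms] by blast
  have "bounded (cell a b n I)" unfolding cell_eq_box by (rule bounded_box)
  then obtain D where D: "\<And>x y. x \<in> cell a b n I \<Longrightarrow> y \<in> cell a b n I \<Longrightarrow> norm (x - y) \<le> D"
    using bounded_two_points[of "cell a b n I"] by (auto simp: dist_norm)
  show ?thesis
  proof (rule that[of "norm (kI I z) + C * D powr \<alpha>"])
    show "0 \<le> norm (kI I z) + C * D powr \<alpha>" using C by simp
    fix x assume x: "x \<in> cell a b n I"
    have "norm (kI I x) \<le> norm (kI I z) + norm (kI I x - kI I z)" using norm_triangle_sub by blast
    also have "norm (kI I x - kI I z) \<le> C * norm (x - z) powr \<alpha>" by (rule C(2)[OF x z])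
    also have "\<dots> \<le> C * D powr \<alpha>" using D[OF x z] C \<alpha> by (intro mult_left_mono powr_mono2) auto
    finally show "norm (kI I x) \<le> norm (kI I z) + C * D powr \<alpha>" by simp
  qed
qed (use that[of 0] in auto)

lemma contrast_measurable [measurable]: "contrast \<in> borel_measurable borel"
proof -
  have "(\<lambda>y. indicator (cell a b n I) y *\<^sub>R kI I y) \<in> borel_measurable borel" if "I \<in> grid_index n" for I
    by (rule borel_measurable_continuous_on_indicator[OF _ kI_continuous[OF that]]) measurable
  then have [measurable]: "(\<lambda>y. \<Sum>I\<in>grid_index n. indicator (cell a b n I) y *\<^sub>R kI I y) \<in> borel_measurable borel"
    by (rule borel_measurable_sum)
  have "contrast = (\<lambda>y. indicator (box a b) y *\<^sub>R
     ((\<Sum>I\<in>grid_index n. indicator (cell a b n I) y *\<^sub>R kI I y)\<^sup>2 - (of_real k0)\<^sup>2))"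
    unfolding contrast_def by simp
  also have "\<dots> \<in> borel_measurable borel"
    by (intro borel_measurable_scaleR borel_measurable_indicator borel_measurable_diff
        borel_measurable_power borel_measurable_const \<open>(\<lambda>y. \<Sum>I\<in>grid_index n. indicator (cell a b n I) y *\<^sub>R kI I y) \<in> borel_measurable borel\<close>) simp
  finally show ?thesis .
qed

lemma contrast_bounded: obtains B where "\<And>y. norm (contrast y) \<le> B"
proof -
  obtain B where B: "\<And>I. I \<in> grid_index n \<Longrightarrow> B I \<ge> 0"
    "\<And>I x. I \<in> grid_index n \<Longrightarrow> x \<in> cell a b n I \<Longrightarrow> norm (kI I x) \<le> B I"
  proof -
    have "\<exists>B. B \<ge> 0 \<and> (\<forall>x\<in>cell a b n I. norm (kI I x) \<le> B)" if "I \<in> grid_index n" for I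
      by (rule kI_bounded[OF that]) blast
    then have "\<exists>B. \<forall>I\<in>grid_index n. B I \<ge> 0 \<and> (\<forall>x\<in>cell a b n I. norm (kI I x) \<le> B I)"
      by (intro bchoice) blast
    then show ?thesis using that by blast
  qed
  define S where "S = (\<Sum>I\<in>grid_index n. B I)"
  have S: "norm (\<Sum>I\<in>grid_index n. indicator (cell a b n I) y *\<^sub>R kI I y) \<le> S" for y
    unfolding S_def by (rule sum_norm_le) (use B in \<open>auto simp: indicator_def\<close>)
  have "norm (contrast y) \<le> S\<^sup>2 + k0\<^sup>2" for y
  proof -
    have "norm (contrast y) \<le> norm ((\<Sum>I\<in>grid_index n. indicator (cell a b n I) y *\<^sub>R kI I y)\<^sup>2 - (of_real k0)\<^sup>2)"
      unfolding contrast_def by (simp add: indicator_def)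
    also have "\<dots> \<le> (norm (\<Sum>I\<in>grid_index n. indicator (cell a b n I) y *\<^sub>R kI I y))\<^sup>2 + k0\<^sup>2"
      by (rule order.trans[OF norm_triangle_ineq4]) (simp add: norm_power)
    also have "\<dots> \<le> S\<^sup>2 + k0\<^sup>2" by (intro add_right_mono power_mono S) auto
    finally show ?thesis .
  qed
  then show ?thesis by (rule that)
qed

definition box_radius :: real where "box_radius = (SOME r. r > 0 \<and> (\<forall>y\<in>cbox a b. norm y < r))"

lemma box_radius: "box_radius > 0" "y \<in> cbox a b \<Longrightarrow> norm y < box_radius"
proof -
  obtain r where "r > 0" "\<forall>y\<in>cbox a b. norm y \<le> r"
    using bounded_cbox[of a b] unfolding bounded_pos by auto
  then have "\<exists>r. r > 0 \<and> (\<forall>y\<in>cbox a b. norm y < r)"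
    by (intro exI[of _ "r + 1"]) force
  from someI_ex[OF this] show "box_radius > 0" "y \<in> cbox a b \<Longrightarrow> norm y < box_radius" unfolding box_radius_def by auto
qed

lemma contrast_far: "box_radius \<le> norm y \<Longrightarrow> contrast y = 0"
  using box_radius(2)[of y] box_subset_cbox[of a b] contrast_outside[of y] by fastforce

text \<open>A solution of the integral equation is only Lebesgue measurable; replacing
  it by a Borel function \<open>g\<close> that agrees with it almost everywhere does not
  change the potential.\<close>

lemma volume_potential_eq_conv:
  assumes g [measurable]: "g \<in> borel_measurable borel"
    and u: "(\<lambda>y. indicator (box a b) y *\<^sub>R u y) \<in> borel_measurable lebesgue"
    and eq: "AE y in lebesgue. y \<in> box a b \<longrightarrow> u y = g y"
  shows "volume_potential (box a b) k k0 u x = conv (rgreen k0 0) (\<lambda>y. contrast y * g y) x"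
proof -
  have borel_leb: "h \<in> borel_measurable lebesgue" if "h \<in> borel_measurable borel" for h :: "real^3 \<Rightarrow> complex"
    using that by (intro measurable_completion) simp
  have eq1: "indicator (box a b) y *\<^sub>R (((k y)\<^sup>2 - (of_real k0)\<^sup>2) * green k0 x y * u y) =
      (contrast y * rgreen k0 0 (x - y)) * (indicator (box a b) y *\<^sub>R u y)" for y
    using contrast_eq[of y] green_eq_rgreen by (auto simp: indicator_def)
  have "volume_potential (box a b) k k0 u x = (LINT y|lebesgue. (contrast y * rgreen k0 0 (x - y)) * (indicator (box a b) y *\<^sub>R u y))"
    unfolding volume_potential_def set_lebesgue_integral_def eq1 ..
  also have "\<dots> = (LINT y|lebesgue. rgreen k0 0 (x - y) * (contrast y * g y))"
  proof (rule integral_cong_AE)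
    show "(\<lambda>y. (contrast y * rgreen k0 0 (x - y)) * (indicator (box a b) y *\<^sub>R u y)) \<in> borel_measurable lebesgue"
      by (intro borel_measurable_times u borel_leb[of "\<lambda>y. contrast y"] borel_leb[of "\<lambda>y. rgreen k0 0 (x - y)"]) measurable
    show "(\<lambda>y. rgreen k0 0 (x - y) * (contrast y * g y)) \<in> borel_measurable lebesgue"
      by (rule borel_leb) measurable
    show "AE y in lebesgue. (contrast y * rgreen k0 0 (x - y)) * (indicator (box a b) y *\<^sub>R u y) = rgreen k0 0 (x - y) * (contrast y * g y)"
      using eq by eventually_elim (auto simp: contrast_outside indicator_def)
  qed
  also have "\<dots> = conv (rgreen k0 0) (\<lambda>y. contrast y * g y) x"
    unfolding conv_def by (rule integral_completion) measurable
  finally show ?thesis .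
qed

end

section \<open>From the integral equation to the boundary value problem\<close>

context scatterer
begin

text \<open>A product of bounded Hoelder functions. Lipschitz continuity of
  \<open>U\<close> gives the exponent \<open>\<alpha> \<le> 1\<close> on a ball, at the
  cost of the factor \<open>(2 * r) powr (1 - \<alpha>)\<close>.\<close>

lemma contrast_field_holder:
  assumes I: "I \<in> grid_index n" and r: "cball c r \<subseteq> cell a b n I"
    and S: "open S" "C1_on S U" "cell a b n I \<subseteq> S"
    and MU: "\<And>y. y \<in> cell a b n I \<Longrightarrow> norm (U y) \<le> MU"
  obtains H where "\<And>x y. x \<in> ball c r \<Longrightarrow> y \<in> ball c r \<Longrightarrow>
    norm (contrast x * U x - contrast y * U y) \<le> H * norm (x - y) powr \<alpha>"
proof -
  obtain L where L: "L \<ge> 0" "\<And>x y. x \<in> ball c r \<Longrightarrow> y \<in> ball c r \<Longrightarrow> norm (U x - U y) \<le> L * norm (x - y)"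
    using C1_on_lipschitz_ball[OF S(1,2), of c r] r S(3) by blast
  obtain C where C: "C \<ge> 0" "\<And>x y. x \<in> cell a b n I \<Longrightarrow> y \<in> cell a b n I \<Longrightarrow>
    norm (kI I x - kI I y) \<le> C * norm (x - y) powr \<alpha>" using kI_holder[OF I] by blast
  obtain K where K: "K \<ge> 0" "\<And>x. x \<in> cell a b n I \<Longrightarrow> norm (kI I x) \<le> K" using kI_bounded[OF I] by blast
  define H where "H = (K\<^sup>2 + k0\<^sup>2) * (L * (2 * r) powr (1 - \<alpha>)) + C * (2 * K) * MU"
  show ?thesis
  proof (rule that[of H])
    fix x y assume x: "x \<in> ball c r" and y: "y \<in> ball c r"
    then have xc: "x \<in> cell a b n I" and yc: "y \<in> cell a b n I" using r by auto
    let ?d = "norm (x - y)"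
    have d: "?d \<le> 2 * r" using x y dist_triangle_half_r dist_triangle3[of x y c] by (simp add: dist_norm)
    have d1: "?d \<le> (2 * r) powr (1 - \<alpha>) * ?d powr \<alpha>"
    proof (cases "?d = 0")
      case False
      then have "?d = ?d powr (1 - \<alpha>) * ?d powr \<alpha>" by (simp add: powr_add[symmetric])
      also have "\<dots> \<le> (2 * r) powr (1 - \<alpha>) * ?d powr \<alpha>"
        using d \<alpha> by (intro mult_right_mono powr_mono2) auto
      finally show ?thesis .
    qed simp
    have kk: "norm ((kI I x)\<^sup>2 - (of_real k0)\<^sup>2) \<le> K\<^sup>2 + k0\<^sup>2"
    proof -
      have "norm ((kI I x)\<^sup>2 - (of_real k0)\<^sup>2) \<le> (norm (kI I x))\<^sup>2 + k0\<^sup>2"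
        by (rule order.trans[OF norm_triangle_ineq4]) (simp add: norm_power)
      also have "\<dots> \<le> K\<^sup>2 + k0\<^sup>2" by (intro add_right_mono power_mono K(2) xc) auto
      finally show ?thesis .
    qed
    have ks: "norm (kI I x + kI I y) \<le> 2 * K"
      using norm_triangle_ineq[of "kI I x" "kI I y"] K(2)[OF xc] K(2)[OF yc] by linarith
    have "contrast x * U x - contrast y * U y = ((kI I x)\<^sup>2 - (of_real k0)\<^sup>2) * (U x - U y)
        + (kI I x - kI I y) * (kI I x + kI I y) * U y"
      unfolding contrast_cell[OF I xc] contrast_cell[OF I yc] by (simp add: algebra_simps power2_eq_square)
    also have "norm \<dots> \<le> (K\<^sup>2 + k0\<^sup>2) * (L * ?d) + (C * ?d powr \<alpha>) * (2 * K) * MU"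
      using L K C kk ks MU[OF yc] x y xc yc
      by (intro order.trans[OF norm_triangle_ineq] add_mono; unfold norm_mult)
         (intro mult_mono mult_nonneg_nonneg; auto)+
    also have "\<dots> \<le> (K\<^sup>2 + k0\<^sup>2) * (L * ((2 * r) powr (1 - \<alpha>) * ?d powr \<alpha>)) + (C * ?d powr \<alpha>) * (2 * K) * MU"
      using d1 L by (intro add_right_mono mult_left_mono) auto
    also have "\<dots> = H * ?d powr \<alpha>" unfolding H_def by (simp add: algebra_simps)
    finally show "norm (contrast x * U x - contrast y * U y) \<le> H * ?d powr \<alpha>" .
  qed
qed

text \<open>Regularity is gained in steps: continuity of the potential makes the density
  bounded, then the potential and with it \<open>U\<close> are \<open>C\<^sup>1\<close>,
  then the density is Hoelder in every cell, and finally the potential is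
  \<open>C\<^sup>2\<close> there. In the exterior the density vanishes, and the same
  lemma \<open>potential_C2\<close> applies. The transmission conditions hold because
  \<open>U\<close> is \<open>C\<^sup>1\<close> across the faces.\<close>

lemma quasiclassical_of_representation:
  fixes U :: "real^3 \<Rightarrow> complex"
  defines "V \<equiv> conv (rgreen k0 0) (\<lambda>y. contrast y * U y)"
  assumes x0: "x0 \<notin> closure (box a b)" and U: "\<And>x. U x = incident k0 x0 x + V x"
    and cV: "continuous_on UNIV V"
  shows "quasiclassical a b n kI k0 x0 U"
proof -
  define f where "f = (\<lambda>y. contrast y * U y)"
  have V: "V = conv (rgreen k0 0) f" unfolding V_def f_def ..
  have U_eq: "U = (\<lambda>x. incident k0 x0 x + V x)" using U by (rule ext)
  let ?S = "- {x0}"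
  have oS: "open ?S" by auto
  have cbS: "cbox a b \<subseteq> ?S" using x0 unfolding closure_box by auto
  have iC1: "C1_on ?S (incident k0 x0)" using incident_C2(1) unfolding C2_on_def by blast
  have cU: "continuous_on ?S U"
    unfolding U_eq by (intro continuous_on_add C1_on_continuous[OF iC1] continuous_on_subset[OF cV]) auto
  have "bounded (U ` cbox a b)"
    by (intro compact_imp_bounded compact_continuous_image continuous_on_subset[OF cU cbS] compact_cbox)
  then obtain MU where MU: "\<And>y. y \<in> cbox a b \<Longrightarrow> norm (U y) \<le> MU" unfolding bounded_iff by blast
  have [measurable]: "V \<in> borel_measurable borel" by (rule borel_measurable_continuous_onI[OF cV])
  have [measurable]: "U \<in> borel_measurable borel" unfolding U_eq by measurable
  obtain B where B: "\<And>y. norm (contrast y) \<le> B" using contrast_bounded by blast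
  have fm: "f \<in> borel_measurable borel" unfolding f_def by measurable
  have fb: "norm (f y) \<le> \<bar>B\<bar> * \<bar>MU\<bar>" for y
  proof (cases "y \<in> box a b")
    case True
    then have "y \<in> cbox a b" using box_subset_cbox by blast
    then show ?thesis unfolding f_def norm_mult using B[of y] MU[of y] by (intro mult_mono) auto
  qed (simp add: f_def contrast_outside)
  have f0: "f y = 0" if "box_radius \<le> norm y" for y unfolding f_def using contrast_far[OF that] by simp
  have k0': "k0 \<ge> 0" using k0 by simp
  note pot = potential_C1[OF fm fb f0 k0']
  have VC1: "C1_on UNIV V" unfolding V by (rule C1_onI[OF pot(1)]) (use pot(2) in auto)
  have UC1: "C1_on ?S U" unfolding U_eq by (intro C1_on_add iC1 C1_on_subset[OF VC1]) auto
  have loc: "\<exists>T. open T \<and> c \<in> T \<and> C2_on T V \<and> laplacian V c = - (of_real k0)\<^sup>2 * V c - f c"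
    if r: "r > 0" and H: "\<And>x y. x \<in> ball c r \<Longrightarrow> y \<in> ball c r \<Longrightarrow> norm (f x - f y) \<le> H * norm (x - y) powr \<alpha>"
    for c r H
  proof -
    have \<rho>: "r / 4 > 0" using r by simp
    have H': "norm (f x - f y) \<le> H * norm (x - y) powr \<alpha>"
      if "x \<in> ball c (4 * (r / 4))" "y \<in> ball c (4 * (r / 4))" for x y
      using H that by simp
    note p = potential_C2[OF fm fb f0 k0' \<rho> \<alpha>(1) H', folded V]
    show ?thesis
      by (rule exI[of _ "ball c (2 * (r / 4))"]) (use p(1) p(2)[where x=c] r in simp)
  qed
  have ext: "\<exists>T. open T \<and> c \<in> T \<and> C2_on T V \<and> laplacian V c = - (of_real k0)\<^sup>2 * V c - f c" and f_ext: "f c = 0"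
    if c: "c \<in> - closure (box a b)" for c
  proof -
    have z: "f x = 0" if "x \<in> - closure (box a b)" for x
      unfolding f_def using that contrast_outside[of x] closure_subset[of "box a b"] by auto
    show "f c = 0" by (rule z[OF c])
    obtain r where r: "r > 0" "ball c r \<subseteq> - closure (box a b)"
      using c openE[of "- closure (box a b)" c] by auto
    show "\<exists>T. open T \<and> c \<in> T \<and> C2_on T V \<and> laplacian V c = - (of_real k0)\<^sup>2 * V c - f c"
    proof (rule loc[OF r(1), where c=c and H=0])
      fix x y assume "x \<in> ball c r" "y \<in> ball c r"
      then have "f x = 0" "f y = 0" using z r(2) by blast+
      then show "norm (f x - f y) \<le> 0 * norm (x - y) powr \<alpha>" by simp
    qed
  qed
  have cellT: "\<exists>T. open T \<and> c \<in> T \<and> C2_on T V \<and> laplacian V c = - (of_real k0)\<^sup>2 * V c - f c"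
    if I: "I \<in> grid_index n" and c: "c \<in> cell a b n I" for c I
  proof -
    obtain r where r: "r > 0" "cball c r \<subseteq> cell a b n I"
      using open_contains_cball[of "cell a b n I"] open_cell c by blast
    have sub: "cell a b n I \<subseteq> ?S" "cell a b n I \<subseteq> cbox a b"
      using cell_subset_box[OF I] box_subset_cbox[of a b] cbS by auto
    obtain H where "\<And>x y. x \<in> ball c r \<Longrightarrow> y \<in> ball c r \<Longrightarrow>
      norm (contrast x * U x - contrast y * U y) \<le> H * norm (x - y) powr \<alpha>"
      using contrast_field_holder[OF I r(2) oS UC1 sub(1), of MU] MU sub(2) by blast
    then show ?thesis by (intro loc[OF r(1), where c=c and H=H]) (auto simp: f_def)
  qed
  have VC2_ext: "C2_on (- closure (box a b)) V" by (rule C2_on_local) (use ext in blast)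
  have VC2_cell: "C2_on (cell a b n I) V" if "I \<in> grid_index n" for I
    by (rule C2_on_local) (use cellT[OF that] in blast)
  have o_ext: "open (- closure (box a b))" by auto
  have UC2_cell: "C2_on (cell a b n I) U" if I: "I \<in> grid_index n" for I
  proof -
    have "cell a b n I \<subseteq> ?S" using cell_subset_box[OF I] box_subset_cbox[of a b] cbS by auto
    then show ?thesis unfolding U_eq
      by (intro C2_on_add open_cell VC2_cell I C2_on_subset[OF incident_C2(1)])
  qed
  have UC2_ext: "C2_on (- (closure (box a b) \<union> {x0})) U"
    unfolding U_eq
    by (intro C2_on_add C2_on_subset[OF VC2_ext] C2_on_subset[OF incident_C2(1)]) auto
  have helm_cell: "helmholtz_on (kI I) (cell a b n I) U" if I: "I \<in> grid_index n" for I
    unfolding helmholtz_on_def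
  proof (intro conjI ballI UC2_cell I)
    fix x assume x: "x \<in> cell a b n I"
    have sub: "cell a b n I \<subseteq> ?S" using cell_subset_box[OF I] box_subset_cbox[of a b] cbS by auto
    have "laplacian U x = laplacian (incident k0 x0) x + laplacian V x"
      unfolding U_eq
      by (rule laplacian_add[OF open_cell _ _ x]) (intro C2_on_subset[OF incident_C2(1)] sub, rule VC2_cell[OF I])
    also have "laplacian (incident k0 x0) x = - (of_real k0)\<^sup>2 * incident k0 x0 x"
      using incident_C2(2) x sub by blast
    also have "laplacian V x = - (of_real k0)\<^sup>2 * V x - f x" using cellT[OF I x] by blast
    finally have L: "laplacian U x = - (of_real k0)\<^sup>2 * incident k0 x0 x + (- (of_real k0)\<^sup>2 * V x - f x)" .
    show "laplacian U x + (kI I x)\<^sup>2 * U x = 0"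
      unfolding L f_def contrast_cell[OF I x] U[of x] by (simp add: algebra_simps)
  qed
  have helm_ext: "helmholtz_on (\<lambda>_. of_real k0) (- closure (box a b)) V"
    unfolding helmholtz_on_def
  proof (intro conjI ballI VC2_ext)
    fix x assume x: "x \<in> - closure (box a b)"
    have "laplacian V x = - (of_real k0)\<^sup>2 * V x - f x" using ext[OF x] by blast
    then show "laplacian V x + (of_real k0)\<^sup>2 * V x = 0" using f_ext[OF x] by simp
  qed
  have jump: "has_jump w (cell a b n I) x 0"
    if I: "I \<in> grid_index n" and x: "x \<in> frontier (cell a b n I)" and w: "continuous_on ?S w" for I x and w :: "real^3 \<Rightarrow> complex"
  proof -
    have "x \<in> closure (cell a b n I)" using x unfolding frontier_def by auto
    then have "x \<in> closure (box a b)" using closure_cell_subset[OF I] by blast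
    then have "x \<in> ?S" using x0 by auto
    then have "isCont w x" using w oS continuous_on_eq_continuous_at by blast
    then have "(w \<longlongrightarrow> w x) (at x within T)" for T
      unfolding isCont_def by (rule Lim_at_imp_Lim_at_within)
    then show ?thesis unfolding has_jump_def by (metis diff_self)
  qed
  have jump1: "has_jump (\<lambda>y. frechet_derivative U (at y) \<nu>) (cell a b n I) x 0"
    if I: "I \<in> grid_index n" and x: "x \<in> frontier (cell a b n I)" for I x \<nu>
  proof (rule jump[OF that])
    have "continuous_on ?S (\<lambda>y. \<Sum>j\<in>UNIV. (\<nu> $ j) *\<^sub>R pd j U y)"
      by (intro continuous_intros C1_on_pd_continuous[OF UC1])
    then show "continuous_on ?S (\<lambda>y. frechet_derivative U (at y) \<nu>)"
      by (rule continuous_on_eq) (simp add: has_grad_frechet[OF C1_on_has_grad[OF UC1]])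
  qed
  have scat: "(\<lambda>x. U x - incident k0 x0 x) = V" using U by auto
  have rad: "radiating k0 (\<lambda>x. U x - incident k0 x0 x)"
    unfolding scat V by (rule potential_radiating[OF fm fb f0 k0'])
  have "P1_solution a b n kI k0 x0 U"
    unfolding P1_solution_def
  proof (intro conjI ballI)
    show "\<exists>v. (\<forall>x\<in>- (closure (box a b) \<union> {x0}). v x = U x - incident k0 x0 x) \<and>
        helmholtz_on (\<lambda>_. of_real k0) (- closure (box a b)) v"
      using helm_ext U by (intro exI[of _ V]) auto
    show "H1_loc_on (- {x0}) U" by (rule H1_loc_of_C1[OF oS UC1])
  qed (use helm_cell jump[OF _ _ cU] jump1 rad in auto)
  then show ?thesis unfolding quasiclassical_def using UC1 UC2_cell UC2_ext by blast
qed

text \<open>The representative \<open>U\<close> is the right-hand side of the integral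
  equation, which is defined everywhere. It differs from \<open>u\<close> on a null set
  only, hence has the same potential.\<close>

lemma solution_of_integral_equation:
  assumes x0: "x0 \<notin> closure (box a b)" and L2: "L2_on (box a b) u"
    and eq: "AE x in lebesgue_on (box a b). u x - volume_potential (box a b) k k0 u x = incident k0 x0 x"
  shows "\<exists>U. (AE x in lebesgue_on (box a b). U x = u x) \<and>
             (\<forall>x. U x = incident k0 x0 x + volume_potential (box a b) k k0 u x) \<and>
             quasiclassical a b n kI k0 x0 U"
proof -
  have bl: "box a b \<inter> space lebesgue \<in> sets lebesgue" by simp
  define u' where "u' = (\<lambda>y. indicator (box a b) y *\<^sub>R u y)"
  have u'm: "u' \<in> borel_measurable lebesgue"
    using L2 unfolding L2_on_def u'_def borel_measurable_restrict_space_iff[OF bl] by blast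
  have "(\<lambda>y. Re (u' y)) \<in> borel_measurable (completion lborel)" "(\<lambda>y. Im (u' y)) \<in> borel_measurable (completion lborel)"
    using u'm by auto
  from this[THEN completion_ex_borel_measurable_real]
  obtain gr gi where gm: "gr \<in> borel_measurable lborel" "gi \<in> borel_measurable lborel"
    and ge: "AE y in lborel. Re (u' y) = gr y" "AE y in lborel. Im (u' y) = gi y"
    by blast
  have [measurable]: "gr \<in> borel_measurable borel" "gi \<in> borel_measurable borel" using gm by auto
  define g where "g y = indicator (box a b) y *\<^sub>R Complex (gr y) (gi y)" for y
  have "g = (\<lambda>y. indicator (box a b) y *\<^sub>R (of_real (gr y) + \<i> * of_real (gi y)))"
    unfolding g_def by (simp add: Complex_eq)
  then have gm' [measurable]: "g \<in> borel_measurable borel" by simp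
  have gu: "AE y in lborel. y \<in> box a b \<longrightarrow> u y = g y"
    using ge by eventually_elim (auto simp: u'_def g_def complex_eq_iff)
  have gu': "AE y in lebesgue. y \<in> box a b \<longrightarrow> u y = g y" using gu by (rule AE_completion)
  have vp: "volume_potential (box a b) k k0 u x = conv (rgreen k0 0) (\<lambda>y. contrast y * g y) x" for x
    by (rule volume_potential_eq_conv[OF gm' u'm[unfolded u'_def] gu'])
  obtain B where B: "\<And>y. norm (contrast y) \<le> B" using contrast_bounded by blast
  have g2: "integrable lborel (\<lambda>y. (norm (g y))\<^sup>2)"
  proof -
    have "integrable lebesgue (\<lambda>y. indicator (box a b) y *\<^sub>R (norm (u y))\<^sup>2)"
      using L2 unfolding L2_on_def integrable_restrict_space[OF bl] by blast
    moreover have "AE y in lebesgue. indicator (box a b) y *\<^sub>R (norm (u y))\<^sup>2 = (norm (g y))\<^sup>2"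
      using gu' by eventually_elim (auto simp: g_def indicator_def)
    moreover have "(\<lambda>y. (norm (g y))\<^sup>2) \<in> borel_measurable lebesgue" by (rule measurable_completion) simp
    ultimately have "integrable lebesgue (\<lambda>y. (norm (g y))\<^sup>2)"
      using integrable_cong_AE[of "\<lambda>y. indicator (box a b) y *\<^sub>R (norm (u y))\<^sup>2" lebesgue "\<lambda>y. (norm (g y))\<^sup>2"]
        borel_measurable_integrable by blast
    then show ?thesis by (subst (asm) integrable_completion) simp_all
  qed
  have qg2: "integrable lborel (\<lambda>y. (norm (contrast y * g y))\<^sup>2)"
  proof (rule Bochner_Integration.integrable_bound)
    show "integrable lborel (\<lambda>y. B\<^sup>2 * (norm (g y))\<^sup>2)" using g2 by simp
    show "AE y in lborel. norm ((norm (contrast y * g y))\<^sup>2) \<le> norm (B\<^sup>2 * (norm (g y))\<^sup>2)"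
      using B by (auto simp: norm_mult power_mult_distrib intro!: AE_I2 mult_right_mono power_mono)
  qed measurable
  have k0': "k0 \<ge> 0" using k0 by simp
  define V where "V = conv (rgreen k0 0) (\<lambda>y. contrast y * g y)"
  have cV: "continuous_on UNIV V"
    unfolding V_def by (rule L2_potential_continuous[OF _ qg2 _ k0', of box_radius]) (auto simp: contrast_far)
  define U where "U x = incident k0 x0 x + V x" for x
  have [measurable]: "V \<in> borel_measurable borel" by (rule borel_measurable_continuous_onI[OF cV])
  have Um [measurable]: "U \<in> borel_measurable borel" unfolding U_def by measurable
  have Uu: "AE x in lebesgue_on (box a b). U x = u x"
    using eq by eventually_elim (simp only: U_def V_def vp[symmetric], simp add: algebra_simps)
  have Ug: "AE y in lborel. contrast y * U y = contrast y * g y"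
  proof -
    have "AE y in lebesgue. y \<in> box a b \<longrightarrow> U y = u y"
      using Uu unfolding AE_restrict_space_iff[OF bl] .
    then have "AE y in lebesgue. contrast y * U y = contrast y * g y"
      using gu' by eventually_elim (auto simp: contrast_outside)
    then show ?thesis by (simp add: AE_completion_iff)
  qed
  have "conv (rgreen k0 0) (\<lambda>y. contrast y * U y) x = V x" for x
    unfolding V_def conv_def
    by (rule integral_cong_AE) (use Ug in \<open>auto elim: eventually_mono\<close>)
  then have "conv (rgreen k0 0) (\<lambda>y. contrast y * U y) = V" by (rule ext)
  then have "quasiclassical a b n kI k0 x0 U"
    using cV by (intro quasiclassical_of_representation[OF x0]) (simp_all add: U_def)
  then show ?thesis using Uu vp unfolding U_def V_def by auto
qed

end

section \<open>From the boundary value problem to the integral equation\<close>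

context scatterer
begin

text \<open>The scattered field, continued across \<open>x0\<close> by the exterior
  solution \<open>vE\<close>, is \<open>C\<^sup>1\<close> on the whole space and
  satisfies its equation classically off the grid planes, so
  \<open>radiating_representation\<close> applies to it.\<close>

lemma representation_of_quasiclassical:
  assumes x0: "x0 \<notin> closure (box a b)" and Q: "quasiclassical a b n kI k0 x0 u" and x: "x \<noteq> x0"
  shows "u x = incident k0 x0 x + volume_potential (box a b) k k0 u x"
proof -
  let ?S = "- {x0}" and ?X = "- closure (box a b)"
  have oS: "open ?S" and oX: "open ?X" by auto
  have P1: "P1_solution a b n kI k0 x0 u" and uC1: "C1_on ?S u" using Q unfolding quasiclassical_def by auto
  obtain vE where vE: "\<And>x. x \<in> - (closure (box a b) \<union> {x0}) \<Longrightarrow> vE x = u x - incident k0 x0 x"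
    and hE: "helmholtz_on (\<lambda>_. of_real k0) ?X vE"
    using P1 unfolding P1_solution_def by blast
  have hc: "helmholtz_on (kI I) (cell a b n I) u" if "I \<in> grid_index n" for I
    using P1 that unfolding P1_solution_def by blast
  have rad: "radiating k0 (\<lambda>x. u x - incident k0 x0 x)" using P1 unfolding P1_solution_def by blast
  have iC1: "C1_on ?S (incident k0 x0)" using incident_C2(1) unfolding C2_on_def by blast
  (* At x0 the difference u - incident is meaningless, since the Green function has the
     value 0 there by the convention for division. *)
  define v where "v x = (if x = x0 then vE x0 else u x - incident k0 x0 x)" for x
  have v_S: "u x - incident k0 x0 x = v x" if "x \<in> ?S" for x using that unfolding v_def by simp
  have v_X: "vE x = v x" if "x \<in> ?X" for x using vE[of x] that unfolding v_def by auto
  have dC1: "C1_on ?S (\<lambda>x. u x - incident k0 x0 x)" by (intro C1_on_diff uC1 iC1)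
  have vC1S: "C1_on ?S v" by (rule C1_on_cong[OF oS v_S dC1])
  have vC2X: "C2_on ?X v"
    by (rule C2_on_cong[OF oX v_X]) (use hE in \<open>simp_all add: helmholtz_on_def\<close>)
  have vC1: "C1_on UNIV v"
  proof (rule C1_on_local)
    fix y
    show "\<exists>T. open T \<and> y \<in> T \<and> C1_on T v"
    proof (cases "y = x0")
      case True
      then have "y \<in> ?X" using x0 by simp
      then show ?thesis using vC2X oX unfolding C2_on_def by blast
    next
      case False
      then have "y \<in> ?S" by simp
      then show ?thesis using vC1S oS by blast
    qed
  qed
  have subS: "cbox a b \<subseteq> ?S" using x0 unfolding closure_box by auto
  define g where "g y = indicator (box a b) y *\<^sub>R u y" for y
  have gm [measurable]: "g \<in> borel_measurable borel"
    unfolding g_def[abs_def]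
  proof (rule borel_measurable_continuous_on_indicator)
    show "continuous_on (box a b) u"
      using continuous_on_subset[OF C1_on_continuous[OF uC1]] subS box_subset_cbox[of a b] by blast
  qed simp
  define f where "f = (\<lambda>y. contrast y * g y)"
  have fm: "f \<in> borel_measurable borel" unfolding f_def by measurable
  obtain B where B: "\<And>y. norm (contrast y) \<le> B" using contrast_bounded by blast
  have "bounded (u ` cbox a b)"
    by (intro compact_imp_bounded compact_continuous_image
        continuous_on_subset[OF C1_on_continuous[OF uC1] subS] compact_cbox)
  then obtain M where M: "\<And>y. y \<in> cbox a b \<Longrightarrow> norm (u y) \<le> M" unfolding bounded_iff by blast
  have fb: "norm (f y) \<le> \<bar>B\<bar> * \<bar>M\<bar>" for y
  proof (cases "y \<in> box a b")
    case True
    then have "y \<in> cbox a b" using box_subset_cbox by blast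
    then show ?thesis using True unfolding f_def g_def norm_mult using B[of y] M[of y] by (intro mult_mono) auto
  qed (simp add: f_def contrast_outside)
  have f0: "f y = 0" if "box_radius \<le> norm y" for y unfolding f_def using contrast_far[OF that] by simp
  have fX: "f y = 0" if "y \<in> ?X" for y
    unfolding f_def using that contrast_outside[of y] closure_subset[of "box a b"] by auto
  define Pl where "Pl = (\<lambda>(j, i). (j, gp j i)) ` (UNIV \<times> {..n})"
  have fin: "finite Pl" unfolding Pl_def by simp
  have off: "\<exists>T. open T \<and> y \<in> T \<and> C2_on T v \<and> laplacian v y = - ((of_real k0)\<^sup>2 * v y + f y)"
    if "\<And>j c. (j, c) \<in> Pl \<Longrightarrow> y $ j \<noteq> c" for y
  proof -
    have nP: "y $ j \<noteq> gp j i" if "i \<le> n" for j i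
      using \<open>\<And>j c. (j, c) \<in> Pl \<Longrightarrow> y $ j \<noteq> c\<close>[of j "gp j i"] that unfolding Pl_def by force
    have "y \<in> ?X \<or> (\<exists>I. I \<in> grid_index n \<and> y \<in> cell a b n I)"
    proof (rule off_planes_cases[of y])
      show "y $ j \<noteq> gp j i" if "i \<le> n" for j i by (rule nP[OF that])
    qed blast+
    then consider "y \<in> ?X" | I where "I \<in> grid_index n" "y \<in> cell a b n I" by blast
    then show ?thesis
    proof cases
      case 1
      have "laplacian v y = laplacian vE y" by (rule laplacian_cong[OF oX 1]) (simp add: v_X)
      also have "\<dots> = - (of_real k0)\<^sup>2 * vE y"
        using hE 1 unfolding helmholtz_on_def by (simp add: eq_neg_iff_add_eq_0)
      finally have "laplacian v y = - ((of_real k0)\<^sup>2 * v y + f y)" using fX[OF 1] v_X[OF 1] by simp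
      then show ?thesis using oX 1 vC2X by blast
    next
      case (2 I)
      have cS: "cell a b n I \<subseteq> ?S" using cell_subset_box[OF 2(1)] box_subset_cbox[of a b] subS by blast
      have yb: "y \<in> box a b" using cell_subset_box[OF 2(1)] 2(2) by blast
      have uC2: "C2_on (cell a b n I) u" using hc[OF 2(1)] unfolding helmholtz_on_def by blast
      have iC2: "C2_on (cell a b n I) (incident k0 x0)" by (rule C2_on_subset[OF incident_C2(1) cS])
      have e: "u z - incident k0 x0 z = v z" if "z \<in> cell a b n I" for z using v_S that cS by blast
      have vC2: "C2_on (cell a b n I) v"
        by (rule C2_on_cong[OF open_cell e C2_on_diff[OF open_cell uC2 iC2]])
      have "laplacian v y = laplacian (\<lambda>z. u z - incident k0 x0 z) y"
        by (rule laplacian_cong[OF open_cell 2(2)]) (simp add: e)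
      also have "\<dots> = laplacian u y - laplacian (incident k0 x0) y"
        by (rule laplacian_diff[OF open_cell uC2 iC2 2(2)])
      also have "laplacian u y = - (kI I y)\<^sup>2 * u y"
        using hc[OF 2(1)] 2(2) unfolding helmholtz_on_def by (simp add: eq_neg_iff_add_eq_0)
      also have "laplacian (incident k0 x0) y = - (of_real k0)\<^sup>2 * incident k0 x0 y"
        by (rule incident_C2(2)) (use cS 2(2) in auto)
      finally have "laplacian v y = - ((of_real k0)\<^sup>2 * v y + f y)"
        unfolding f_def g_def contrast_cell[OF 2] e[OF 2(2), symmetric] using yb by (simp add: algebra_simps)
      then show ?thesis using open_cell 2(2) vC2 by blast
    qed
  qed
  have radv: "radiating k0 v"
  proof -
    have ev: "\<forall>\<^sub>F x in at_infinity.
        norm (frechet_derivative (\<lambda>x. u x - incident k0 x0 x) (at x) (x /\<^sub>R norm x) - \<i> * of_real k0 * (u x - incident k0 x0 x))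
        = norm (frechet_derivative v (at x) (x /\<^sub>R norm x) - \<i> * of_real k0 * v x)"
      unfolding eventually_at_infinity
    proof (intro exI allI impI)
      fix y :: "real^3" assume "norm x0 + 1 \<le> norm y"
      then have y: "y \<in> ?S" by auto
      have 1: "has_grad (\<lambda>x. u x - incident k0 x0 x) (\<lambda>j. pd j v y) y"
        by (rule has_grad_cong_open[OF oS y v_S[symmetric] C1_on_has_grad[OF vC1 UNIV_I]])
      have 2: "has_grad v (\<lambda>j. pd j v y) y" by (rule C1_on_has_grad[OF vC1 UNIV_I])
      show "norm (frechet_derivative (\<lambda>x. u x - incident k0 x0 x) (at y) (y /\<^sub>R norm y) - \<i> * of_real k0 * (u y - incident k0 x0 y))
        = norm (frechet_derivative v (at y) (y /\<^sub>R norm y) - \<i> * of_real k0 * v y)"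
        unfolding has_grad_frechet[OF 1] has_grad_frechet[OF 2] v_S[OF y] ..
    qed
    show ?thesis using rad landau_o.small.in_cong[OF ev] unfolding radiating_def by blast
  qed
  have "v x = conv (rgreen k0 0) f x"
    by (rule radiating_representation[where M="\<bar>B\<bar> * \<bar>M\<bar>", OF vC1 radv fm fb f0 k0 fin off])
  moreover have "volume_potential (box a b) k k0 u x = conv (rgreen k0 0) f x"
    unfolding f_def
  proof (rule volume_potential_eq_conv[OF gm])
    show "(\<lambda>y. indicator (box a b) y *\<^sub>R u y) \<in> borel_measurable lebesgue"
      unfolding g_def[abs_def, symmetric] by (rule measurable_completion) (use gm in simp)
    show "AE y in lebesgue. y \<in> box a b \<longrightarrow> u y = g y" unfolding g_def by simp
  qed
  ultimately show ?thesis using v_S[of x] x by (simp add: algebra_simps)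
qed

end

section \<open>The equivalence theorem\<close>

theorem theorem2:
  fixes a b x0 :: "real^3" and n :: nat and \<alpha> k0 :: real
    and kI :: "nat^3 \<Rightarrow> real^3 \<Rightarrow> complex" and k :: "real^3 \<Rightarrow> complex"
  assumes "\<And>j. a $ j < b $ j" and "n \<ge> 1"
    and "0 < \<alpha>" and "\<alpha> \<le> 1"
    and "\<And>I. I \<in> grid_index n \<Longrightarrow> holder_on \<alpha> (cell a b n I) (kI I)"
    and "\<And>x. x \<in> box a b \<Longrightarrow>
           k x = (\<Sum>I\<in>grid_index n. kI I x * of_real (indicator (cell a b n I) x))"
    and "k0 > 0" and "x0 \<notin> closure (box a b)"
  shows
    "(\<forall>u. quasiclassical a b n kI k0 x0 u \<longrightarrow>
        (\<forall>x \<in> box a b. u x - volume_potential (box a b) k k0 u x = incident k0 x0 x) \<and>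
        (\<forall>x \<in> - (box a b \<union> {x0}).
           u x = incident k0 x0 x + volume_potential (box a b) k k0 u x)) \<and>
     (\<forall>u. L2_on (box a b) u \<and>
        (AE x in lebesgue_on (box a b).
           u x - volume_potential (box a b) k k0 u x = incident k0 x0 x) \<longrightarrow>
        (\<exists>U. (AE x in lebesgue_on (box a b). U x = u x) \<and>
             (\<forall>x \<in> - (box a b \<union> {x0}).
                U x = incident k0 x0 x + volume_potential (box a b) k k0 u x) \<and>
             quasiclassical a b n kI k0 x0 U))"
proof -
  interpret scatterer a b n \<alpha> k0 kI k
    using assms by unfold_locales
  note x0 = assms(8)
  show ?thesis
  proof (intro conjI allI impI)
    fix u assume Q: "quasiclassical a b n kI k0 x0 u"
    have "x \<noteq> x0" if "x \<in> box a b" for x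
      using that x0 closure_subset[of "box a b"] by auto
    then show "\<forall>x\<in>box a b. u x - volume_potential (box a b) k k0 u x = incident k0 x0 x"
      using representation_of_quasiclassical[OF x0 Q] by (metis add_diff_cancel_right')
    show "\<forall>x\<in>- (box a b \<union> {x0}). u x = incident k0 x0 x + volume_potential (box a b) k k0 u x"
      using representation_of_quasiclassical[OF x0 Q] by blast
  next
    fix u
    assume "L2_on (box a b) u \<and>
        (AE x in lebesgue_on (box a b). u x - volume_potential (box a b) k k0 u x = incident k0 x0 x)"
    then show "\<exists>U. (AE x in lebesgue_on (box a b). U x = u x) \<and>
             (\<forall>x \<in> - (box a b \<union> {x0}).
                U x = incident k0 x0 x + volume_potential (box a b) k k0 u x) \<and>
             quasiclassical a b n kI k0 x0 U"
      using solution_of_integral_equation[OF x0, of u] by blast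
  qed
qed

end
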